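(* Let $T\subset\mathbb{R}^d$ be compact, $X=(X(t),t\in T)$ a real-valued centered Gaussian random field with continuous sample paths and covariance $R_X(s,t)$, and let $\xi:[0,1]\to T$ be continuous with $\xi(0)=a$, $\xi(1)=b$. Let $C_X(\xi)=\inf\{EH^2: H\in\mathcal{L},\ w_H(\xi(v))>1 \text{ for all } 0\le v\le1\}$. (i) With $\Psi_{a,b}(u;\xi)=P(X(\xi(v))>u,\ 0\le v\le1)$, $$\lim_{u\to\infty}\frac1{u^2}\log\Psi_{a,b}(u;\xi)=-\frac12C_X(\xi).$$ (ii) $C_X(\xi)=\inf\{EH^2: H\in\mathcal{L},\ E[X(\xi(v))H]\ge1,\ 0\le v\le1\}$, and if the feasible set of this latter problem is nonempty, its infimum is attained at a unique $H_\xi\in\mathcal{L}$. (iii) The set $\mathcal{W}_\xi$ of $\mu\in M_1^+([0,1])$ at which $\min_{\mu\in M_1^+([0,1])}\int_0^1\int_0^1R_X(\xi(u),\xi(v))\mu(du)\mu(dv)$ is attained is a weakly compact convex subset of $M_1^+([0,1])$. Moreover, if the feasible set in (ii) is nonempty, then for every $\mu\in\mathcal{W}_\xi$, $$\mu\big(\{0\le v\le1:\ E[X(\xi(v))H_\xi]>1\}\big)=0.$$ (iv) If the feasible set in (ii) is nonempty, then for every $\varepsilon>0$, $$P\Big(\sup_{0\le v\le1}\Big|\frac1uX(\xi(v))-x_\xi(v)\Big|\ge\varepsilon\ \Big|\ X(\xi(v))>u,\ 0\le v\le1\Big)\to0\quad(u\to\infty),$$ where $x_\xi(v)=E[X(\xi(v))H_\xi]$,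 $0\le v\le 1$.
   Context: $\mathcal{L}$ is the closure in $L^2(P)$ of finite linear combinations $\sum_j a_jX(t_j)$, $t_j\in T$; for $H\in\mathcal{L}$, $w_H(t)=E(X(t)H)$. $M_1^+([0,1])$ is the set of Borel probability measures on $[0,1]$ with the weak topology. $\inf\emptyset=+\infty$. *)

theory Defs
  imports "HOL-Probability.Probability"
begin

definition centered_normal_rv :: "'a measure \<Rightarrow> ('a \<Rightarrow> real) \<Rightarrow> bool" where
  "centered_normal_rv M Y \<longleftrightarrow> Y \<in> borel_measurable M \<and>
     ((AE \<omega> in M. Y \<omega> = 0) \<or>
      (\<exists>\<sigma>>0. distributed M lborel Y (normal_density 0 \<sigma>)))"

definition lin_combs :: "('t \<Rightarrow> 'a \<Rightarrow> real) \<Rightarrow> 't set \<Rightarrow> ('a \<Rightarrow> real) set" where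
  "lin_combs X T = {Y. \<exists>(n::nat) (c::nat \<Rightarrow> real) (t::nat \<Rightarrow> 't).
      (\<forall>j<n. t j \<in> T) \<and> Y = (\<lambda>\<omega>. \<Sum>j<n. c j * X (t j) \<omega>)}"

definition centered_gaussian_field :: "'a measure \<Rightarrow> ('t \<Rightarrow> 'a \<Rightarrow> real) \<Rightarrow> 't set \<Rightarrow> bool" where
  "centered_gaussian_field M X T \<longleftrightarrow> prob_space M \<and>
     (\<forall>t\<in>T. X t \<in> borel_measurable M) \<and>
     (\<forall>Y\<in>lin_combs X T. centered_normal_rv M Y)"

text \<open>The Gaussian space: closure in L2(P) of the finite linear combinations
  (elements represented by square-integrable random variables).\<close>
definition gauss_space :: "'a measure \<Rightarrow> ('t \<Rightarrow> 'a \<Rightarrow> real) \<Rightarrow> 't set \<Rightarrow> ('a \<Rightarrow> real) set" where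
  "gauss_space M X T = {H. H \<in> borel_measurable M \<and> integrable M (\<lambda>\<omega>. (H \<omega>)\<^sup>2) \<and>
     (\<exists>Y. (\<forall>n. Y n \<in> lin_combs X T) \<and>
          (\<lambda>n. integral\<^sup>L M (\<lambda>\<omega>. (Y n \<omega> - H \<omega>)\<^sup>2)) \<longlonglongrightarrow> 0)}"

definition wH :: "'a measure \<Rightarrow> ('t \<Rightarrow> 'a \<Rightarrow> real) \<Rightarrow> ('a \<Rightarrow> real) \<Rightarrow> 't \<Rightarrow> real" where
  "wH M X H t = integral\<^sup>L M (\<lambda>\<omega>. X t \<omega> * H \<omega>)"

definition covar :: "'a measure \<Rightarrow> ('t \<Rightarrow> 'a \<Rightarrow> real) \<Rightarrow> 't \<Rightarrow> 't \<Rightarrow> real" where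
  "covar M X s t = integral\<^sup>L M (\<lambda>\<omega>. X s \<omega> * X t \<omega>)"

text \<open>C_X(xi), with inf of the empty set = +infinity.\<close>
definition CX :: "'a measure \<Rightarrow> ('t \<Rightarrow> 'a \<Rightarrow> real) \<Rightarrow> 't set \<Rightarrow> (real \<Rightarrow> 't) \<Rightarrow> ereal" where
  "CX M X T \<xi> = Inf {ereal (integral\<^sup>L M (\<lambda>\<omega>. (H \<omega>)\<^sup>2)) | H.
      H \<in> gauss_space M X T \<and> (\<forall>v\<in>{0..1}. wH M X H (\<xi> v) > 1)}"

definition feasible2 :: "'a measure \<Rightarrow> ('t \<Rightarrow> 'a \<Rightarrow> real) \<Rightarrow> 't set \<Rightarrow> (real \<Rightarrow> 't) \<Rightarrow> ('a \<Rightarrow> real) \<Rightarrow> bool" where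
  "feasible2 M X T \<xi> H \<longleftrightarrow> H \<in> gauss_space M X T \<and> (\<forall>v\<in>{0..1}. wH M X H (\<xi> v) \<ge> 1)"

definition Psi :: "'a measure \<Rightarrow> ('t \<Rightarrow> 'a \<Rightarrow> real) \<Rightarrow> (real \<Rightarrow> 't) \<Rightarrow> real \<Rightarrow> real" where
  "Psi M X \<xi> u = measure M {\<omega>\<in>space M. \<forall>v\<in>{0..1}. X (\<xi> v) \<omega> > u}"

definition eln :: "real \<Rightarrow> ereal" where
  "eln x = (if x > 0 then ereal (ln x) else -\<infinity>)"

definition M1_01 :: "real measure set" where
  "M1_01 = {\<mu>. prob_space \<mu> \<and> sets \<mu> = sets (restrict_space borel {0..1})}"

definition weak_top :: "real measure topology" where
  "weak_top = topology_generated_by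
     {{\<mu>\<in>M1_01. integral\<^sup>L \<mu> f \<in> U} | (f :: real \<Rightarrow> real) (U :: real set). continuous_on {0..1} f \<and> open U}"

definition mix_measure :: "real \<Rightarrow> real measure \<Rightarrow> real measure \<Rightarrow> real measure" where
  "mix_measure p \<mu> \<nu> = measure_of {0..1} (sets (restrict_space borel {0..1}))
     (\<lambda>A. ennreal p * emeasure \<mu> A + ennreal (1 - p) * emeasure \<nu> A)"

definition measure_convex :: "real measure set \<Rightarrow> bool" where
  "measure_convex W \<longleftrightarrow> (\<forall>\<mu>\<in>W. \<forall>\<nu>\<in>W. \<forall>p\<in>{0..1}. mix_measure p \<mu> \<nu> \<in> W)"

definition quad_form :: "'a measure \<Rightarrow> ('t \<Rightarrow> 'a \<Rightarrow> real) \<Rightarrow> (real \<Rightarrow> 't) \<Rightarrow> real measure \<Rightarrow> real" where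
  "quad_form M X \<xi> \<mu> = (\<integral>u. (\<integral>v. covar M X (\<xi> u) (\<xi> v) \<partial>\<mu>) \<partial>\<mu>)"

definition W_set :: "'a measure \<Rightarrow> ('t \<Rightarrow> 'a \<Rightarrow> real) \<Rightarrow> (real \<Rightarrow> 't) \<Rightarrow> real measure set" where
  "W_set M X \<xi> = {\<mu>\<in>M1_01. \<forall>\<nu>\<in>M1_01. quad_form M X \<xi> \<mu> \<le> quad_form M X \<xi> \<nu>}"

end

theory Submission
  imports Defs
begin

text \<open>
  For a probability measure \<open>\<mu>\<close> on the unit interval let \<open>Z\<close> be the pathwise integral of
  \<open>X (\<xi> v)\<close> against \<open>\<mu>\<close>. It lies in the Gaussian space, pairs with \<open>H\<close> as the integral of
  \<open>w\<^sub>H (\<xi> v)\<close>, and its variance is the quadratic form of \<open>\<mu>\<close>. If \<open>\<mu>\<close> is a minimiser, with value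
  \<open>q\<close>, the first-order condition in the direction of a point mass says that \<open>Z / q\<close> is feasible, while
  Cauchy-Schwarz shows that every feasible \<open>H\<close> has variance at least \<open>1 / q\<close>. Hence \<open>C = 1 / q\<close> and
  \<open>H = Z / q\<close> is the optimum; if \<open>q = 0\<close> then \<open>Z\<close> vanishes and exceedances have probability zero.

  On the exceedance event \<open>Z\<close> is at least \<open>u\<close>, which gives the upper bound for its probability. For the
  lower bound and the conditional limit write \<open>X = w H / C + y\<close>: the remainder \<open>y\<close> is uncorrelated with,
  hence independent of \<open>H\<close>, and Fernique's rotation argument gives its supremum Gaussian tails.
  Equality of Gaussian laws is only needed on boxes; it follows from the one-dimensional uniqueness
  theorem for characteristic functions by replacing one trigonometric factor after the other by an
  indicator. Existence and compactness of minimisers follow from Helly's theorem.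
\<close>

section \<open>Laws determined by characteristic functions\<close>

text \<open>Everything Gaussian is drawn from one identity,
  \<open>E cos (\<theta> + Z) = cos \<theta> * exp (- E Z^2 / 2)\<close>. It covers degenerate
  variables, passes to mean square limits, and its phase encodes both the real and the imaginary
  part of a characteristic function. A Gaussian tail of the remainder \<open>y\<close> matters for
  the conditional limit: the lower bound for the exceedance probability falls short of
  \<open>exp (- C u^2 / 2)\<close> by a factor of order \<open>exp (- L u)\<close>, and a merely
  vanishing tail could not beat that loss. Integrals against \<mu> are handled by Riemann sums.
  Along a path these are finite linear combinations of field values, which places \<open>Z\<close>
  in the Gaussian space and interchanges expectation and integral without a Fubini argument. Helly's
  theorem speaks of sequences, whereas weak compactness concerns covers in a topology given by a
  subbase. The gap is closed by recording \<mu> through its countably many integrals of Bernstein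
  polynomials: every weakly open set is a preimage under these coordinates, and their target is
  metrisable.\<close>

lemma weighted_law_unique:
  fixes U :: "'a \<Rightarrow> real" and V :: "'b \<Rightarrow> real"
  assumes g: "integrable P g" "\<And>\<omega>. \<omega> \<in> space P \<Longrightarrow> 0 \<le> g \<omega>" and U: "U \<in> borel_measurable P"
    and h: "integrable Q h" "\<And>\<omega>. \<omega> \<in> space Q \<Longrightarrow> 0 \<le> h \<omega>" and V: "V \<in> borel_measurable Q"
    and eq: "\<And>s \<phi>. (\<integral>\<omega>. g \<omega> * cos (\<phi> + s * U \<omega>) \<partial>P) = (\<integral>\<omega>. h \<omega> * cos (\<phi> + s * V \<omega>) \<partial>Q)"
    and B: "B \<in> sets borel"
  shows "(\<integral>\<omega>. g \<omega> * indicator B (U \<omega>) \<partial>P) = (\<integral>\<omega>. h \<omega> * indicator B (V \<omega>) \<partial>Q)"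
proof -
  define c where "c = (\<integral>\<omega>. g \<omega> \<partial>P)"
  \<comment> \<open>Frequency and phase 0 compare the total masses, so both weights are normalised
    by the same \<open>c\<close>.\<close>
  have c': "c = (\<integral>\<omega>. h \<omega> \<partial>Q)" using eq[of 0 0] by (simp add: c_def)
  have c0: "c \<ge> 0" unfolding c_def using g by (intro integral_nonneg_AE) auto
  have vanish: "(\<integral>\<omega>. k \<omega> * indicator B (W \<omega>) \<partial>R) = 0"
    if "integrable R k" "\<And>\<omega>. \<omega> \<in> space R \<Longrightarrow> 0 \<le> k \<omega>" "(\<integral>\<omega>. k \<omega> \<partial>R) = 0" for k :: "'c \<Rightarrow> real" and R W
  proof -
    have "AE \<omega> in R. k \<omega> = 0"
      using integral_nonneg_eq_0_iff_AE[of R k] that by auto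
    then have "AE \<omega> in R. k \<omega> * indicator B (W \<omega>) = (0::real)" by auto
    then show ?thesis by (rule integral_eq_zero_AE)
  qed
  have key: "prob_space (density R (\<lambda>x. k x / c))
     \<and> real_distribution (distr (density R (\<lambda>x. k x / c)) borel W)
     \<and> (\<forall>s. char (distr (density R (\<lambda>x. k x / c)) borel W) s
          = Complex ((\<integral>\<omega>. k \<omega> * cos (s * W \<omega>) \<partial>R) / c) ((\<integral>\<omega>. k \<omega> * sin (s * W \<omega>) \<partial>R) / c))
     \<and> measure (distr (density R (\<lambda>x. k x / c)) borel W) B = (\<integral>\<omega>. k \<omega> * indicator B (W \<omega>) \<partial>R) / c"
    if k: "integrable R k" "\<And>\<omega>. \<omega> \<in> space R \<Longrightarrow> 0 \<le> k \<omega>" "(\<integral>\<omega>. k \<omega> \<partial>R) = c" "c > 0"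
      and W: "W \<in> borel_measurable R" for k :: "'c \<Rightarrow> real" and R W
  proof -
    let ?D = "density R (\<lambda>x. k x / c)"
    have [measurable]: "k \<in> borel_measurable R" "W \<in> borel_measurable R" using k W by auto
    have pos: "AE x in R. 0 \<le> k x / c" using k by auto
    have "emeasure ?D (space ?D) = (\<integral>\<^sup>+x. ennreal (k x / c) \<partial>R)"
      by (simp add: emeasure_density nn_integral_cong_AE cong: nn_integral_cong)
    also have "\<dots> = ennreal (\<integral>x. k x / c \<partial>R)"
      using k pos by (intro nn_integral_eq_integral) auto
    also have "\<dots> = 1" using k by simp
    finally have p: "prob_space ?D" by (rule prob_spaceI)
    have rd: "real_distribution (distr ?D borel W)"
      by (intro prob_space.real_distribution_distr[OF p]) simp
    have ic: "integrable R (\<lambda>\<omega>. k \<omega> * cos (s * W \<omega>))" for s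
      by (rule Bochner_Integration.integrable_bound[OF k(1)]) (auto simp: abs_mult mult_left_le)
    have is': "integrable R (\<lambda>\<omega>. k \<omega> * sin (s * W \<omega>))" for s
      by (rule Bochner_Integration.integrable_bound[OF k(1)]) (auto simp: abs_mult mult_left_le)
    have ch: "char (distr ?D borel W) s
       = Complex ((\<integral>\<omega>. k \<omega> * cos (s * W \<omega>) \<partial>R) / c) ((\<integral>\<omega>. k \<omega> * sin (s * W \<omega>) \<partial>R) / c)" for s
    proof -
      have "char (distr ?D borel W) s = (\<integral>\<omega>. (k \<omega> / c) *\<^sub>R iexp (s * W \<omega>) \<partial>R)"
        unfolding char_def by (subst integral_distr) (auto intro!: integral_density pos)
      also have "\<dots> = (\<integral>\<omega>. complex_of_real (k \<omega> * cos (s * W \<omega>) / c) + \<i> * complex_of_real (k \<omega> * sin (s * W \<omega>) / c) \<partial>R)"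
        by (intro Bochner_Integration.integral_cong) (auto simp: complex_eq_iff Re_exp Im_exp)
      also have "\<dots> = complex_of_real (\<integral>\<omega>. k \<omega> * cos (s * W \<omega>) / c \<partial>R) + \<i> * complex_of_real (\<integral>\<omega>. k \<omega> * sin (s * W \<omega>) / c \<partial>R)"
        using ic[of s] is'[of s] 
        by (subst Bochner_Integration.integral_add)
           (auto intro!: integrable_of_real integrable_divide_zero simp del: of_real_mult of_real_divide)
      finally show ?thesis by (simp add: complex_eq_iff)
    qed
    have "measure (distr ?D borel W) B = (\<integral>x. indicator B x \<partial>distr ?D borel W)"
      using B by simp
    also have "\<dots> = (\<integral>\<omega>. (k \<omega> / c) *\<^sub>R indicator B (W \<omega>) \<partial>R)"
      using B pos by (subst integral_distr) (auto simp: integral_density)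
    also have "\<dots> = (\<integral>\<omega>. k \<omega> * indicator B (W \<omega>) \<partial>R) / c" by simp
    finally show ?thesis using p rd ch by blast
  qed
  show ?thesis
  proof (cases "c = 0")
    case True
    then show ?thesis using vanish[OF g] vanish[OF h] c_def c' by simp
  next
    case False
    then have cp: "c > 0" using c0 by simp
    note k1 = key[OF g c_def[symmetric] cp U] and k2 = key[OF h c'[symmetric] cp V]
    \<comment> \<open>A quarter period of phase turns cosine into sine: phases 0 and -pi/2 of the
      hypothesis give the real and the imaginary part of the two characteristic functions.\<close>
    have sc: "sin x = cos (- (pi/2) + x)" for x :: real
      using sin_cos_eq[of x] cos_minus[of "pi/2 - x"] by simp
    have "char (distr (density P (\<lambda>x. g x / c)) borel U) = char (distr (density Q (\<lambda>x. h x / c)) borel V)"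
      using k1 k2 eq[of 0] eq[of "- (pi/2)"] by (auto simp: fun_eq_iff sc)
    then have "distr (density P (\<lambda>x. g x / c)) borel U = distr (density Q (\<lambda>x. h x / c)) borel V"
      using k1 k2 by (intro Levy_uniqueness) auto
    then show ?thesis using k1 k2 cp by auto
  qed
qed

text \<open>Indicator of a box, kept as a product so that the induction can split off its last
  factor.\<close>

definition cyl :: "(nat \<Rightarrow> real set) \<Rightarrow> nat \<Rightarrow> (nat \<Rightarrow> 'a \<Rightarrow> real) \<Rightarrow> 'a \<Rightarrow> real" where
  "cyl A m W \<omega> = (\<Prod>k<m. indicator (A k) (W k \<omega>))"

text \<open>A named constant, so that the tail of the phase stays one opaque term while
  trigonometric identities are applied around it.\<close>

definition tsum :: "(nat \<Rightarrow> real) \<Rightarrow> nat \<Rightarrow> nat \<Rightarrow> (nat \<Rightarrow> 'a \<Rightarrow> real) \<Rightarrow> 'a \<Rightarrow> real" where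
  "tsum t m n W \<omega> = (\<Sum>k\<in>{m..<n}. t k * W k \<omega>)"

text \<open>One coordinate after the other is moved out of the phase and into an indicator. The
  weight in front of the current coordinate must be nonnegative for
  \<open>weighted_law_unique\<close>, so the cosine of the remaining coordinates is used in the form
  1 + cos and recovered afterwards.\<close>

lemma finite_dim_law_unique:
  fixes U :: "nat \<Rightarrow> 'a \<Rightarrow> real" and V :: "nat \<Rightarrow> 'b \<Rightarrow> real"
  assumes P: "prob_space P" and Q: "prob_space Q"
    and U: "\<And>k. k < n \<Longrightarrow> U k \<in> borel_measurable P" and V: "\<And>k. k < n \<Longrightarrow> V k \<in> borel_measurable Q"
    and eq: "\<And>t \<theta>. (\<integral>\<omega>. cos (\<theta> + (\<Sum>k<n. t k * U k \<omega>)) \<partial>P) = (\<integral>\<omega>. cos (\<theta> + (\<Sum>k<n. t k * V k \<omega>)) \<partial>Q)"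
    and A: "\<And>k. k < n \<Longrightarrow> A k \<in> sets borel"
  shows "measure P {\<omega>\<in>space P. \<forall>k<n. U k \<omega> \<in> A k} = measure Q {\<omega>\<in>space Q. \<forall>k<n. V k \<omega> \<in> A k}"
proof -
  interpret P: prob_space P by fact
  interpret Q: prob_space Q by fact
  have I01: "0 \<le> cyl A m W \<omega>" "cyl A m W \<omega> \<le> 1" for m and W :: "nat \<Rightarrow> 'c \<Rightarrow> real" and \<omega>
    unfolding cyl_def by (auto intro!: prod_nonneg prod_le_1)
  have Imeas: "cyl A m W \<in> borel_measurable R" if "m \<le> n" "\<And>k. k < n \<Longrightarrow> W k \<in> borel_measurable R"
    for m R and W :: "nat \<Rightarrow> 'c \<Rightarrow> real"
    unfolding cyl_def using that A
    by (intro borel_measurable_prod) (auto intro!: measurable_compose[OF _ borel_measurable_indicator])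
  have Smeas: "(\<lambda>\<omega>. \<Sum>k\<in>{m..<n}. t k * W k \<omega>) \<in> borel_measurable R" if "\<And>k. k < n \<Longrightarrow> W k \<in> borel_measurable R"
    for m t R and W :: "nat \<Rightarrow> 'c \<Rightarrow> real"
    using that by (intro borel_measurable_sum borel_measurable_times) auto
  have bnd: "integrable R (\<lambda>\<omega>. f \<omega> * cyl A m W \<omega> * cos (g \<omega>))"
    if "prob_space R" "m \<le> n" "\<And>k. k < n \<Longrightarrow> W k \<in> borel_measurable R" "g \<in> borel_measurable R"
      "f \<in> borel_measurable R" "\<And>\<omega>. \<bar>f \<omega>\<bar> \<le> 2"
    for R m f g and W :: "nat \<Rightarrow> 'c \<Rightarrow> real"
  proof -
    interpret prob_space R by fact
    have [measurable]: "cyl A m W \<in> borel_measurable R" "g \<in> borel_measurable R" "f \<in> borel_measurable R" 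
      using Imeas that by auto
    have "\<bar>f \<omega>\<bar> * \<bar>cyl A m W \<omega>\<bar> * \<bar>cos (g \<omega>)\<bar> \<le> 2 * 1 * 1" for \<omega>
      using I01[of m W \<omega>] that(6) by (intro mult_mono) auto
    then show ?thesis by (intro integrable_const_bound[where B=2]) (auto simp: abs_mult)
  qed
  \<comment> \<open>Invariant: coordinates below m are already indicators, those from m on still sit
    in the phase. At m = 0 this is the hypothesis, at m = n the claim.\<close>
  have main: "m \<le> n \<Longrightarrow> (\<integral>\<omega>. cyl A m U \<omega> * cos (\<theta> + (\<Sum>k\<in>{m..<n}. t k * U k \<omega>)) \<partial>P)
     = (\<integral>\<omega>. cyl A m V \<omega> * cos (\<theta> + (\<Sum>k\<in>{m..<n}. t k * V k \<omega>)) \<partial>Q)" for m t \<theta>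
  proof (induction m arbitrary: t \<theta>)
    case 0
    then show ?case using eq by (simp add: cyl_def lessThan_atLeast0)
  next
    case (Suc m t \<theta>)
    then have m: "m < n" and IH: "\<And>t \<theta>. (\<integral>\<omega>. cyl A m U \<omega> * cos (\<theta> + (\<Sum>k\<in>{m..<n}. t k * U k \<omega>)) \<partial>P)
     = (\<integral>\<omega>. cyl A m V \<omega> * cos (\<theta> + (\<Sum>k\<in>{m..<n}. t k * V k \<omega>)) \<partial>Q)" by auto
    have S: "(\<Sum>k\<in>{m..<n}. (r(m := s)) k * W k \<omega>) = s * W m \<omega> + (\<Sum>k\<in>{Suc m..<n}. r k * W k \<omega>)" 
      for s r \<omega> and W :: "nat \<Rightarrow> 'c \<Rightarrow> real"
      using m by (subst sum.atLeast_Suc_lessThan) auto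
    have int: "integrable R (\<lambda>\<omega>. cyl A m W \<omega> * cos (\<phi> + s * W m \<omega>))"
       "integrable R (\<lambda>\<omega>. cyl A m W \<omega> * cos (\<phi> + \<theta> + s * W m \<omega> + tsum t (Suc m) n W \<omega>))"
       "integrable R (\<lambda>\<omega>. cyl A m W \<omega> * cos (\<phi> - \<theta> + s * W m \<omega> - tsum t (Suc m) n W \<omega>))"
       "integrable R (\<lambda>\<omega>. (1 + cos (\<theta> + tsum t (Suc m) n W \<omega>)) * cyl A m W \<omega>)"
       "integrable R (\<lambda>\<omega>. (1 + cos (\<theta> + tsum t (Suc m) n W \<omega>)) * cyl A (Suc m) W \<omega>)"
      if "prob_space R" "\<And>k. k < n \<Longrightarrow> W k \<in> borel_measurable R" for R s \<phi> \<theta> and W :: "nat \<Rightarrow> 'c \<Rightarrow> real"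
    proof -
      have [measurable]: "tsum t (Suc m) n W \<in> borel_measurable R" using Smeas[of W R] that unfolding tsum_def by auto
      have [measurable]: "W m \<in> borel_measurable R" using that m by auto
      have b: "\<bar>1 + cos x\<bar> \<le> 2" for x :: real using cos_ge_minus_one[of x] cos_le_one[of x] unfolding abs_le_iff by linarith
      show "integrable R (\<lambda>\<omega>. cyl A m W \<omega> * cos (\<phi> + s * W m \<omega>))"
       "integrable R (\<lambda>\<omega>. cyl A m W \<omega> * cos (\<phi> + \<theta> + s * W m \<omega> + tsum t (Suc m) n W \<omega>))"
       "integrable R (\<lambda>\<omega>. cyl A m W \<omega> * cos (\<phi> - \<theta> + s * W m \<omega> - tsum t (Suc m) n W \<omega>))"
        using bnd[of R m W "\<lambda>\<omega>. \<phi> + s * W m \<omega>" "\<lambda>_. 1", OF that(1) _ that(2)]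
          bnd[of R m W "\<lambda>\<omega>. \<phi> + \<theta> + s * W m \<omega> + tsum t (Suc m) n W \<omega>" "\<lambda>_. 1", OF that(1) _ that(2)]
          bnd[of R m W "\<lambda>\<omega>. \<phi> - \<theta> + s * W m \<omega> - tsum t (Suc m) n W \<omega>" "\<lambda>_. 1", OF that(1) _ that(2)] m by auto
      show "integrable R (\<lambda>\<omega>. (1 + cos (\<theta> + tsum t (Suc m) n W \<omega>)) * cyl A m W \<omega>)"
        using bnd[of R m W "\<lambda>_. 0" "\<lambda>\<omega>. 1 + cos (\<theta> + tsum t (Suc m) n W \<omega>)", OF that(1) _ that(2)] m b by auto
      show "integrable R (\<lambda>\<omega>. (1 + cos (\<theta> + tsum t (Suc m) n W \<omega>)) * cyl A (Suc m) W \<omega>)"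
        using bnd[of R "Suc m" W "\<lambda>_. 0" "\<lambda>\<omega>. 1 + cos (\<theta> + tsum t (Suc m) n W \<omega>)", OF that(1) _ that(2)] m b by auto
    qed
    \<comment> \<open>Product-to-sum: cosine in coordinate m times 1 + cos of the tail is a
      combination of three cosines. Each carries coefficient s at m and 0, t or -t beyond it, hence
      is an instance of the induction hypothesis.\<close>
    have expand: "(\<integral>\<omega>. (1 + cos (\<theta> + tsum t (Suc m) n W \<omega>)) * cyl A m W \<omega> * cos (\<phi> + s * W m \<omega>) \<partial>R)
      = (\<integral>\<omega>. cyl A m W \<omega> * cos (\<phi> + (\<Sum>k\<in>{m..<n}. ((\<lambda>_. 0)(m := s)) k * W k \<omega>)) \<partial>R)
       + ((\<integral>\<omega>. cyl A m W \<omega> * cos (\<phi> + \<theta> + (\<Sum>k\<in>{m..<n}. (t(m := s)) k * W k \<omega>)) \<partial>R)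
       + (\<integral>\<omega>. cyl A m W \<omega> * cos (\<phi> - \<theta> + (\<Sum>k\<in>{m..<n}. ((\<lambda>k. - t k)(m := s)) k * W k \<omega>)) \<partial>R)) / 2"
      if R: "prob_space R" and W: "\<And>k. k < n \<Longrightarrow> W k \<in> borel_measurable R" for R s \<phi> \<theta> and W :: "nat \<Rightarrow> 'c \<Rightarrow> real"
    proof -
      have ring: "(1 + c) * b * d = b * d + (b * p + b * q) / 2" if "b * (c * d) = b * ((p + q) / 2)" for b c d p q :: real
        using that by (simp add: algebra_simps)
      have pt: "(1 + cos (\<theta> + tsum t (Suc m) n W \<omega>)) * cyl A m W \<omega> * cos (\<phi> + s * W m \<omega>)
        = cyl A m W \<omega> * cos (\<phi> + s * W m \<omega>) + (cyl A m W \<omega> * cos (\<phi> + \<theta> + s * W m \<omega> + tsum t (Suc m) n W \<omega>)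
          + cyl A m W \<omega> * cos (\<phi> - \<theta> + s * W m \<omega> - tsum t (Suc m) n W \<omega>)) / 2" for \<omega>
      proof -
        have "cos (\<theta> + tsum t (Suc m) n W \<omega>) * cos (\<phi> + s * W m \<omega>)
          = (cos (\<phi> + \<theta> + s * W m \<omega> + tsum t (Suc m) n W \<omega>) + cos (\<phi> - \<theta> + s * W m \<omega> - tsum t (Suc m) n W \<omega>)) / 2"
          using cos_times_cos[of "\<phi> + s * W m \<omega>" "\<theta> + tsum t (Suc m) n W \<omega>"] by (simp add: algebra_simps)
        then have "cyl A m W \<omega> * (cos (\<theta> + tsum t (Suc m) n W \<omega>) * cos (\<phi> + s * W m \<omega>))
          = cyl A m W \<omega> * ((cos (\<phi> + \<theta> + s * W m \<omega> + tsum t (Suc m) n W \<omega>) + cos (\<phi> - \<theta> + s * W m \<omega> - tsum t (Suc m) n W \<omega>)) / 2)"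
          by simp
        then show ?thesis by (rule ring)
      qed
      have tl: "\<phi> + (s * W m \<omega> + (\<Sum>k\<in>{Suc m..<n}. 0 * W k \<omega>)) = \<phi> + s * W m \<omega>"
        "\<phi> + \<theta> + (s * W m \<omega> + (\<Sum>k\<in>{Suc m..<n}. t k * W k \<omega>)) = \<phi> + \<theta> + s * W m \<omega> + tsum t (Suc m) n W \<omega>"
        "\<phi> - \<theta> + (s * W m \<omega> + (\<Sum>k\<in>{Suc m..<n}. - t k * W k \<omega>)) = \<phi> - \<theta> + s * W m \<omega> - tsum t (Suc m) n W \<omega>" for \<omega>
        by (simp_all add: tsum_def sum_negf)
      show ?thesis unfolding pt S tl
        by (simp only: Bochner_Integration.integral_add integral_divide_zero integrable_divide_zero
            Bochner_Integration.integrable_add int[of R W, OF R W])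
    qed
    have box_Suc: "cyl A (Suc m) W \<omega> = cyl A m W \<omega> * indicator (A m) (W m \<omega>)" for W :: "nat \<Rightarrow> 'c \<Rightarrow> real" and \<omega>
      by (simp add: cyl_def)
    have step: "(\<integral>\<omega>. (1 + cos (\<theta> + tsum t (Suc m) n U \<omega>)) * cyl A (Suc m) U \<omega> \<partial>P)
       = (\<integral>\<omega>. (1 + cos (\<theta> + tsum t (Suc m) n V \<omega>)) * cyl A (Suc m) V \<omega> \<partial>Q)" for \<theta>
    proof -
      have nn: "0 \<le> (1 + cos x) * cyl A m W \<omega>" for x \<omega> and W :: "nat \<Rightarrow> 'c \<Rightarrow> real"
        using I01(1)[of m W \<omega>] cos_ge_minus_one[of x] by (intro mult_nonneg_nonneg) linarith
      have "(\<integral>\<omega>. (1 + cos (\<theta> + tsum t (Suc m) n U \<omega>)) * cyl A m U \<omega> * indicator (A m) (U m \<omega>) \<partial>P)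
        = (\<integral>\<omega>. (1 + cos (\<theta> + tsum t (Suc m) n V \<omega>)) * cyl A m V \<omega> * indicator (A m) (V m \<omega>) \<partial>Q)"
      proof (rule weighted_law_unique[where g="\<lambda>\<omega>. (1 + cos (\<theta> + tsum t (Suc m) n U \<omega>)) * cyl A m U \<omega>"
            and h="\<lambda>\<omega>. (1 + cos (\<theta> + tsum t (Suc m) n V \<omega>)) * cyl A m V \<omega>" and U="U m" and V="V m" and B="A m"])
        show "integrable P (\<lambda>\<omega>. (1 + cos (\<theta> + tsum t (Suc m) n U \<omega>)) * cyl A m U \<omega>)" by (rule int[of P U, OF P U])
        show "integrable Q (\<lambda>\<omega>. (1 + cos (\<theta> + tsum t (Suc m) n V \<omega>)) * cyl A m V \<omega>)" by (rule int[of Q V, OF Q V])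
        show "(\<integral>\<omega>. (1 + cos (\<theta> + tsum t (Suc m) n U \<omega>)) * cyl A m U \<omega> * cos (\<phi> + s * U m \<omega>) \<partial>P)
          = (\<integral>\<omega>. (1 + cos (\<theta> + tsum t (Suc m) n V \<omega>)) * cyl A m V \<omega> * cos (\<phi> + s * V m \<omega>) \<partial>Q)" for s \<phi>
          by (simp only: expand[of P U, OF P U] expand[of Q V, OF Q V] IH)
      qed (rule U V A m nn)+
      then show ?thesis by (simp only: box_Suc mult.assoc)
    qed
    \<comment> \<open>Adding pi to the phase flips the sign of the cosine, so half the difference of
      the two 1 + cos weights is the bare cosine.\<close>
    have fin: "(\<integral>\<omega>. cyl A (Suc m) W \<omega> * cos (\<theta> + (\<Sum>k\<in>{Suc m..<n}. t k * W k \<omega>)) \<partial>R)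
      = ((\<integral>\<omega>. (1 + cos (\<theta> + tsum t (Suc m) n W \<omega>)) * cyl A (Suc m) W \<omega> \<partial>R)
         - (\<integral>\<omega>. (1 + cos ((\<theta> + pi) + tsum t (Suc m) n W \<omega>)) * cyl A (Suc m) W \<omega> \<partial>R)) / 2"
      if R: "prob_space R" and W: "\<And>k. k < n \<Longrightarrow> W k \<in> borel_measurable R" for R and W :: "nat \<Rightarrow> 'c \<Rightarrow> real"
    proof -
      have ring2: "(1 + p) * b - (1 + - p) * b = 2 * (b * p)" for b p :: real
        by (simp add: algebra_simps)
      have half: "c = (a - b) / 2" if "a - b = 2 * c" for a b c :: real
        using that by simp
      have c: "cos ((\<theta> + pi) + x) = - cos (\<theta> + x)" for x :: real
        by (metis add.assoc add.commute cos_periodic_pi)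
      have "((\<integral>\<omega>. (1 + cos (\<theta> + tsum t (Suc m) n W \<omega>)) * cyl A (Suc m) W \<omega> \<partial>R)
         - (\<integral>\<omega>. (1 + cos ((\<theta> + pi) + tsum t (Suc m) n W \<omega>)) * cyl A (Suc m) W \<omega> \<partial>R))
         = (\<integral>\<omega>. (1 + cos (\<theta> + tsum t (Suc m) n W \<omega>)) * cyl A (Suc m) W \<omega> - (1 + cos ((\<theta> + pi) + tsum t (Suc m) n W \<omega>)) * cyl A (Suc m) W \<omega> \<partial>R)"
        by (rule Bochner_Integration.integral_diff[symmetric]) (intro int[of R W, OF R W]; assumption)+
      also have "\<dots> = (\<integral>\<omega>. 2 * (cyl A (Suc m) W \<omega> * cos (\<theta> + tsum t (Suc m) n W \<omega>)) \<partial>R)"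
        unfolding c by (simp only: ring2)
      also have "\<dots> = 2 * (\<integral>\<omega>. cyl A (Suc m) W \<omega> * cos (\<theta> + tsum t (Suc m) n W \<omega>) \<partial>R)"
        by (rule integral_mult_right_zero)
      finally show ?thesis unfolding tsum_def by (rule half)
    qed
    show ?case using fin[of P U, OF P U] fin[of Q V, OF Q V] step[of "\<theta>"] step[of "\<theta> + pi"] by (simp only:)
  qed
  \<comment> \<open>With no coordinate left in the phase, cos 0 = 1 and only the box indicator
    remains.\<close>
  have meas: "(\<integral>\<omega>. cyl A n W \<omega> * cos (0 + (\<Sum>k\<in>{n..<n}. 0 * W k \<omega>)) \<partial>R) = measure R {\<omega>\<in>space R. \<forall>k<n. W k \<omega> \<in> A k}"
    if R: "prob_space R" and W: "\<And>k. k < n \<Longrightarrow> W k \<in> borel_measurable R" for R and W :: "nat \<Rightarrow> 'c \<Rightarrow> real"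
  proof -
    have "cyl A n W \<omega> = indicator {\<omega>\<in>space R. \<forall>k<n. W k \<omega> \<in> A k} \<omega>" if "\<omega> \<in> space R" for \<omega>
      using that by (auto simp: cyl_def indicator_def split: if_splits)
    then have "cyl A n W \<omega> * cos (0 + (\<Sum>k\<in>{n..<n}. 0 * W k \<omega>)) = indicator {\<omega>\<in>space R. \<forall>k<n. W k \<omega> \<in> A k} \<omega>" if "\<omega> \<in> space R" for \<omega>
      using that by simp
    then have "(\<integral>\<omega>. cyl A n W \<omega> * cos (0 + (\<Sum>k\<in>{n..<n}. 0 * W k \<omega>)) \<partial>R) = (\<integral>\<omega>. indicator {\<omega>\<in>space R. \<forall>k<n. W k \<omega> \<in> A k} \<omega> \<partial>R)"
      by (rule Bochner_Integration.integral_cong[OF refl])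
    also have "\<dots> = measure R ({\<omega>\<in>space R. \<forall>k<n. W k \<omega> \<in> A k} \<inter> space R)" by (rule Bochner_Integration.integral_indicator)
    also have "{\<omega>\<in>space R. \<forall>k<n. W k \<omega> \<in> A k} \<inter> space R = {\<omega>\<in>space R. \<forall>k<n. W k \<omega> \<in> A k}" by (rule Int_absorb2[OF Collect_subset])
    finally show ?thesis .
  qed
  have mn: "(\<integral>\<omega>. cyl A n U \<omega> * cos (0 + (\<Sum>k\<in>{n..<n}. 0 * U k \<omega>)) \<partial>P)
     = (\<integral>\<omega>. cyl A n V \<omega> * cos (0 + (\<Sum>k\<in>{n..<n}. 0 * V k \<omega>)) \<partial>Q)"
    by (rule main[of n 0 "\<lambda>_. 0"]) (rule order_refl)
  show ?thesis
    by (rule trans[OF meas[of P U, OF P U, symmetric] trans[OF mn meas[of Q V, OF Q V]]]) assumption+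
qed

section \<open>Square-integrable and Gaussian variables\<close>

definition sq_integrable :: "'a measure \<Rightarrow> ('a \<Rightarrow> real) \<Rightarrow> bool" where
  "sq_integrable M f \<longleftrightarrow> f \<in> borel_measurable M \<and> integrable M (\<lambda>\<omega>. (f \<omega>)\<^sup>2)"

lemma sq_integrable_measurable: "sq_integrable M f \<Longrightarrow> f \<in> borel_measurable M"
  by (simp add: sq_integrable_def)

lemma sq_integrable_square: "sq_integrable M f \<Longrightarrow> integrable M (\<lambda>\<omega>. (f \<omega>)\<^sup>2)"
  by (simp add: sq_integrable_def)

lemma sq_integrable_mult:
  assumes "sq_integrable M f" "sq_integrable M g"
  shows "integrable M (\<lambda>\<omega>. f \<omega> * g \<omega>)"
proof (rule Bochner_Integration.integrable_bound)
  show "integrable M (\<lambda>\<omega>. (f \<omega>)\<^sup>2 + (g \<omega>)\<^sup>2)" using assms by (simp add: sq_integrable_def)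
  show "(\<lambda>\<omega>. f \<omega> * g \<omega>) \<in> borel_measurable M" using assms by (auto simp: sq_integrable_def)
  have "\<bar>x * y\<bar> \<le> x\<^sup>2 + y\<^sup>2" for x y :: real
  proof -
    have "2 * (\<bar>x\<bar> * \<bar>y\<bar>) \<le> x\<^sup>2 + y\<^sup>2"
      using sum_squares_bound[of "\<bar>x\<bar>" "\<bar>y\<bar>"] by (simp add: mult.assoc)
    moreover have "0 \<le> \<bar>x\<bar> * \<bar>y\<bar>" by simp
    ultimately show ?thesis unfolding abs_mult by linarith
  qed
  then show "AE \<omega> in M. norm (f \<omega> * g \<omega>) \<le> norm ((f \<omega>)\<^sup>2 + (g \<omega>)\<^sup>2)" by (simp add: abs_of_nonneg)
qed

lemma sq_integrable_lin:
  assumes "sq_integrable M f" "sq_integrable M g"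
  shows "sq_integrable M (\<lambda>\<omega>. a * f \<omega> + b * g \<omega>)"
proof -
  have "(a * x + b * y)\<^sup>2 = a\<^sup>2 * x\<^sup>2 + (2 * a * b * (x * y) + b\<^sup>2 * y\<^sup>2)" for x y :: real
    by (simp add: power2_eq_square algebra_simps)
  then show ?thesis
    using assms sq_integrable_mult[OF assms] unfolding sq_integrable_def by auto
qed

lemma integral_square_lin:
  assumes "sq_integrable M f" "sq_integrable M g"
  shows "(\<integral>\<omega>. (a * f \<omega> + b * g \<omega>)\<^sup>2 \<partial>M) = a\<^sup>2 * (\<integral>\<omega>. (f \<omega>)\<^sup>2 \<partial>M) + 2 * a * b * (\<integral>\<omega>. f \<omega> * g \<omega> \<partial>M) + b\<^sup>2 * (\<integral>\<omega>. (g \<omega>)\<^sup>2 \<partial>M)"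
proof -
  have e: "(a * x + b * y)\<^sup>2 = a\<^sup>2 * x\<^sup>2 + 2 * a * b * (x * y) + b\<^sup>2 * y\<^sup>2" for x y :: real
    by (simp add: power2_eq_square algebra_simps)
  show ?thesis unfolding e
    using assms sq_integrable_mult[OF assms] unfolding sq_integrable_def
    by (subst Bochner_Integration.integral_add Bochner_Integration.integral_add; simp)
qed

lemma integral_mult_lin:
  assumes "sq_integrable M f" "sq_integrable M g" "sq_integrable M h"
  shows "(\<integral>\<omega>. (a * f \<omega> + b * g \<omega>) * h \<omega> \<partial>M) = a * (\<integral>\<omega>. f \<omega> * h \<omega> \<partial>M) + b * (\<integral>\<omega>. g \<omega> * h \<omega> \<partial>M)"
  using sq_integrable_mult[OF assms(1,3)] sq_integrable_mult[OF assms(2,3)]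
  by (simp add: distrib_right mult.assoc)

lemma integral_Cauchy_Schwarz:
  fixes f g :: "'a \<Rightarrow> real"
  assumes "sq_integrable M f" "sq_integrable M g"
  shows "(\<integral>\<omega>. f \<omega> * g \<omega> \<partial>M)\<^sup>2 \<le> (\<integral>\<omega>. (f \<omega>)\<^sup>2 \<partial>M) * (\<integral>\<omega>. (g \<omega>)\<^sup>2 \<partial>M)"
proof -
  define A B C where "A = (\<integral>\<omega>. (f \<omega>)\<^sup>2 \<partial>M)" and "B = (\<integral>\<omega>. f \<omega> * g \<omega> \<partial>M)" and "C = (\<integral>\<omega>. (g \<omega>)\<^sup>2 \<partial>M)"
  have A0: "0 \<le> A" by (simp add: A_def)
  have Q: "0 \<le> a\<^sup>2 * A + 2 * a * b * B + b\<^sup>2 * C" for a b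
  proof -
    have "0 \<le> (\<integral>\<omega>. (a * f \<omega> + b * g \<omega>)\<^sup>2 \<partial>M)" by (rule integral_nonneg_AE) simp
    then show ?thesis unfolding integral_square_lin[OF assms] A_def B_def C_def .
  qed
  show ?thesis
  proof (cases "A = 0")
    case True
    have "B = 0"
    proof (rule ccontr)
      assume "B \<noteq> 0"
      \<comment> \<open>For A = 0 and b = 1 the form is 2 a B + C; this a makes it equal to
        -1.\<close>
      then show False using Q[of "- (C + 1) / (2 * B)" 1] True by (simp add: field_simps)
    qed
    then show ?thesis using True by (simp add: A_def B_def)
  next
    case False
    then have "A > 0" using A0 by simp
    \<comment> \<open>At a = -B, b = A the form collapses to A (A C - B^2).\<close>
    have "0 \<le> A * (A * C - B\<^sup>2)"
      using Q[of "- B" A] by (simp add: power2_eq_square algebra_simps)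
    then have "0 \<le> A * C - B\<^sup>2" using \<open>A > 0\<close> by (simp add: zero_le_mult_iff)
    then show ?thesis by (simp add: A_def B_def C_def)
  qed
qed

lemma tendsto_integral_mult_L2:
  assumes Y: "\<And>n. sq_integrable M (Y n)" and H: "sq_integrable M H" and K: "sq_integrable M K"
    and lim: "(\<lambda>n. \<integral>\<omega>. (Y n \<omega> - H \<omega>)\<^sup>2 \<partial>M) \<longlonglongrightarrow> 0"
  shows "(\<lambda>n. \<integral>\<omega>. Y n \<omega> * K \<omega> \<partial>M) \<longlonglongrightarrow> (\<integral>\<omega>. H \<omega> * K \<omega> \<partial>M)"
proof -
  have D: "sq_integrable M (\<lambda>\<omega>. Y n \<omega> - H \<omega>)" for n
    using sq_integrable_lin[OF Y[of n] H, of 1 "-1"] by simp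
  have "(\<lambda>n. sqrt ((\<integral>\<omega>. (Y n \<omega> - H \<omega>)\<^sup>2 \<partial>M) * (\<integral>\<omega>. (K \<omega>)\<^sup>2 \<partial>M))) \<longlonglongrightarrow> sqrt (0 * (\<integral>\<omega>. (K \<omega>)\<^sup>2 \<partial>M))"
    by (intro tendsto_intros lim)
  then have z: "(\<lambda>n. sqrt ((\<integral>\<omega>. (Y n \<omega> - H \<omega>)\<^sup>2 \<partial>M) * (\<integral>\<omega>. (K \<omega>)\<^sup>2 \<partial>M))) \<longlonglongrightarrow> 0" by simp
  have bnd: "norm ((\<integral>\<omega>. Y n \<omega> * K \<omega> \<partial>M) - (\<integral>\<omega>. H \<omega> * K \<omega> \<partial>M)) \<le> sqrt ((\<integral>\<omega>. (Y n \<omega> - H \<omega>)\<^sup>2 \<partial>M) * (\<integral>\<omega>. (K \<omega>)\<^sup>2 \<partial>M))" for n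
  proof -
    have "(\<integral>\<omega>. Y n \<omega> * K \<omega> \<partial>M) - (\<integral>\<omega>. H \<omega> * K \<omega> \<partial>M) = (\<integral>\<omega>. (Y n \<omega> - H \<omega>) * K \<omega> \<partial>M)"
      using integral_mult_lin[OF Y[of n] H K, of 1 "-1"] by simp
    then show ?thesis using integral_Cauchy_Schwarz[OF D[of n] K] real_sqrt_le_mono by fastforce
  qed
  show ?thesis
    by (rule LIM_zero_cancel, rule Lim_null_comparison[OF _ z], rule always_eventually, rule allI, rule bnd)
qed

lemma tendsto_integral_square_L2:
  assumes Y: "\<And>n. sq_integrable M (Y n)" and H: "sq_integrable M H"
    and lim: "(\<lambda>n. \<integral>\<omega>. (Y n \<omega> - H \<omega>)\<^sup>2 \<partial>M) \<longlonglongrightarrow> 0"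
  shows "(\<lambda>n. \<integral>\<omega>. (Y n \<omega>)\<^sup>2 \<partial>M) \<longlonglongrightarrow> (\<integral>\<omega>. (H \<omega>)\<^sup>2 \<partial>M)"
proof -
  have "(\<integral>\<omega>. (Y n \<omega>)\<^sup>2 \<partial>M) = (\<integral>\<omega>. (Y n \<omega> - H \<omega>)\<^sup>2 \<partial>M) + 2 * (\<integral>\<omega>. Y n \<omega> * H \<omega> \<partial>M) - (\<integral>\<omega>. (H \<omega>)\<^sup>2 \<partial>M)" for n
    using integral_square_lin[OF Y[of n] H, of 1 "-1"] by simp
  moreover have "(\<lambda>n. (\<integral>\<omega>. (Y n \<omega> - H \<omega>)\<^sup>2 \<partial>M) + 2 * (\<integral>\<omega>. Y n \<omega> * H \<omega> \<partial>M) - (\<integral>\<omega>. (H \<omega>)\<^sup>2 \<partial>M))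
     \<longlonglongrightarrow> 0 + 2 * (\<integral>\<omega>. H \<omega> * H \<omega> \<partial>M) - (\<integral>\<omega>. (H \<omega>)\<^sup>2 \<partial>M)"
    by (intro tendsto_intros lim tendsto_integral_mult_L2[OF Y H H])
  ultimately show ?thesis by (simp add: power2_eq_square)
qed

section \<open>Cosine integrals and tails of centered normal variables\<close>

lemma normal_density_cos_integral:
  assumes "\<sigma> > 0"
  shows "(\<integral>x. normal_density 0 \<sigma> x * cos (\<theta> + s * x) \<partial>lborel) = cos \<theta> * exp (- (s\<^sup>2 * \<sigma>\<^sup>2) / 2)"
proof -
  have std: "(\<integral>x. std_normal_density x * cos (t * x) \<partial>lborel) = exp (- t\<^sup>2 / 2)
     \<and> (\<integral>x. std_normal_density x * sin (t * x) \<partial>lborel) = 0" for t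
  proof -
    have i: "integrable lborel (\<lambda>x. std_normal_density x *\<^sub>R iexp (t * x))"
      by (rule Bochner_Integration.integrable_bound[of _ std_normal_density]) auto
    have c: "complex_of_real (exp (- t\<^sup>2 / 2)) = (\<integral>x. std_normal_density x *\<^sub>R iexp (t * x) \<partial>lborel)"
      using char_std_normal_distribution unfolding fun_eq_iff char_def
      by (subst (asm) integral_density) auto
    have "Re (\<integral>x. std_normal_density x *\<^sub>R iexp (t * x) \<partial>lborel) = (\<integral>x. std_normal_density x * cos (t * x) \<partial>lborel)"
      using i by (subst integral_Re[symmetric]) (auto simp: Re_exp)
    moreover have "Im (\<integral>x. std_normal_density x *\<^sub>R iexp (t * x) \<partial>lborel) = (\<integral>x. std_normal_density x * sin (t * x) \<partial>lborel)"
      using i by (subst integral_Im[symmetric]) (auto simp: Im_exp)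
    ultimately show ?thesis unfolding c[symmetric] by simp
  qed
  have ic: "integrable lborel (\<lambda>x. std_normal_density x * cos (t * x))"
    and is': "integrable lborel (\<lambda>x. std_normal_density x * sin (t * x))" for t
    by (rule Bochner_Integration.integrable_bound[of _ std_normal_density], auto simp: abs_mult mult_left_le)+
  have d: "\<sigma> * normal_density 0 \<sigma> (\<sigma> * x) = std_normal_density x" for x
    using assms by (simp add: normal_density_def real_sqrt_mult power_mult_distrib)
  have "(\<integral>x. normal_density 0 \<sigma> x * cos (\<theta> + s * x) \<partial>lborel)
     = (\<integral>x. \<sigma> * (normal_density 0 \<sigma> (\<sigma> * x) * cos (\<theta> + s * (\<sigma> * x))) \<partial>lborel)"
    using assms lborel_integral_real_affine[of \<sigma> "\<lambda>x. normal_density 0 \<sigma> x * cos (\<theta> + s * x)" 0] by simp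
  also have "\<dots> = (\<integral>x. std_normal_density x * cos (\<theta> + (s * \<sigma>) * x) \<partial>lborel)"
    unfolding d[symmetric] by (simp add: mult_ac)
  also have "\<dots> = (\<integral>x. cos \<theta> * (std_normal_density x * cos ((s * \<sigma>) * x)) - sin \<theta> * (std_normal_density x * sin ((s * \<sigma>) * x)) \<partial>lborel)"
    unfolding cos_add by (simp add: algebra_simps)
  also have "\<dots> = cos \<theta> * exp (- (s * \<sigma>)\<^sup>2 / 2)"
    using ic[of "s * \<sigma>"] is'[of "s * \<sigma>"] std[of "s * \<sigma>"] by simp
  finally show ?thesis by (simp add: power_mult_distrib)
qed

text \<open>For a, x \<ge> 0 one has (a + x)^2 \<ge> a^2 + x^2, so the density shifted by a is at
  most the exponential factor times the unshifted density, whose total mass is 1.\<close>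

lemma normal_density_upper_tail:
  assumes s: "\<sigma> > 0" and a: "a \<ge> 0"
  shows "measure (density lborel (normal_density 0 \<sigma>)) {a..} \<le> exp (- a\<^sup>2 / (2 * \<sigma>\<^sup>2))"
proof -
  interpret prob_space "density lborel (normal_density 0 \<sigma>)" by (rule prob_space_normal_density[OF s])
  have pt: "normal_density 0 \<sigma> (a + x) \<le> exp (- a\<^sup>2 / (2 * \<sigma>\<^sup>2)) * normal_density 0 \<sigma> x" if "x \<ge> 0" for x
  proof -
    have "a\<^sup>2 + x\<^sup>2 \<le> (a + x)\<^sup>2" using a that by (simp add: power2_sum)
    then have "(a\<^sup>2 + x\<^sup>2) / (2 * \<sigma>\<^sup>2) \<le> (a + x)\<^sup>2 / (2 * \<sigma>\<^sup>2)"
      by (rule divide_right_mono) simp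
    then have "- (a + x)\<^sup>2 / (2 * \<sigma>\<^sup>2) \<le> - a\<^sup>2 / (2 * \<sigma>\<^sup>2) + - x\<^sup>2 / (2 * \<sigma>\<^sup>2)"
      unfolding add_divide_distrib by simp
    then have "exp (- (a + x)\<^sup>2 / (2 * \<sigma>\<^sup>2)) \<le> exp (- a\<^sup>2 / (2 * \<sigma>\<^sup>2)) * exp (- x\<^sup>2 / (2 * \<sigma>\<^sup>2))"
      by (simp flip: exp_add)
    then have "1 / sqrt (2 * pi * \<sigma>\<^sup>2) * exp (- (a + x)\<^sup>2 / (2 * \<sigma>\<^sup>2))
       \<le> 1 / sqrt (2 * pi * \<sigma>\<^sup>2) * (exp (- a\<^sup>2 / (2 * \<sigma>\<^sup>2)) * exp (- x\<^sup>2 / (2 * \<sigma>\<^sup>2)))"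
      by (intro mult_left_mono) simp_all
    then show ?thesis by (simp add: normal_density_def mult_ac)
  qed
  have "emeasure (density lborel (normal_density 0 \<sigma>)) {a..} = (\<integral>\<^sup>+x. ennreal (normal_density 0 \<sigma> x) * indicator {a..} x \<partial>lborel)"
    by (simp add: emeasure_density)
  also have "\<dots> = (\<integral>\<^sup>+x. ennreal (normal_density 0 \<sigma> (a + x)) * indicator {a..} (a + x) \<partial>lborel)"
    using nn_integral_real_affine[of "\<lambda>x. ennreal (normal_density 0 \<sigma> x) * indicator {a..} x" 1 a] by simp
  also have "\<dots> \<le> (\<integral>\<^sup>+x. ennreal (exp (- a\<^sup>2 / (2 * \<sigma>\<^sup>2))) * ennreal (normal_density 0 \<sigma> x) \<partial>lborel)"
    using pt by (intro nn_integral_mono) (auto simp: indicator_def ennreal_leI simp flip: ennreal_mult)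
  also have "\<dots> = ennreal (exp (- a\<^sup>2 / (2 * \<sigma>\<^sup>2))) * (\<integral>\<^sup>+x. ennreal (normal_density 0 \<sigma> x) \<partial>lborel)"
    by (rule nn_integral_cmult) simp
  also have "(\<integral>\<^sup>+x. ennreal (normal_density 0 \<sigma> x) \<partial>lborel) = 1"
    using emeasure_space_1 by (simp add: emeasure_density)
  finally show ?thesis by (simp add: emeasure_eq_measure)
qed

text \<open>The density decreases on the unit interval to the right of a, whose mass is therefore at
  least the value at a + 1. Replacing a by a + 1 costs only a linear term in the exponent.\<close>

lemma normal_density_lower_tail:
  assumes s: "\<sigma> > 0" and a: "a \<ge> 0"
  shows "1 / sqrt (2 * pi * \<sigma>\<^sup>2) * exp (- (a + 1)\<^sup>2 / (2 * \<sigma>\<^sup>2)) \<le> measure (density lborel (normal_density 0 \<sigma>)) {a<..}"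
proof -
  interpret prob_space "density lborel (normal_density 0 \<sigma>)" by (rule prob_space_normal_density[OF s])
  have "ennreal (normal_density 0 \<sigma> (a + 1)) = (\<integral>\<^sup>+x. ennreal (normal_density 0 \<sigma> (a + 1)) * indicator {a<..a+1} x \<partial>lborel)"
    by (simp add: nn_integral_cmult_indicator)
  also have "\<dots> \<le> (\<integral>\<^sup>+x. ennreal (normal_density 0 \<sigma> x) * indicator {a<..} x \<partial>lborel)"
  proof (intro nn_integral_mono)
    fix x
    have "normal_density 0 \<sigma> (a + 1) \<le> normal_density 0 \<sigma> x" if "a < x" "x \<le> a + 1"
    proof -
      have "x\<^sup>2 \<le> (a + 1)\<^sup>2" using that a by (intro power_mono) auto
      then have "exp (- (a + 1)\<^sup>2 / (2 * \<sigma>\<^sup>2)) \<le> exp (- x\<^sup>2 / (2 * \<sigma>\<^sup>2))"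
        using s by (simp add: divide_right_mono)
      then show ?thesis unfolding normal_density_def by (intro mult_left_mono) auto
    qed
    then show "ennreal (normal_density 0 \<sigma> (a + 1)) * indicator {a<..a+1} x \<le> ennreal (normal_density 0 \<sigma> x) * indicator {a<..} x"
      by (auto simp: indicator_def ennreal_leI)
  qed
  also have "\<dots> = emeasure (density lborel (normal_density 0 \<sigma>)) {a<..}"
    by (simp add: emeasure_density)
  finally have "normal_density 0 \<sigma> (a + 1) \<le> measure (density lborel (normal_density 0 \<sigma>)) {a<..}"
    by (simp add: emeasure_eq_measure)
  then show ?thesis by (simp add: normal_density_def)
qed

text \<open>The degenerate and the nondegenerate case obey the same cosine formula once \<sigma>^2
  is replaced by the second moment; in this form it survives limits.\<close>

lemma centered_normal_rv_props:
  assumes "prob_space M" and Z: "centered_normal_rv M Z"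
  shows "sq_integrable M Z" and "(\<integral>\<omega>. cos (\<theta> + Z \<omega>) \<partial>M) = cos \<theta> * exp (- (\<integral>\<omega>. (Z \<omega>)\<^sup>2 \<partial>M) / 2)"
proof -
  interpret prob_space M by fact
  have [measurable]: "Z \<in> borel_measurable M" using Z by (simp add: centered_normal_rv_def)
  have "sq_integrable M Z \<and> (\<integral>\<omega>. cos (\<theta> + Z \<omega>) \<partial>M) = cos \<theta> * exp (- (\<integral>\<omega>. (Z \<omega>)\<^sup>2 \<partial>M) / 2)"
  proof (cases "AE \<omega> in M. Z \<omega> = 0")
    case True
    have "AE \<omega> in M. (Z \<omega>)\<^sup>2 = 0" using True by auto
    then have i: "integrable M (\<lambda>\<omega>. (Z \<omega>)\<^sup>2)" "(\<integral>\<omega>. (Z \<omega>)\<^sup>2 \<partial>M) = 0"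
      by (auto simp: integral_eq_zero_AE intro!: integrable_cong_AE_imp[of M "\<lambda>_. 0"])
    have "(\<integral>\<omega>. cos (\<theta> + Z \<omega>) \<partial>M) = (\<integral>\<omega>. cos \<theta> \<partial>M)"
      using True by (intro integral_cong_AE) auto
    then show ?thesis using i by (simp add: sq_integrable_def prob_space)
  next
    case False
    then obtain \<sigma> where s: "\<sigma> > 0" and D: "distributed M lborel Z (normal_density 0 \<sigma>)"
      using Z by (auto simp: centered_normal_rv_def)
    have h: "has_bochner_integral lborel (\<lambda>x. normal_density 0 \<sigma> x * x\<^sup>2) (\<sigma>\<^sup>2)"
      using normal_moment_even[of \<sigma> 0 1] s by (simp add: fact_numeral)
    have "integrable M (\<lambda>\<omega>. (Z \<omega>)\<^sup>2)"
      using distributed_integrable[OF D, of "\<lambda>x. x\<^sup>2"] h by (simp add: has_bochner_integral_iff)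
    moreover have "(\<integral>\<omega>. (Z \<omega>)\<^sup>2 \<partial>M) = \<sigma>\<^sup>2"
      using distributed_integral[OF D, of "\<lambda>x. x\<^sup>2"] h by (simp add: has_bochner_integral_iff)
    moreover have "(\<integral>\<omega>. cos (\<theta> + Z \<omega>) \<partial>M) = cos \<theta> * exp (- \<sigma>\<^sup>2 / 2)"
      using distributed_integral[OF D, of "\<lambda>x. cos (\<theta> + x)"] normal_density_cos_integral[OF s, of \<theta> 1] by simp
    ultimately show ?thesis by (simp add: sq_integrable_def)
  qed
  then show "sq_integrable M Z" "(\<integral>\<omega>. cos (\<theta> + Z \<omega>) \<partial>M) = cos \<theta> * exp (- (\<integral>\<omega>. (Z \<omega>)\<^sup>2 \<partial>M) / 2)" by auto
qed

text \<open>Linearity together with \<open>L_cos\<close> says that every linear combination is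
  centered normal, possibly degenerate. Joint laws are thus fixed by second moments, and all
  Gaussian arguments below rest on these axioms alone.\<close>

locale gauss_linear = prob_space M for M :: "'a measure" +
  fixes L :: "('a \<Rightarrow> real) set"
  assumes L_sq: "Z \<in> L \<Longrightarrow> sq_integrable M Z"
    and L_zero: "(\<lambda>\<omega>. 0) \<in> L"
    and L_lin: "Z \<in> L \<Longrightarrow> W \<in> L \<Longrightarrow> (\<lambda>\<omega>. a * Z \<omega> + b * W \<omega>) \<in> L"
    and L_cos: "Z \<in> L \<Longrightarrow> (\<integral>\<omega>. cos (\<theta> + Z \<omega>) \<partial>M) = cos \<theta> * exp (- (\<integral>\<omega>. (Z \<omega>)\<^sup>2 \<partial>M) / 2)"
begin

abbreviation msq :: "('a \<Rightarrow> real) \<Rightarrow> real" where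
  "msq f \<equiv> (\<integral>\<omega>. (f \<omega>)\<^sup>2 \<partial>M)"

lemma L_measurable: "Z \<in> L \<Longrightarrow> Z \<in> borel_measurable M"
  using L_sq sq_integrable_measurable by auto

lemma L_scale: "Z \<in> L \<Longrightarrow> (\<lambda>\<omega>. a * Z \<omega>) \<in> L"
  using L_lin[OF _ L_zero, of Z a 0] by simp

lemma L_sum: "(\<And>k. k < (n::nat) \<Longrightarrow> y k \<in> L) \<Longrightarrow> (\<lambda>\<omega>. \<Sum>k<n. t k * y k \<omega>) \<in> L"
proof (induction n)
  case 0
  show ?case using L_zero by simp
next
  case (Suc n)
  then have "(\<lambda>\<omega>. 1 * (\<Sum>k<n. t k * y k \<omega>) + t n * y n \<omega>) \<in> L" by (intro L_lin) auto
  then show ?case by (simp add: add.commute)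
qed

lemma L_law:
  assumes Z: "Z \<in> L" and v: "(msq Z) = \<sigma>\<^sup>2" "\<sigma> > 0" and B: "B \<in> sets borel"
  shows "measure M {\<omega>\<in>space M. Z \<omega> \<in> B} = measure (density lborel (normal_density 0 \<sigma>)) B"
proof -
  interpret N: prob_space "density lborel (normal_density 0 \<sigma>)" by (rule prob_space_normal_density[OF v(2)])
  note [measurable] = L_measurable[OF Z] B
  have "(\<integral>\<omega>. (1::real) * indicator B (Z \<omega>) \<partial>M) = (\<integral>x. (1::real) * indicator B x \<partial>density lborel (normal_density 0 \<sigma>))"
  proof (rule weighted_law_unique[where g="\<lambda>_. 1" and h="\<lambda>_. 1" and U=Z and V="\<lambda>x. x" and B=B])
    fix s \<phi>
    have "(\<integral>\<omega>. 1 * cos (\<phi> + s * Z \<omega>) \<partial>M) = cos \<phi> * exp (- (s\<^sup>2 * \<sigma>\<^sup>2) / 2)"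
      using L_cos[OF L_scale[OF Z, of s], of \<phi>] v by (simp add: power_mult_distrib)
    also have "\<dots> = (\<integral>x. 1 * cos (\<phi> + s * x) \<partial>density lborel (normal_density 0 \<sigma>))"
      using normal_density_cos_integral[OF v(2), of \<phi> s] by (subst integral_density) auto
    finally show "(\<integral>\<omega>. 1 * cos (\<phi> + s * Z \<omega>) \<partial>M) = (\<integral>x. 1 * cos (\<phi> + s * x) \<partial>density lborel (normal_density 0 \<sigma>))" .
  qed (simp_all add: L_measurable[OF Z] B)
  moreover have "(\<integral>\<omega>. (1::real) * indicator B (Z \<omega>) \<partial>M) = measure M {\<omega>\<in>space M. Z \<omega> \<in> B}"
  proof -
    have "(\<integral>\<omega>. (1::real) * indicator B (Z \<omega>) \<partial>M) = (\<integral>\<omega>. indicator {\<omega>\<in>space M. Z \<omega> \<in> B} \<omega> \<partial>M)"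
      by (intro Bochner_Integration.integral_cong) (auto simp: indicator_def)
    then show ?thesis by (simp add: Int_absorb2[OF Collect_subset])
  qed
  ultimately show ?thesis using B by simp
qed

lemma L_upper_tail:
  assumes Z: "Z \<in> L" and v: "(msq Z) > 0" and a: "a \<ge> 0"
  shows "measure M {\<omega>\<in>space M. Z \<omega> \<ge> a} \<le> exp (- a\<^sup>2 / (2 * (msq Z)))"
  using L_law[OF Z, of "sqrt (msq Z)" "{a..}"] v
    normal_density_upper_tail[of "sqrt (msq Z)" a] a by simp

lemma L_lower_tail:
  assumes Z: "Z \<in> L" and v: "(msq Z) > 0" and a: "a \<ge> 0"
  shows "1 / sqrt (2 * pi * (msq Z)) * exp (- (a + 1)\<^sup>2 / (2 * (msq Z))) \<le> measure M {\<omega>\<in>space M. Z \<omega> > a}"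
  using L_law[OF Z, of "sqrt (msq Z)" "{a<..}"] v
    normal_density_lower_tail[of "sqrt (msq Z)" a] a by simp

end

section \<open>Independence and Fernique's inequality\<close>

text \<open>\<open>finite_dim_law_unique\<close> takes one sequence; a pair of sequences is coded by
  even and odd indices.\<close>

lemma sum_lessThan_double:
  fixes f :: "nat \<Rightarrow> 'a::comm_monoid_add"
  shows "(\<Sum>j<2 * n. f j) = (\<Sum>k<n. f (2 * k)) + (\<Sum>k<n. f (2 * k + 1))"
  by (induction n) (simp_all add: add.commute add.left_commute add.assoc)

lemma all_lessThan_double:
  "(\<forall>j<2 * n. P j) \<longleftrightarrow> (\<forall>k<n. P (2 * k) \<and> P (2 * k + 1))" for n :: nat
proof
  assume r: "\<forall>k<n. P (2 * k) \<and> P (2 * k + 1)"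
  show "\<forall>j<2 * n. P j"
  proof (intro allI impI)
    fix j assume j: "j < 2 * n"
    then have "j div 2 < n" by simp
    then have "P (2 * (j div 2)) \<and> P (2 * (j div 2) + 1)" using r by blast
    moreover have "j = 2 * (j div 2) \<or> j = 2 * (j div 2) + 1" by presburger
    ultimately show "P j" by metis
  qed
next
  assume l: "\<forall>j<2 * n. P j"
  show "\<forall>k<n. P (2 * k) \<and> P (2 * k + 1)"
  proof (intro allI impI)
    fix k assume "k < n"
    then have "2 * k < 2 * n" "2 * k + 1 < 2 * n" by simp_all
    then show "P (2 * k) \<and> P (2 * k + 1)" using l by blast
  qed
qed

context gauss_linear
begin

abbreviation "MM \<equiv> M \<Otimes>\<^sub>M M"

lemma prob_space_pair: "prob_space MM"
proof -
  interpret pair_prob_space M M ..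
  show ?thesis by unfold_locales
qed

text \<open>The free phase in \<open>L_cos\<close> carries the iterated integral: for fixed first
  coordinate x the inner integral is taken at phase \<theta> + A x.\<close>

lemma pair_cos:
  assumes A: "A \<in> L" and B: "B \<in> L"
  shows "(\<integral>p. cos (\<theta> + (A (fst p) + B (snd p))) \<partial>MM)
    = cos \<theta> * exp (- ((msq A) + (msq B)) / 2)"
proof -
  interpret pair_prob_space M M ..
  note [measurable] = L_measurable[OF A] L_measurable[OF B]
  have i: "integrable MM (\<lambda>p. cos (\<theta> + (A (fst p) + B (snd p))))"
    by (rule P.integrable_const_bound[where B=1]) auto
  have "(\<integral>p. cos (\<theta> + (A (fst p) + B (snd p))) \<partial>MM) = (\<integral>x. (\<integral>y. cos (\<theta> + (A x + B y)) \<partial>M) \<partial>M)"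
    using integral_fst'[OF i] by simp
  also have "\<dots> = (\<integral>x. cos (\<theta> + A x) * exp (- (msq B) / 2) \<partial>M)"
    using L_cos[OF B, of "\<theta> + A x" for x] by (simp add: add.assoc)
  also have "\<dots> = (\<integral>x. cos (\<theta> + A x) \<partial>M) * exp (- (msq B) / 2)"
    by (rule integral_mult_left_zero)
  also have "\<dots> = cos \<theta> * exp (- ((msq A) + (msq B)) / 2)"
    unfolding L_cos[OF A] mult.assoc exp_add[symmetric] by (simp add: add_divide_distrib)
  finally show ?thesis .
qed

lemma measure_pair_times:
  assumes "A \<in> sets M" "B \<in> sets M"
  shows "measure MM (A \<times> B) = measure M A * measure M B"
proof -
  have "emeasure MM (A \<times> B) = emeasure M A * emeasure M B"
    using assms by (rule emeasure_pair_measure_Times)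
  then show ?thesis by (simp add: measure_def enn2real_mult)
qed

lemma box_sets:
  fixes y :: "nat \<Rightarrow> 'a \<Rightarrow> real"
  assumes "\<And>k. y k \<in> L" "\<And>k. B k \<in> sets borel"
  shows "{\<omega>\<in>space M. \<forall>k<(n::nat). y k \<omega> \<in> B k} \<in> sets M"
proof -
  have [measurable]: "y k \<in> borel_measurable M" "B k \<in> sets borel" for k using assms L_measurable by auto
  show ?thesis by measurable
qed

text \<open>\<open>H\<close> and \<open>y\<close> are compared with \<open>H\<close> on the first
  and \<open>y\<close> on the second factor of the product space. The cosine integrals agree because
  the mixed second moment vanishes, and on the product space the event is a rectangle.\<close>

lemma uncorrelated_box:
  fixes y :: "nat \<Rightarrow> 'a \<Rightarrow> real"
  assumes H: "H \<in> L" and y: "\<And>k. y k \<in> L" and orth: "\<And>k. (\<integral>\<omega>. y k \<omega> * H \<omega> \<partial>M) = 0"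
    and B0: "B0 \<in> sets borel" and B: "\<And>k. B k \<in> sets borel"
  shows "measure M {\<omega>\<in>space M. H \<omega> \<in> B0 \<and> (\<forall>k<n. y k \<omega> \<in> B k)}
    = measure M {\<omega>\<in>space M. H \<omega> \<in> B0} * measure M {\<omega>\<in>space M. \<forall>k<n. y k \<omega> \<in> B k}"
proof -
  define U where "U = case_nat H y"
  define V where "V = case_nat (\<lambda>p. H (fst p)) (\<lambda>k p. y k (snd p))"
  define A where "A = case_nat B0 B"
  have ULs: "U k \<in> L" for k using H y by (simp add: U_def split: nat.split)
  have all_Suc: "(\<forall>k<Suc n. P k) \<longleftrightarrow> P 0 \<and> (\<forall>k<n. P (Suc k))" for P
    using less_Suc_eq_0_disj by auto
  have Vm: "V k \<in> borel_measurable MM" for k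
    using L_measurable[OF H] L_measurable[OF y] by (cases k) (auto simp: V_def)
  have "measure M {\<omega>\<in>space M. \<forall>k<Suc n. U k \<omega> \<in> A k} = measure MM {p\<in>space MM. \<forall>k<Suc n. V k p \<in> A k}"
  proof (rule finite_dim_law_unique[where n="Suc n"])
    show "prob_space M" by unfold_locales
    show "prob_space MM" by (rule prob_space_pair)
    fix k show "U k \<in> borel_measurable M" "V k \<in> borel_measurable MM" "A k \<in> sets borel"
      using L_measurable[OF ULs] Vm B0 B by (auto simp: A_def split: nat.split)
  next
    fix t :: "nat \<Rightarrow> real" and \<theta> :: real
    define Y where "Y = (\<lambda>\<omega>. \<Sum>k<n. t (Suc k) * y k \<omega>)"
    have Y: "Y \<in> L" unfolding Y_def by (rule L_sum) (rule y)
    have "integrable M (\<lambda>\<omega>. y k \<omega> * H \<omega>)" for k by (rule sq_integrable_mult[OF L_sq[OF y] L_sq[OF H]])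
    then have "(\<integral>\<omega>. Y \<omega> * H \<omega> \<partial>M) = (\<Sum>k<n. t (Suc k) * (\<integral>\<omega>. y k \<omega> * H \<omega> \<partial>M))"
      unfolding Y_def sum_distrib_right mult.assoc by simp
    then have o: "(\<integral>\<omega>. H \<omega> * Y \<omega> \<partial>M) = 0" using orth by (simp add: mult.commute)
    have sU: "(\<Sum>k<Suc n. t k * U k \<omega>) = t 0 * H \<omega> + 1 * Y \<omega>" for \<omega>
      unfolding sum.lessThan_Suc_shift by (simp add: U_def Y_def)
    have sV: "(\<Sum>k<Suc n. t k * V k p) = t 0 * H (fst p) + Y (snd p)" for p
      unfolding sum.lessThan_Suc_shift by (simp add: V_def Y_def)
    have "(\<integral>\<omega>. cos (\<theta> + (t 0 * H \<omega> + 1 * Y \<omega>)) \<partial>M)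
       = cos \<theta> * exp (- (\<integral>\<omega>. (t 0 * H \<omega> + 1 * Y \<omega>)\<^sup>2 \<partial>M) / 2)"
      by (rule L_cos[OF L_lin[OF H Y]])
    also have "\<dots> = (\<integral>p. cos (\<theta> + (t 0 * H (fst p) + Y (snd p))) \<partial>MM)"
      unfolding integral_square_lin[OF L_sq[OF H] L_sq[OF Y]] pair_cos[OF L_scale[OF H] Y] o
      by (simp add: power_mult_distrib)
    finally show "(\<integral>\<omega>. cos (\<theta> + (\<Sum>k<Suc n. t k * U k \<omega>)) \<partial>M) = (\<integral>p. cos (\<theta> + (\<Sum>k<Suc n. t k * V k p)) \<partial>MM)"
      unfolding sU sV .
  qed
  also have "{p\<in>space MM. \<forall>k<Suc n. V k p \<in> A k}
     = {\<omega>\<in>space M. H \<omega> \<in> B0} \<times> {\<omega>\<in>space M. \<forall>k<n. y k \<omega> \<in> B k}"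
    unfolding all_Suc by (auto simp: V_def A_def space_pair_measure)
  also have "measure MM \<dots> = measure M {\<omega>\<in>space M. H \<omega> \<in> B0} * measure M {\<omega>\<in>space M. \<forall>k<n. y k \<omega> \<in> B k}"
  proof (rule measure_pair_times)
    show "{\<omega>\<in>space M. H \<omega> \<in> B0} \<in> sets M" using L_measurable[OF H] B0 by measurable
    show "{\<omega>\<in>space M. \<forall>k<n. y k \<omega> \<in> B k} \<in> sets M" by (rule box_sets[of y B n, OF y B])
  qed
  finally show ?thesis unfolding all_Suc by (simp add: U_def A_def)
qed

text \<open>The pair \<open>((y - y') / sqrt 2, (y + y') / sqrt 2)\<close> built from an independent copy has the law of \<open>(y, y')\<close>.\<close>

lemma rotation_box:
  fixes y :: "nat \<Rightarrow> 'a \<Rightarrow> real"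
  assumes y: "\<And>k. y k \<in> L" and B: "\<And>k. B k \<in> sets borel" and C: "\<And>k. C k \<in> sets borel"
  shows "measure MM {p\<in>space MM. \<forall>k<n. (y k (fst p) - y k (snd p)) / sqrt 2 \<in> B k \<and> (y k (fst p) + y k (snd p)) / sqrt 2 \<in> C k}
    = measure M {\<omega>\<in>space M. \<forall>k<n. y k \<omega> \<in> B k} * measure M {\<omega>\<in>space M. \<forall>k<n. y k \<omega> \<in> C k}"
proof -
  define U where "U j p = (if even j then (y (j div 2) (fst p) - y (j div 2) (snd p)) / sqrt 2
      else (y (j div 2) (fst p) + y (j div 2) (snd p)) / sqrt 2)" for j p
  define V where "V j p = (if even j then y (j div 2) (fst p) else y (j div 2) (snd p))" for j p
  define A where "A j = (if even j then B (j div 2) else C (j div 2))" for j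
  have ym: "y k \<in> borel_measurable M" for k by (rule L_measurable[OF y])
  have m: "(\<lambda>p. y k (fst p)) \<in> borel_measurable MM" "(\<lambda>p. y k (snd p)) \<in> borel_measurable MM" for k
    using ym by auto
  have Um: "U j \<in> borel_measurable MM" for j
    unfolding U_def using m[of "j div 2"] by (cases "even j") auto
  have Vm: "V j \<in> borel_measurable MM" for j
    unfolding V_def using m[of "j div 2"] by (cases "even j") auto
  have "measure MM {p\<in>space MM. \<forall>j<2*n. U j p \<in> A j} = measure MM {p\<in>space MM. \<forall>j<2*n. V j p \<in> A j}"
  proof (rule finite_dim_law_unique[where n="2*n"])
    show "prob_space MM" "prob_space MM" by (rule prob_space_pair)+
    fix j show "U j \<in> borel_measurable MM" "V j \<in> borel_measurable MM" "A j \<in> sets borel"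
      using Um Vm B C by (auto simp: A_def)
  next
    fix t :: "nat \<Rightarrow> real" and \<theta> :: real
    define P where "P = (\<lambda>\<omega>. \<Sum>k<n. t (2 * k) * y k \<omega>)"
    define Q where "Q = (\<lambda>\<omega>. \<Sum>k<n. t (2 * k + 1) * y k \<omega>)"
    have P: "P \<in> L" and Q: "Q \<in> L" unfolding P_def Q_def by (rule L_sum, rule y)+
    have sV: "(\<Sum>j<2*n. t j * V j p) = P (fst p) + Q (snd p)" for p
      unfolding sum_lessThan_double by (simp add: V_def P_def Q_def)
    have sU: "(\<Sum>j<2*n. t j * U j p) = ((1 / sqrt 2) * P (fst p) + (1 / sqrt 2) * Q (fst p)) + ((- 1 / sqrt 2) * P (snd p) + (1 / sqrt 2) * Q (snd p))" for p
      unfolding sum_lessThan_double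
      by (simp add: U_def P_def Q_def sum_distrib_left sum.distrib[symmetric] sum_negf[symmetric] sum_divide_distrib)
         (intro sum.cong refl, simp add: field_simps)
    \<comment> \<open>In the sum of the two variances the mixed moments of \<open>P\<close> and
      \<open>Q\<close> enter with opposite signs and cancel.\<close>
    show "(\<integral>p. cos (\<theta> + (\<Sum>j<2*n. t j * U j p)) \<partial>MM) = (\<integral>p. cos (\<theta> + (\<Sum>j<2*n. t j * V j p)) \<partial>MM)"
      unfolding sU sV pair_cos[OF P Q] pair_cos[OF L_lin[OF P Q] L_lin[OF P Q]]
        integral_square_lin[OF L_sq[OF P] L_sq[OF Q]]
      by (simp add: power_divide)
  qed
  also have "{p\<in>space MM. \<forall>j<2*n. V j p \<in> A j}
     = {\<omega>\<in>space M. \<forall>k<n. y k \<omega> \<in> B k} \<times> {\<omega>\<in>space M. \<forall>k<n. y k \<omega> \<in> C k}"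
    unfolding all_lessThan_double by (auto simp: V_def A_def space_pair_measure)
  also have "measure MM \<dots> = measure M {\<omega>\<in>space M. \<forall>k<n. y k \<omega> \<in> B k} * measure M {\<omega>\<in>space M. \<forall>k<n. y k \<omega> \<in> C k}"
    by (rule measure_pair_times[OF box_sets[of y B n, OF y B] box_sets[of y C n, OF y C]])
  finally show ?thesis unfolding all_lessThan_double by (simp add: U_def A_def)
qed

text \<open>A countable family with closed bounds: the event is a decreasing limit of the finite
  boxes whose laws are under control.\<close>

definition sup_le :: "(nat \<Rightarrow> 'a \<Rightarrow> real) \<Rightarrow> real \<Rightarrow> 'a set" where
  "sup_le y s = {\<omega>\<in>space M. \<forall>k. \<bar>y k \<omega>\<bar> \<le> s}"

lemma sup_le_sets: "(\<And>k. y k \<in> L) \<Longrightarrow> sup_le y s \<in> sets M"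
proof -
  assume "\<And>k. y k \<in> L"
  then have [measurable]: "y k \<in> borel_measurable M" for k by (rule L_measurable)
  show ?thesis unfolding sup_le_def by measurable
qed

lemma sup_le_limit:
  fixes y :: "nat \<Rightarrow> 'a \<Rightarrow> real"
  assumes y: "\<And>k. y k \<in> L" and E: "E \<in> sets M"
  shows "(\<lambda>n. measure M {\<omega>\<in>space M. \<omega> \<in> E \<and> (\<forall>k<n. y k \<omega> \<in> {-s..s})}) \<longlonglongrightarrow> measure M (E \<inter> sup_le y s)"
proof -
  have ym[measurable]: "y k \<in> borel_measurable M" for k by (rule L_measurable[OF y])
  note [measurable] = E
  let ?A = "\<lambda>n. {\<omega>\<in>space M. \<omega> \<in> E \<and> (\<forall>k<n. y k \<omega> \<in> {-s..s})}"
  have "(\<Inter>n. ?A n) = E \<inter> sup_le y s"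
  proof (intro set_eqI iffI)
    fix \<omega> assume a: "\<omega> \<in> (\<Inter>n. ?A n)"
    have "\<bar>y k \<omega>\<bar> \<le> s" for k
    proof -
      have "\<omega> \<in> ?A (Suc k)" using a by blast
      then show ?thesis by (auto simp: abs_le_iff)
    qed
    then show "\<omega> \<in> E \<inter> sup_le y s" using a by (auto simp: sup_le_def)
  next
    fix \<omega> assume a: "\<omega> \<in> E \<inter> sup_le y s"
    then have "\<bar>y k \<omega>\<bar> \<le> s" for k by (simp add: sup_le_def)
    then have "y k \<omega> \<in> {-s..s}" for k unfolding atLeastAtMost_iff abs_le_iff by (simp add: minus_le_iff)
    moreover have "\<omega> \<in> space M" "\<omega> \<in> E" using a unfolding sup_le_def by blast+
    ultimately show "\<omega> \<in> (\<Inter>n. ?A n)" by blast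
  qed
  moreover have r: "range ?A \<subseteq> sets M"
  proof
    fix S assume "S \<in> range ?A"
    then obtain n where S: "S = ?A n" by blast
    show "S \<in> sets M" unfolding S by measurable
  qed
  have dec: "decseq ?A"
  proof (rule decseq_SucI, rule subsetI)
    fix n \<omega> assume "\<omega> \<in> ?A (Suc n)"
    then show "\<omega> \<in> ?A n" using less_SucI by blast
  qed
  ultimately show ?thesis using finite_Lim_measure_decseq[OF r dec] by (simp only:)
qed

lemma sup_le_mono: "s \<le> t \<Longrightarrow> sup_le y s \<subseteq> sup_le y t"
proof
  fix \<omega> assume st: "s \<le> t" and w: "\<omega> \<in> sup_le y s"
  have "\<bar>y k \<omega>\<bar> \<le> t" for k
  proof -
    have "\<bar>y k \<omega>\<bar> \<le> s" using w unfolding sup_le_def by blast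
    then show ?thesis using st by linarith
  qed
  then show "\<omega> \<in> sup_le y t" using w unfolding sup_le_def by blast
qed

text \<open>\<open>H\<close> is independent of every finite stage, and the product formula passes to
  the decreasing limit.\<close>

lemma uncorrelated_sup:
  fixes y :: "nat \<Rightarrow> 'a \<Rightarrow> real"
  assumes H: "H \<in> L" and y: "\<And>k. y k \<in> L" and orth: "\<And>k. (\<integral>\<omega>. y k \<omega> * H \<omega> \<partial>M) = 0"
    and B0: "B0 \<in> sets borel"
  shows "measure M ({\<omega>\<in>space M. H \<omega> \<in> B0} \<inter> sup_le y s) = measure M {\<omega>\<in>space M. H \<omega> \<in> B0} * measure M (sup_le y s)"
proof -
  let ?E = "{\<omega>\<in>space M. H \<omega> \<in> B0}"
  have E: "?E \<in> sets M" using L_measurable[OF H] B0 by measurable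
  have "(\<lambda>n. measure M {\<omega>\<in>space M. \<omega> \<in> space M \<and> (\<forall>k<n. y k \<omega> \<in> {-s..s})}) \<longlonglongrightarrow> measure M (space M \<inter> sup_le y s)"
    by (rule sup_le_limit[of y "space M" _, OF y sets.top])
  moreover have "space M \<inter> sup_le y s = sup_le y s" by (auto simp: sup_le_def)
  ultimately have "(\<lambda>n. measure M ?E * measure M {\<omega>\<in>space M. \<forall>k<n. y k \<omega> \<in> {-s..s}}) \<longlonglongrightarrow> measure M ?E * measure M (sup_le y s)"
    by (intro tendsto_mult tendsto_const) (simp add: conj_absorb)
  moreover have "measure M ?E * measure M {\<omega>\<in>space M. \<forall>k<n. y k \<omega> \<in> {-s..s}} = measure M {\<omega>\<in>space M. \<omega> \<in> ?E \<and> (\<forall>k<n. y k \<omega> \<in> {-s..s})}" for n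
  proof -
    have "{\<omega>\<in>space M. \<omega> \<in> ?E \<and> (\<forall>k<n. y k \<omega> \<in> {-s..s})} = {\<omega>\<in>space M. H \<omega> \<in> B0 \<and> (\<forall>k<n. y k \<omega> \<in> {-s..s})}" by blast
    then show ?thesis using uncorrelated_box[of H y B0 "\<lambda>_. {-s..s}" n, OF H y orth B0] by simp
  qed
  ultimately show ?thesis using LIMSEQ_unique[OF sup_le_limit[of y ?E s, OF y E]] by simp
qed

text \<open>Let \<open>D\<close> and \<open>S\<close> be the rotated pair of \<open>y\<close> and an
  independent copy. By rotation invariance, that all |D_k| \<le> s and some |S_k| > t has, for
  finitely many k, the probability on the left. Both original coordinates at such a k are (S_k +-
  D_k) / sqrt 2, so they exceed (t - s) / sqrt 2 in modulus; independence of the copies gives the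
  square.\<close>

lemma Fernique_inequality:
  fixes y :: "nat \<Rightarrow> 'a \<Rightarrow> real"
  assumes y: "\<And>k. y k \<in> L"
  shows "measure M (sup_le y s) * (1 - measure M (sup_le y t)) \<le> (1 - measure M (sup_le y ((t - s) / sqrt 2)))\<^sup>2"
proof -
  define F where "F n r = measure M {\<omega>\<in>space M. \<forall>k<n. y k \<omega> \<in> {-r..r}}" for n r
  have lim: "(\<lambda>n. F n r) \<longlonglongrightarrow> measure M (sup_le y r)" for r
  proof -
    have "(\<lambda>n. measure M {\<omega>\<in>space M. \<omega> \<in> space M \<and> (\<forall>k<n. y k \<omega> \<in> {-r..r})}) \<longlonglongrightarrow> measure M (space M \<inter> sup_le y r)"
      by (rule sup_le_limit[of y "space M" _, OF y sets.top])
    moreover have "space M \<inter> sup_le y r = sup_le y r" by (auto simp: sup_le_def)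
    ultimately show ?thesis unfolding F_def by (simp add: conj_absorb)
  qed
  have "F n s * (1 - F n t) \<le> (1 - F n ((t - s) / sqrt 2))\<^sup>2" for n
  proof -
    let ?r = "(t - s) / sqrt 2"
    interpret P: prob_space MM by (rule prob_space_pair)
    let ?D = "\<lambda>k p. (y k (fst p) - y k (snd p)) / sqrt 2" and ?S = "\<lambda>k p. (y k (fst p) + y k (snd p)) / sqrt 2"
    \<comment> \<open>The unconstrained second box yields the law of the differences alone, and
      \<open>?E - ?E'\<close> is the event that in addition some rotated sum exceeds t.\<close>
    let ?E = "{p\<in>space MM. \<forall>k<n. ?D k p \<in> {-s..s} \<and> ?S k p \<in> UNIV}"
    let ?E' = "{p\<in>space MM. \<forall>k<n. ?D k p \<in> {-s..s} \<and> ?S k p \<in> {-t..t}}"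
    let ?G = "space M - {\<omega>\<in>space M. \<forall>k<n. y k \<omega> \<in> {-?r..?r}}"
    have ym[measurable]: "y k \<in> borel_measurable M" for k by (rule L_measurable[OF y])
    have sets: "?E \<in> sets MM" "?E' \<in> sets MM" by measurable
    have G: "?G \<in> sets M" using box_sets[of y "\<lambda>_. {-?r..?r}" n, OF y] by auto
    have mG: "measure M ?G = 1 - F n ?r"
      unfolding F_def by (rule prob_compl) (rule box_sets[of y "\<lambda>_. {-?r..?r}" n, OF y], simp)
    have "measure MM ?E = F n s"
      using rotation_box[of y "\<lambda>_. {-s..s}" "\<lambda>_. UNIV" n, OF y] by (simp add: F_def prob_space)
    moreover have "measure MM ?E' = F n s * F n t"
      using rotation_box[of y "\<lambda>_. {-s..s}" "\<lambda>_. {-t..t}" n, OF y] by (simp add: F_def)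
    moreover have "measure MM (?E - ?E') = measure MM ?E - measure MM ?E'"
      by (rule P.finite_measure_Diff[OF sets]) blast
    moreover have "measure MM (?E - ?E') \<le> measure MM (?G \<times> ?G)"
    proof (rule P.finite_measure_mono)
      show "?G \<times> ?G \<in> sets MM" using G by simp
      show "?E - ?E' \<subseteq> ?G \<times> ?G"
      proof
        fix p assume p: "p \<in> ?E - ?E'"
        then have sp: "fst p \<in> space M" "snd p \<in> space M" by (auto simp: space_pair_measure)
        have D: "\<forall>k<n. ?D k p \<in> {-s..s}" using p by blast
        have "\<not> (\<forall>k<n. ?S k p \<in> {-t..t})" using p by blast
        then obtain k where k: "k < n" and S: "?S k p \<notin> {-t..t}" by blast
        have Dk: "\<bar>?D k p\<bar> \<le> s" using D k by (auto simp: abs_le_iff)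
        have Sk: "\<bar>?S k p\<bar> > t" using S by (auto simp: abs_le_iff not_le abs_if split: if_splits)
        have e: "y k (fst p) * 2 / sqrt 2 = ?S k p + ?D k p" "y k (snd p) * 2 / sqrt 2 = ?S k p - ?D k p"
          by (simp_all add: field_simps)
        have r2: "x * 2 / sqrt 2 = sqrt 2 * x" for x
          by (metis mult.assoc mult.commute real_div_sqrt times_divide_eq_right zero_le_numeral)
        have ab: "sqrt 2 * \<bar>x\<bar> = \<bar>sqrt 2 * x\<bar>" for x :: real by (simp add: abs_mult)
        have tri: "sqrt 2 * \<bar>x\<bar> > t - s" if "sqrt 2 * x = ?S k p + ?D k p" for x
          using that Dk Sk unfolding ab by linarith
        have tri2: "sqrt 2 * \<bar>x\<bar> > t - s" if "sqrt 2 * x = ?S k p - ?D k p" for x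
          using that Dk Sk unfolding ab by linarith
        have b: "sqrt 2 * \<bar>y k (fst p)\<bar> > t - s" "sqrt 2 * \<bar>y k (snd p)\<bar> > t - s"
          by (rule tri[OF e(1)[unfolded r2]], rule tri2[OF e(2)[unfolded r2]])
        have big: "x \<notin> {-?r..?r}" if "sqrt 2 * \<bar>x\<bar> > t - s" for x
        proof
          assume "x \<in> {-?r..?r}"
          then have "\<bar>x\<bar> \<le> ?r" by auto
          then have "sqrt 2 * \<bar>x\<bar> \<le> t - s" by (simp add: field_simps)
          then show False using that by simp
        qed
        have "fst p \<in> ?G" "snd p \<in> ?G" using sp k big[OF b(1)] big[OF b(2)] by blast+
        then show "p \<in> ?G \<times> ?G" by (simp add: mem_Times_iff)
      qed
    qed
    moreover have "measure MM (?G \<times> ?G) = (1 - F n ?r)\<^sup>2"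
      unfolding measure_pair_times[OF G G] mG by (simp add: power2_eq_square)
    ultimately show ?thesis by (simp add: algebra_simps)
  qed
  then show ?thesis
    by (intro LIMSEQ_le[OF tendsto_mult[OF lim tendsto_diff[OF tendsto_const lim]] tendsto_power[OF tendsto_diff[OF tendsto_const lim]]]) auto
qed

text \<open>Start at a level s whose tail is below 1/4. One use of Fernique's inequality squares the
  tail up to a factor 4/3, while the level grows only by about sqrt 2. The logarithm of the tail
  therefore falls like the square of the level.\<close>

lemma Fernique_tail:
  fixes y :: "nat \<Rightarrow> 'a \<Rightarrow> real"
  assumes y: "\<And>k. y k \<in> L" and bdd: "\<And>\<omega>. \<omega> \<in> space M \<Longrightarrow> \<exists>s. \<forall>k. \<bar>y k \<omega>\<bar> \<le> s"
  obtains K \<alpha> where "K > 0" "\<alpha> > 0" "measure M (sup_le y K) \<ge> 1/2"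
    "\<And>t. t \<ge> K \<Longrightarrow> 1 - measure M (sup_le y t) \<le> exp (- \<alpha> * t\<^sup>2)"
proof -
  define p where "p t = 1 - measure M (sup_le y t)" for t
  have mono: "p t \<le> p s" if "s \<le> t" for s t
    unfolding p_def using that sup_le_sets[of y, OF y]
    by (intro diff_left_mono finite_measure_mono sup_le_mono)
  have p0: "0 \<le> p t" for t by (simp add: p_def)
  have "(\<lambda>n. measure M (sup_le y (real n))) \<longlonglongrightarrow> measure M (\<Union>n. sup_le y (real n))"
  proof (rule finite_Lim_measure_incseq)
    show "range (\<lambda>n. sup_le y (real n)) \<subseteq> sets M" using sup_le_sets[of y, OF y] by auto
    show "incseq (\<lambda>n. sup_le y (real n))" by (intro incseq_SucI sup_le_mono) simp
  qed
  moreover have "(\<Union>n. sup_le y (real n)) = space M"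
  proof
    show "space M \<subseteq> (\<Union>n. sup_le y (real n))"
    proof
      fix \<omega> assume w: "\<omega> \<in> space M"
      then obtain s where s: "\<forall>k. \<bar>y k \<omega>\<bar> \<le> s" using bdd by blast
      obtain n where "s \<le> real n" using real_arch_simple by blast
      moreover have "\<omega> \<in> sup_le y s" using s w unfolding sup_le_def by blast
      ultimately have "\<omega> \<in> sup_le y (real n)" using sup_le_mono by blast
      then show "\<omega> \<in> (\<Union>n. sup_le y (real n))" by blast
    qed
  qed (auto simp: sup_le_def)
  ultimately have "(\<lambda>n. measure M (sup_le y (real n))) \<longlonglongrightarrow> 1" by (simp add: prob_space)
  then have "eventually (\<lambda>n. measure M (sup_le y (real n)) > 3/4 \<and> n > 0) sequentially"
    by (intro eventually_conj order_tendstoD(1) eventually_gt_at_top) auto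
  then obtain N where N: "measure M (sup_le y (real N)) > 3/4" "N > 0"
    using eventually_happens'[OF sequentially_bot] by blast
  define s where "s = real N"
  have s: "s > 0" "measure M (sup_le y s) > 3/4" using N by (auto simp: s_def)
  \<comment> \<open>4/3 bounds the reciprocal of the probability of
    \<open>sup_le y s\<close>.\<close>
  have rec: "p (s + sqrt 2 * t) \<le> 4/3 * (p t)\<^sup>2" for t
  proof -
    have "measure M (sup_le y s) * p (s + sqrt 2 * t) \<le> (p t)\<^sup>2"
      using Fernique_inequality[of y s "s + sqrt 2 * t", OF y] by (simp add: p_def)
    moreover have "3/4 * p (s + sqrt 2 * t) \<le> measure M (sup_le y s) * p (s + sqrt 2 * t)"
      using s p0 by (intro mult_right_mono) auto
    ultimately show ?thesis by simp
  qed
  define T where "T n = ((\<lambda>t. s + sqrt 2 * t) ^^ n) s" for n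
  have T: "T 0 = s" "T (Suc n) = s + sqrt 2 * T n" for n by (simp_all add: T_def)
  \<comment> \<open>The exact solution is ((2 + sqrt 2) sqrt 2 ^ n - (1 + sqrt 2)) s. The constants
    4 and 3 are round replacements: 4 - 3 = 1 starts the induction, and 3 sqrt 2 \<ge> 4 carries it
    on.\<close>
  have Tb: "T n \<le> (4 * sqrt 2 ^ n - 3) * s" for n
  proof (induction n)
    case 0 show ?case using T by simp
  next
    case (Suc n)
    have sq: "4/3 \<le> sqrt 2" by (rule real_le_rsqrt) (simp add: power2_eq_square)
    have "T (Suc n) \<le> s + sqrt 2 * ((4 * sqrt 2 ^ n - 3) * s)"
      unfolding T(2) using mult_left_mono[OF Suc, of "sqrt 2"] by simp
    also have "\<dots> = (4 * sqrt 2 ^ Suc n - 3) * s - (3 * sqrt 2 - 4) * s" by (simp add: algebra_simps)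
    also have "\<dots> \<le> (4 * sqrt 2 ^ Suc n - 3) * s"
      using sq s by simp
    finally show ?case .
  qed
  \<comment> \<open>The quantity 4/3 p is at most squared at each step and starts below 4/3 times
    1/4, that is 1/3.\<close>
  have pT: "p (T n) \<le> 3/4 * (1/3) ^ (2 ^ n)" for n
  proof (induction n)
    case 0 show ?case using s T by (simp add: p_def)
  next
    case (Suc n)
    have "p (T (Suc n)) \<le> 4/3 * (p (T n))\<^sup>2" unfolding T(2) by (rule rec)
    also have "\<dots> \<le> 4/3 * (3/4 * (1/3) ^ (2 ^ n))\<^sup>2"
      using Suc p0 by (intro mult_left_mono power_mono) auto
    also have "\<dots> = 3/4 * (1/3) ^ (2 ^ Suc n)"
      by (simp add: power_mult_distrib power2_eq_square mult_2 power_add)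
    finally show ?case .
  qed
  have tail: "p t \<le> exp (- (1 / (32 * s\<^sup>2)) * t\<^sup>2)" if t: "t \<ge> 4 * s" for t
  proof -
    \<comment> \<open>n will be the dyadic order of x, so 2^n \<le> x < 2^(n + 1). The left
      inequality puts \<open>T n\<close> below t; the right one gives 2^n > x / 2, the source of the
      constant 32 = 2 times 16. The base 1/3 is then replaced by 1/e.\<close>
    define x where "x = t\<^sup>2 / (16 * s\<^sup>2)"
    have "(4 * s)\<^sup>2 \<le> t\<^sup>2" using t s by (intro power_mono) auto
    then have x1: "x \<ge> 1" using s by (simp add: x_def power_mult_distrib)
    obtain N where "x < 2 ^ N" using real_arch_pow[of 2 x] by auto
    then obtain k where k: "\<forall>i<k. \<not> x < 2 ^ i" "x < 2 ^ k" using ex_least_nat_le[of "\<lambda>n. x < 2 ^ n" N] by blast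
    then obtain n where n: "k = Suc n" using x1 by (cases k) auto
    have lo: "2 ^ n \<le> x" and hi: "x < 2 * 2 ^ n" using k n by (auto simp: not_less)
    have "(4 * sqrt 2 ^ n * s)\<^sup>2 = 16 * s\<^sup>2 * 2 ^ n"
    proof -
      have "(sqrt 2 ^ n)\<^sup>2 = ((sqrt 2)\<^sup>2) ^ n" by (simp only: power_mult[symmetric] mult.commute)
      also have "\<dots> = 2 ^ n" by simp
      finally show ?thesis by (simp only: power_mult_distrib) simp
    qed
    also have "\<dots> \<le> t\<^sup>2" using lo s by (simp add: x_def field_simps)
    finally have "(4 * sqrt 2 ^ n * s)\<^sup>2 \<le> t\<^sup>2" .
    then have "4 * sqrt 2 ^ n * s \<le> t" by (rule power2_le_imp_le) (use t s in simp)
    then have "T n \<le> t" using Tb[of n] s by (simp add: algebra_simps)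
    then have "p t \<le> 3/4 * (1/3) ^ (2 ^ n)" using mono pT order_trans by blast
    also have "\<dots> \<le> (1/3) ^ (2 ^ n)" by simp
    also have "\<dots> \<le> exp (- 1) ^ (2 ^ n)"
      using exp_le by (intro power_mono) (auto simp: exp_minus field_simps)
    also have "\<dots> = exp (- (2 ^ n))" by (simp flip: exp_of_nat_mult)
    also have "\<dots> \<le> exp (- x / 2)" using hi by simp
    also have "- x / 2 = - (1 / (32 * s\<^sup>2)) * t\<^sup>2" by (simp add: x_def)
    finally show ?thesis .
  qed
  show ?thesis
  proof (rule that[of "4 * s" "1 / (32 * s\<^sup>2)"])
    have "p (4 * s) \<le> p s" using s by (intro mono) auto
    then show "1/2 \<le> measure M (sup_le y (4 * s))" using s by (simp add: p_def)
    show "1 - measure M (sup_le y t) \<le> exp (- (1 / (32 * s\<^sup>2)) * t\<^sup>2)" if "4 * s \<le> t" for t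
      using tail[OF that] by (simp add: p_def)
  qed (use s in auto)
qed

end

section \<open>The Gaussian space of a field\<close>

text \<open>Lets cosine integrals follow mean square convergence.\<close>

lemma abs_cos_diff_le: "\<bar>cos a - cos b\<bar> \<le> \<bar>a - b\<bar>" for a b :: real
proof -
  have "\<bar>cos a - cos b\<bar> = 2 * (\<bar>sin ((a + b) / 2)\<bar> * \<bar>sin ((b - a) / 2)\<bar>)"
    by (simp add: cos_diff_cos abs_mult)
  also have "\<dots> \<le> 2 * (1 * \<bar>(b - a) / 2\<bar>)"
    by (intro mult_left_mono mult_mono abs_sin_x_le_abs_x abs_sin_le_one) simp_all
  finally show ?thesis by simp
qed

lemma lin_combs_zero: "(\<lambda>\<omega>. 0) \<in> lin_combs X T"
  unfolding lin_combs_def by (rule CollectI, rule exI[of _ 0]) simp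

lemma lin_combs_sum:
  fixes n :: nat
  assumes "\<And>j. j < n \<Longrightarrow> t j \<in> T"
  shows "(\<lambda>\<omega>. \<Sum>j<n. c j * X (t j) \<omega>) \<in> lin_combs X T"
  unfolding lin_combs_def using assms by blast

lemma sum_lessThan_plus: "(\<Sum>j<n + m. f j) = (\<Sum>j<n. f j) + (\<Sum>j<m. f (n + j))" for n m :: nat
  and f :: "nat \<Rightarrow> 'b::comm_monoid_add"
  by (induction m) (simp_all add: add.assoc)

lemma lin_combs_lin:
  assumes "Y \<in> lin_combs X T" "W \<in> lin_combs X T"
  shows "(\<lambda>\<omega>. a * Y \<omega> + b * W \<omega>) \<in> lin_combs X T"
proof -
  obtain n c t where Y: "\<forall>j<n. t j \<in> T" "Y = (\<lambda>\<omega>. \<Sum>j<(n::nat). c j * X (t j) \<omega>)"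
    using assms(1) unfolding lin_combs_def by blast
  obtain m d r where W: "\<forall>j<m. r j \<in> T" "W = (\<lambda>\<omega>. \<Sum>j<(m::nat). d j * X (r j) \<omega>)"
    using assms(2) unfolding lin_combs_def by blast
  \<comment> \<open>Coefficients and points of the two combinations are concatenated.\<close>
  define e where "e j = (if j < n then a * c j else b * d (j - n))" for j
  define q where "q j = (if j < n then t j else r (j - n))" for j
  have "(\<lambda>\<omega>. \<Sum>j<n + m. e j * X (q j) \<omega>) \<in> lin_combs X T"
    by (rule lin_combs_sum) (use Y W in \<open>auto simp: q_def\<close>)
  moreover have "(\<Sum>j<n + m. e j * X (q j) \<omega>) = a * Y \<omega> + b * W \<omega>" for \<omega>
    unfolding sum_lessThan_plus Y W sum_distrib_left by (simp add: e_def q_def mult.assoc)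
  ultimately show ?thesis by simp
qed

context gauss_linear
begin

lemma L_diff: "Z \<in> L \<Longrightarrow> W \<in> L \<Longrightarrow> (\<lambda>\<omega>. Z \<omega> - W \<omega>) \<in> L"
  using L_lin[of Z W 1 "-1"] by simp

text \<open>Gaussianity takes the place of an integrable majorant: dominated convergence is applied
  to the bounded cosines, and the logarithm of their limit returns the variances.\<close>

lemma L_tendsto_zero:
  assumes D: "\<And>k. D k \<in> L" and lim: "\<And>\<omega>. \<omega> \<in> space M \<Longrightarrow> (\<lambda>k. D k \<omega>) \<longlonglongrightarrow> 0"
  shows "(\<lambda>k. \<integral>\<omega>. (D k \<omega>)\<^sup>2 \<partial>M) \<longlonglongrightarrow> 0"
proof -
  have [measurable]: "D k \<in> borel_measurable M" for k by (rule L_measurable[OF D])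
  have "(\<lambda>k. \<integral>\<omega>. cos (0 + D k \<omega>) \<partial>M) \<longlonglongrightarrow> (\<integral>\<omega>. cos (0 + 0) \<partial>M)"
  proof (rule integral_dominated_convergence[where w="\<lambda>_. 1"])
    show "AE \<omega> in M. (\<lambda>k. cos (0 + D k \<omega>)) \<longlonglongrightarrow> cos (0 + 0)"
      by (rule AE_I2, intro tendsto_intros lim)
  qed auto
  then have "(\<lambda>k. exp (- (msq (D k)) / 2)) \<longlonglongrightarrow> 1"
    unfolding L_cos[OF D] by (simp add: prob_space)
  then have "(\<lambda>k. - 2 * ln (exp (- (msq (D k)) / 2))) \<longlonglongrightarrow> - 2 * ln 1"
    by (intro tendsto_intros) auto
  then show ?thesis by simp
qed

text \<open>Almost sure convergence of jointly Gaussian variables forces mean square convergence: the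
  characteristic functions of the differences tend to 1, hence the variances tend to 0.\<close>

lemma L_pointwise_limit:
  assumes Z: "\<And>n. Y n \<in> L" and lim: "\<And>\<omega>. \<omega> \<in> space M \<Longrightarrow> (\<lambda>n. Y n \<omega>) \<longlonglongrightarrow> Z \<omega>"
  shows "sq_integrable M Z" "(\<lambda>n. \<integral>\<omega>. (Y n \<omega> - Z \<omega>)\<^sup>2 \<partial>M) \<longlonglongrightarrow> 0"
proof -
  have Ym[measurable]: "Y n \<in> borel_measurable M" for n by (rule L_measurable[OF Z])
  have Zm[measurable]: "Z \<in> borel_measurable M"
    by (rule borel_measurable_LIMSEQ_metric[where f=Y, OF Ym lim])
  \<comment> \<open>Otherwise two index sequences tending to infinity keep the differences apart in
    mean square, although these differences tend to 0 pointwise.\<close>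
  have cauchy: "\<exists>N. \<forall>n\<ge>N. \<forall>m\<ge>N. (\<integral>\<omega>. (Y n \<omega> - Y m \<omega>)\<^sup>2 \<partial>M) \<le> e" if e: "e > 0" for e
  proof (rule ccontr)
    assume "\<not> ?thesis"
    then have "\<forall>N. \<exists>n m. n \<ge> N \<and> m \<ge> N \<and> e < (\<integral>\<omega>. (Y n \<omega> - Y m \<omega>)\<^sup>2 \<partial>M)"
      by (simp add: not_le)
    then obtain f g where fg: "\<And>N. f N \<ge> N" "\<And>N. g N \<ge> N" "\<And>N. e < (\<integral>\<omega>. (Y (f N) \<omega> - Y (g N) \<omega>)\<^sup>2 \<partial>M)"
      by metis
    have f: "filterlim f at_top sequentially" and g: "filterlim g at_top sequentially"
      by (rule filterlim_at_top_mono[OF filterlim_ident always_eventually[OF allI]], rule fg)+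
    have "(\<lambda>k. \<integral>\<omega>. (Y (f k) \<omega> - Y (g k) \<omega>)\<^sup>2 \<partial>M) \<longlonglongrightarrow> 0"
    proof (rule L_tendsto_zero)
      show "(\<lambda>\<omega>. Y (f k) \<omega> - Y (g k) \<omega>) \<in> L" for k by (rule L_diff[OF Z Z])
      show "(\<lambda>k. Y (f k) \<omega> - Y (g k) \<omega>) \<longlonglongrightarrow> 0" if "\<omega> \<in> space M" for \<omega>
        using tendsto_diff[OF filterlim_compose[OF lim[OF that] f] filterlim_compose[OF lim[OF that] g]] by simp
    qed
    then have "eventually (\<lambda>k. (\<integral>\<omega>. (Y (f k) \<omega> - Y (g k) \<omega>)\<^sup>2 \<partial>M) < e) sequentially"
      using e by (rule order_tendstoD(2))
    then obtain k where "(\<integral>\<omega>. (Y (f k) \<omega> - Y (g k) \<omega>)\<^sup>2 \<partial>M) < e"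
      using eventually_happens'[OF sequentially_bot] by blast
    then show False using fg(3)[of k] by simp
  qed
  \<comment> \<open>Fatou's lemma in the second index. Extended integrals are used because square
    integrability of the limit is not known yet.\<close>
  have fatou: "\<exists>N. \<forall>n\<ge>N. (\<integral>\<^sup>+\<omega>. ennreal ((Y n \<omega> - Z \<omega>)\<^sup>2) \<partial>M) \<le> ennreal e" if e: "e > 0" for e
  proof -
    obtain N where N: "\<forall>n\<ge>N. \<forall>m\<ge>N. (\<integral>\<omega>. (Y n \<omega> - Y m \<omega>)\<^sup>2 \<partial>M) \<le> e" using cauchy[OF e] by blast
    have "(\<integral>\<^sup>+\<omega>. ennreal ((Y n \<omega> - Z \<omega>)\<^sup>2) \<partial>M) \<le> ennreal e" if n: "n \<ge> N" for n
    proof -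
      have "(\<integral>\<^sup>+\<omega>. ennreal ((Y n \<omega> - Z \<omega>)\<^sup>2) \<partial>M) = (\<integral>\<^sup>+\<omega>. liminf (\<lambda>m. ennreal ((Y n \<omega> - Y m \<omega>)\<^sup>2)) \<partial>M)"
      proof (rule nn_integral_cong)
        fix \<omega> assume "\<omega> \<in> space M"
        then have "(\<lambda>m. ennreal ((Y n \<omega> - Y m \<omega>)\<^sup>2)) \<longlonglongrightarrow> ennreal ((Y n \<omega> - Z \<omega>)\<^sup>2)"
          by (intro tendsto_ennrealI tendsto_intros lim)
        then show "ennreal ((Y n \<omega> - Z \<omega>)\<^sup>2) = liminf (\<lambda>m. ennreal ((Y n \<omega> - Y m \<omega>)\<^sup>2))"
          using lim_imp_Liminf[OF sequentially_bot] by metis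
      qed
      also have "\<dots> \<le> liminf (\<lambda>m. \<integral>\<^sup>+\<omega>. ennreal ((Y n \<omega> - Y m \<omega>)\<^sup>2) \<partial>M)"
        by (rule nn_integral_liminf) measurable
      also have "\<dots> \<le> limsup (\<lambda>m. \<integral>\<^sup>+\<omega>. ennreal ((Y n \<omega> - Y m \<omega>)\<^sup>2) \<partial>M)"
        by (rule Liminf_le_Limsup[OF sequentially_bot])
      also have "\<dots> \<le> ennreal e"
      proof (rule Limsup_bounded, rule eventually_sequentiallyI[of N])
        fix m assume m: "m \<ge> N"
        have "integrable M (\<lambda>\<omega>. (Y n \<omega> - Y m \<omega>)\<^sup>2)"
          using L_sq[OF L_diff[OF Z[of n] Z[of m]]] by (rule sq_integrable_square)
        then have "(\<integral>\<^sup>+\<omega>. ennreal ((Y n \<omega> - Y m \<omega>)\<^sup>2) \<partial>M) = ennreal (\<integral>\<omega>. (Y n \<omega> - Y m \<omega>)\<^sup>2 \<partial>M)"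
          by (intro nn_integral_eq_integral) auto
        then show "(\<integral>\<^sup>+\<omega>. ennreal ((Y n \<omega> - Y m \<omega>)\<^sup>2) \<partial>M) \<le> ennreal e"
          using N n m by (simp add: ennreal_leI)
      qed
      finally show ?thesis .
    qed
    then show ?thesis by blast
  qed
  have int: "integrable M (\<lambda>\<omega>. (Y n \<omega> - Z \<omega>)\<^sup>2)" if "(\<integral>\<^sup>+\<omega>. ennreal ((Y n \<omega> - Z \<omega>)\<^sup>2) \<partial>M) \<le> ennreal e" for n e
    using that le_less_trans[OF that ennreal_less_top] by (intro integrableI_nonneg) auto
  obtain N where N: "\<forall>n\<ge>N. (\<integral>\<^sup>+\<omega>. ennreal ((Y n \<omega> - Z \<omega>)\<^sup>2) \<partial>M) \<le> ennreal 1" using fatou[of 1] by auto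
  then have "sq_integrable M (\<lambda>\<omega>. Y N \<omega> - Z \<omega>)"
    unfolding sq_integrable_def using int[of N 1] by auto
  then have "sq_integrable M (\<lambda>\<omega>. 1 * Y N \<omega> + (-1) * (Y N \<omega> - Z \<omega>))"
    by (rule sq_integrable_lin[OF L_sq[OF Z]])
  then show "sq_integrable M Z" by simp
  show "(\<lambda>n. \<integral>\<omega>. (Y n \<omega> - Z \<omega>)\<^sup>2 \<partial>M) \<longlonglongrightarrow> 0"
  proof (rule LIMSEQ_I)
    fix r :: real assume "r > 0"
    then obtain N where N: "\<forall>n\<ge>N. (\<integral>\<^sup>+\<omega>. ennreal ((Y n \<omega> - Z \<omega>)\<^sup>2) \<partial>M) \<le> ennreal (r / 2)"
      using fatou[of "r/2"] by auto
    have "norm ((\<integral>\<omega>. (Y n \<omega> - Z \<omega>)\<^sup>2 \<partial>M) - 0) < r" if "n \<ge> N" for n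
    proof -
      have le: "(\<integral>\<^sup>+\<omega>. ennreal ((Y n \<omega> - Z \<omega>)\<^sup>2) \<partial>M) \<le> ennreal (r / 2)" using N that by blast
      have "(\<integral>\<^sup>+\<omega>. ennreal ((Y n \<omega> - Z \<omega>)\<^sup>2) \<partial>M) = ennreal (\<integral>\<omega>. (Y n \<omega> - Z \<omega>)\<^sup>2 \<partial>M)"
        using int[OF le] by (intro nn_integral_eq_integral) auto
      then have "(\<integral>\<omega>. (Y n \<omega> - Z \<omega>)\<^sup>2 \<partial>M) \<le> r / 2" using le \<open>r > 0\<close> by simp
      moreover have "0 \<le> (\<integral>\<omega>. (Y n \<omega> - Z \<omega>)\<^sup>2 \<partial>M)" by simp
      ultimately show ?thesis using \<open>r > 0\<close> by (simp only: diff_0_right real_norm_def)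
    qed
    then show "\<exists>no. \<forall>n\<ge>no. norm ((\<integral>\<omega>. (Y n \<omega> - Z \<omega>)\<^sup>2 \<partial>M) - 0) < r" by blast
  qed
qed

end

context
  fixes M :: "'a measure" and X :: "'t \<Rightarrow> 'a \<Rightarrow> real" and T :: "'t set"
  assumes gf: "centered_gaussian_field M X T"
begin

lemma field_prob_space: "prob_space M" using gf by (simp add: centered_gaussian_field_def)

lemma lin_combs_sq: "Y \<in> lin_combs X T \<Longrightarrow> sq_integrable M Y"
  using gf centered_normal_rv_props(1)[OF field_prob_space] by (simp add: centered_gaussian_field_def)

lemma gauss_space_iff:
  "H \<in> gauss_space M X T \<longleftrightarrow> sq_integrable M H \<and>
     (\<exists>Y. (\<forall>n. Y n \<in> lin_combs X T) \<and> (\<lambda>n. \<integral>\<omega>. (Y n \<omega> - H \<omega>)\<^sup>2 \<partial>M) \<longlonglongrightarrow> 0)"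
  by (auto simp: gauss_space_def sq_integrable_def)

lemma lin_combs_gauss_space: "Y \<in> lin_combs X T \<Longrightarrow> Y \<in> gauss_space M X T"
  unfolding gauss_space_iff using lin_combs_sq by (auto intro!: exI[of _ "\<lambda>_. Y"])

text \<open>Linear combinations satisfy the axioms, and each axiom passes to mean square limits. For
  \<open>L_cos\<close>, the left side converges because cosine is 1-Lipschitz, the right side
  because second moments converge.\<close>

lemma gauss_space_gauss_linear: "gauss_linear M (gauss_space M X T)"
proof -
  interpret prob_space M by (rule field_prob_space)
  have sq1: "sq_integrable M (\<lambda>_. 1)" by (simp add: sq_integrable_def)
  show ?thesis
  proof
    show "sq_integrable M Z" if "Z \<in> gauss_space M X T" for Z using that by (simp add: gauss_space_iff)
    show "(\<lambda>\<omega>. 0) \<in> gauss_space M X T" by (rule lin_combs_gauss_space[OF lin_combs_zero])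
    show "(\<lambda>\<omega>. a * Z \<omega> + b * W \<omega>) \<in> gauss_space M X T"
      if Z: "Z \<in> gauss_space M X T" and W: "W \<in> gauss_space M X T" for Z W a b
    proof -
      obtain Y where Y: "\<And>n. Y n \<in> lin_combs X T" "(\<lambda>n. \<integral>\<omega>. (Y n \<omega> - Z \<omega>)\<^sup>2 \<partial>M) \<longlonglongrightarrow> 0"
        using Z gauss_space_iff by blast
      obtain V where V: "\<And>n. V n \<in> lin_combs X T" "(\<lambda>n. \<integral>\<omega>. (V n \<omega> - W \<omega>)\<^sup>2 \<partial>M) \<longlonglongrightarrow> 0"
        using W gauss_space_iff by blast
      have sZ: "sq_integrable M Z" and sW: "sq_integrable M W" using Z W gauss_space_iff by auto
      have dY: "sq_integrable M (\<lambda>\<omega>. Y n \<omega> - Z \<omega>)" for n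
        using sq_integrable_lin[OF lin_combs_sq[OF Y(1)[of n]] sZ, of 1 "-1"] by simp
      have dV: "sq_integrable M (\<lambda>\<omega>. V n \<omega> - W \<omega>)" for n
        using sq_integrable_lin[OF lin_combs_sq[OF V(1)[of n]] sW, of 1 "-1"] by simp
      have "(\<lambda>n. \<integral>\<omega>. ((a * Y n \<omega> + b * V n \<omega>) - (a * Z \<omega> + b * W \<omega>))\<^sup>2 \<partial>M) \<longlonglongrightarrow> 0"
      proof (rule tendsto_sandwich[OF _ _ tendsto_const])
        have "(\<lambda>n. 2 * a\<^sup>2 * (\<integral>\<omega>. (Y n \<omega> - Z \<omega>)\<^sup>2 \<partial>M) + 2 * b\<^sup>2 * (\<integral>\<omega>. (V n \<omega> - W \<omega>)\<^sup>2 \<partial>M))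
          \<longlonglongrightarrow> 2 * a\<^sup>2 * 0 + 2 * b\<^sup>2 * 0" by (intro tendsto_intros Y V)
        then show "(\<lambda>n. 2 * a\<^sup>2 * (\<integral>\<omega>. (Y n \<omega> - Z \<omega>)\<^sup>2 \<partial>M) + 2 * b\<^sup>2 * (\<integral>\<omega>. (V n \<omega> - W \<omega>)\<^sup>2 \<partial>M)) \<longlonglongrightarrow> 0"
          by simp
        have "(\<integral>\<omega>. ((a * Y n \<omega> + b * V n \<omega>) - (a * Z \<omega> + b * W \<omega>))\<^sup>2 \<partial>M)
           \<le> 2 * a\<^sup>2 * (\<integral>\<omega>. (Y n \<omega> - Z \<omega>)\<^sup>2 \<partial>M) + 2 * b\<^sup>2 * (\<integral>\<omega>. (V n \<omega> - W \<omega>)\<^sup>2 \<partial>M)" for n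
        proof -
          have "(\<integral>\<omega>. ((a * Y n \<omega> + b * V n \<omega>) - (a * Z \<omega> + b * W \<omega>))\<^sup>2 \<partial>M)
            = (\<integral>\<omega>. (a * (Y n \<omega> - Z \<omega>) + b * (V n \<omega> - W \<omega>))\<^sup>2 \<partial>M)" by (simp add: algebra_simps)
          \<comment> \<open>Nonnegativity of the combination with opposite sign bounds the mixed
            term: (x + y)^2 \<le> 2 x^2 + 2 y^2 in integrated form.\<close>
          moreover have "0 \<le> (\<integral>\<omega>. (a * (Y n \<omega> - Z \<omega>) + (-b) * (V n \<omega> - W \<omega>))\<^sup>2 \<partial>M)"
            by (rule integral_nonneg_AE) simp
          ultimately show ?thesis unfolding integral_square_lin[OF dY dV] by simp
        qed
        then show "\<forall>\<^sub>F n in sequentially. (\<integral>\<omega>. ((a * Y n \<omega> + b * V n \<omega>) - (a * Z \<omega> + b * W \<omega>))\<^sup>2 \<partial>M)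
           \<le> 2 * a\<^sup>2 * (\<integral>\<omega>. (Y n \<omega> - Z \<omega>)\<^sup>2 \<partial>M) + 2 * b\<^sup>2 * (\<integral>\<omega>. (V n \<omega> - W \<omega>)\<^sup>2 \<partial>M)"
          by (rule always_eventually[OF allI])
      qed (simp add: always_eventually)
      then show ?thesis unfolding gauss_space_iff
        using sq_integrable_lin[OF sZ sW] lin_combs_lin[OF Y(1) V(1)]
        by (auto intro!: exI[of _ "\<lambda>n \<omega>. a * Y n \<omega> + b * V n \<omega>"])
    qed
    show "(\<integral>\<omega>. cos (\<theta> + Z \<omega>) \<partial>M) = cos \<theta> * exp (- (\<integral>\<omega>. (Z \<omega>)\<^sup>2 \<partial>M) / 2)"
      if Z: "Z \<in> gauss_space M X T" for Z \<theta>
    proof -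
      obtain Y where Y: "\<And>n. Y n \<in> lin_combs X T" "(\<lambda>n. \<integral>\<omega>. (Y n \<omega> - Z \<omega>)\<^sup>2 \<partial>M) \<longlonglongrightarrow> 0"
        using Z gauss_space_iff by blast
      have sZ: "sq_integrable M Z" using Z gauss_space_iff by auto
      have sY: "sq_integrable M (Y n)" for n by (rule lin_combs_sq[OF Y(1)])
      have Ym[measurable]: "Y n \<in> borel_measurable M" for n by (rule sq_integrable_measurable[OF sY])
      have [measurable]: "Z \<in> borel_measurable M" by (rule sq_integrable_measurable[OF sZ])
      have "(\<integral>\<omega>. cos (\<theta> + Y n \<omega>) \<partial>M) = cos \<theta> * exp (- (\<integral>\<omega>. (Y n \<omega>)\<^sup>2 \<partial>M) / 2)" for n
        using centered_normal_rv_props(2)[OF field_prob_space] gf Y(1)[of n] by (simp add: centered_gaussian_field_def)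
      then have l1: "(\<lambda>n. \<integral>\<omega>. cos (\<theta> + Y n \<omega>) \<partial>M) \<longlonglongrightarrow> cos \<theta> * exp (- (\<integral>\<omega>. (Z \<omega>)\<^sup>2 \<partial>M) / 2)"
        using tendsto_integral_square_L2[OF sY sZ Y(2)] by (simp only:) (intro tendsto_intros, simp_all)
      have dY: "sq_integrable M (\<lambda>\<omega>. \<bar>Y n \<omega> - Z \<omega>\<bar>)" for n
        using sq_integrable_lin[OF sY[of n] sZ, of 1 "-1"] by (simp add: sq_integrable_def)
      have bnd: "norm ((\<integral>\<omega>. cos (\<theta> + Y n \<omega>) \<partial>M) - (\<integral>\<omega>. cos (\<theta> + Z \<omega>) \<partial>M)) \<le> sqrt (\<integral>\<omega>. (Y n \<omega> - Z \<omega>)\<^sup>2 \<partial>M)" for n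
      proof -
        have i: "integrable M (\<lambda>\<omega>. \<bar>Y n \<omega> - Z \<omega>\<bar>)" using sq_integrable_mult[OF dY sq1] by simp
        have c: "integrable M (\<lambda>\<omega>. cos (\<theta> + Y n \<omega>))" "integrable M (\<lambda>\<omega>. cos (\<theta> + Z \<omega>))"
          by (rule integrable_const_bound[where B=1]; simp)+
        have "norm ((\<integral>\<omega>. cos (\<theta> + Y n \<omega>) \<partial>M) - (\<integral>\<omega>. cos (\<theta> + Z \<omega>) \<partial>M)) = norm (\<integral>\<omega>. cos (\<theta> + Y n \<omega>) - cos (\<theta> + Z \<omega>) \<partial>M)"
          using c by simp
        also have "\<dots> \<le> (\<integral>\<omega>. norm (cos (\<theta> + Y n \<omega>) - cos (\<theta> + Z \<omega>)) \<partial>M)" by (rule integral_norm_bound)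
        also have "\<dots> \<le> (\<integral>\<omega>. \<bar>Y n \<omega> - Z \<omega>\<bar> \<partial>M)"
        proof (rule integral_mono)
          show "norm (cos (\<theta> + Y n \<omega>) - cos (\<theta> + Z \<omega>)) \<le> \<bar>Y n \<omega> - Z \<omega>\<bar>" for \<omega>
            using abs_cos_diff_le[of "\<theta> + Y n \<omega>" "\<theta> + Z \<omega>"] by simp
        qed (use c i in auto)
        also have "\<dots> \<le> sqrt (\<integral>\<omega>. (Y n \<omega> - Z \<omega>)\<^sup>2 \<partial>M)"
          using integral_Cauchy_Schwarz[OF dY[of n] sq1] by (intro real_le_rsqrt) (simp add: prob_space)
        finally show ?thesis .
      qed
      have "(\<lambda>n. sqrt (\<integral>\<omega>. (Y n \<omega> - Z \<omega>)\<^sup>2 \<partial>M)) \<longlonglongrightarrow> sqrt 0" by (intro tendsto_intros Y(2))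
      then have z: "(\<lambda>n. sqrt (\<integral>\<omega>. (Y n \<omega> - Z \<omega>)\<^sup>2 \<partial>M)) \<longlonglongrightarrow> 0" by simp
      have l2: "(\<lambda>n. \<integral>\<omega>. cos (\<theta> + Y n \<omega>) \<partial>M) \<longlonglongrightarrow> (\<integral>\<omega>. cos (\<theta> + Z \<omega>) \<partial>M)"
        by (rule LIM_zero_cancel, rule Lim_null_comparison[OF _ z], rule always_eventually, rule allI, rule bnd)
      show ?thesis by (rule LIMSEQ_unique[OF l2 l1])
    qed
  qed
qed

end

section \<open>Probability measures on the unit interval\<close>

lemma M1_01_D:
  assumes "\<mu> \<in> M1_01"
  shows "prob_space \<mu>" "sets \<mu> = sets (restrict_space borel {0..1})" "space \<mu> = {0..1}"
proof -
  show "prob_space \<mu>" and s: "sets \<mu> = sets (restrict_space borel {0..1})"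
    using assms by (auto simp: M1_01_def)
  show "space \<mu> = {0..1}" using sets_eq_imp_space_eq[OF s] by (simp add: space_restrict_space)
qed

lemma M1_01_measurable:
  fixes f :: "real \<Rightarrow> real"
  assumes "\<mu> \<in> M1_01" "continuous_on {0..1} f"
  shows "f \<in> borel_measurable \<mu>"
  using borel_measurable_continuous_on_restrict[OF assms(2)] M1_01_D(2)[OF assms(1)]
  by (simp cong: measurable_cong_sets)

lemma continuous_on_unit_interval_bounded:
  fixes f :: "real \<Rightarrow> real"
  assumes "continuous_on {0..1} f"
  obtains B where "B > 0" "\<And>v. v \<in> {0..1} \<Longrightarrow> \<bar>f v\<bar> \<le> B"
proof -
  have "bounded (f ` {0..1})" using compact_continuous_image[OF assms] compact_imp_bounded by auto
  then obtain B where "B > 0" "\<forall>x\<in>f ` {0..1}. norm x \<le> B" unfolding bounded_pos by blast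
  then show ?thesis using that by auto
qed

lemma M1_01_integrable:
  fixes f :: "real \<Rightarrow> real"
  assumes m: "\<mu> \<in> M1_01" and f: "continuous_on {0..1} f"
  shows "integrable \<mu> f"
proof -
  interpret prob_space \<mu> by (rule M1_01_D[OF m])
  obtain B where B: "\<And>v. v \<in> {0..1} \<Longrightarrow> \<bar>f v\<bar> \<le> B" using continuous_on_unit_interval_bounded[OF f] by blast
  show ?thesis
    by (rule integrable_const_bound[where B=B])
       (use B M1_01_D(3)[OF m] M1_01_measurable[OF m f] in auto)
qed

text \<open>Cells of length 1 / (n + 1). The index n + 1 occurs only at v = 1, hence the n + 2
  summands in \<open>riemann\<close>.\<close>

definition cell :: "nat \<Rightarrow> nat \<Rightarrow> real set" where
  "cell n k = {v\<in>{0..1}. nat \<lfloor>real (Suc n) * v\<rfloor> = k}"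

lemma cell_sets: "\<mu> \<in> M1_01 \<Longrightarrow> cell n k \<in> sets \<mu>"
proof -
  have "cell n k \<in> sets borel" unfolding cell_def by measurable
  then show "\<mu> \<in> M1_01 \<Longrightarrow> cell n k \<in> sets \<mu>"
    using M1_01_D(2) by (simp add: sets_restrict_space_iff) (auto simp: cell_def)
qed

text \<open>Tagged at left endpoints. When f is a path of the field, this is a finite linear
  combination of field values whose weights do not depend on the sample point.\<close>

definition riemann :: "real measure \<Rightarrow> (real \<Rightarrow> real) \<Rightarrow> nat \<Rightarrow> real" where
  "riemann \<mu> f n = (\<Sum>k<Suc (Suc n). measure \<mu> (cell n k) * f (real k / real (Suc n)))"

lemma riemann_tendsto:
  fixes f :: "real \<Rightarrow> real"
  assumes m: "\<mu> \<in> M1_01" and f: "continuous_on {0..1} f"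
  shows "riemann \<mu> f \<longlonglongrightarrow> (\<integral>v. f v \<partial>\<mu>)"
proof -
  interpret prob_space \<mu> by (rule M1_01_D[OF m])
  obtain B where B: "\<And>v. v \<in> {0..1} \<Longrightarrow> \<bar>f v\<bar> \<le> B" using continuous_on_unit_interval_bounded[OF f] by blast
  let ?s = "\<lambda>n v. \<Sum>k<Suc (Suc n). indicator (cell n k) v * f (real k / real (Suc n))"
  \<comment> \<open>Left endpoint of the cell containing v; the step function \<open>?s n\<close> is
    f evaluated there.\<close>
  define q where "q n v = real (nat \<lfloor>real (Suc n) * v\<rfloor>) / real (Suc n)" for n v
  have q: "q n v \<in> {0..1}" "\<bar>q n v - v\<bar> \<le> 1 / real (Suc n)" "nat \<lfloor>real (Suc n) * v\<rfloor> < Suc (Suc n)" if v: "v \<in> {0..1}" for n v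
  proof -
    define z where "z = \<lfloor>real (Suc n) * v\<rfloor>"
    have nn: "0 \<le> real (Suc n) * v" using v by simp
    then have z0: "0 \<le> z" by (simp add: z_def)
    have le: "real_of_int z \<le> real (Suc n) * v" and gt: "real (Suc n) * v < real_of_int z + 1"
      unfolding z_def by linarith+
    have le2: "real (Suc n) * v \<le> real (Suc n)" using v by (simp add: mult_left_le)
    have rz: "real (nat z) = real_of_int z" using z0 by simp
    have "real (nat z) < real (Suc (Suc n))" using rz order_trans[OF le le2] by simp
    then show "nat \<lfloor>real (Suc n) * v\<rfloor> < Suc (Suc n)" unfolding z_def by linarith
    have "q n v = real_of_int z / real (Suc n)" using rz by (simp add: q_def z_def)
    moreover have "real_of_int z / real (Suc n) \<le> 1" using order_trans[OF le le2] by simp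
    moreover have "0 \<le> real_of_int z / real (Suc n)" using z0 by simp
    moreover have "real_of_int z / real (Suc n) \<le> v" using le by (simp add: field_simps)
    moreover have "v - real_of_int z / real (Suc n) \<le> 1 / real (Suc n)"
    proof -
      have "v * real (Suc n) \<le> real_of_int z + 1" using gt by (simp add: mult.commute)
      then have "v \<le> (real_of_int z + 1) / real (Suc n)" by (simp only: pos_le_divide_eq of_nat_0_less_iff zero_less_Suc)
      then show ?thesis unfolding add_divide_distrib by linarith
    qed
    ultimately show "q n v \<in> {0..1}" "\<bar>q n v - v\<bar> \<le> 1 / real (Suc n)" by (simp_all add: abs_le_iff)
  qed
  have eq: "(?s n v) = f (q n v)" if v: "v \<in> {0..1}" for n v
  proof -
    have "(?s n v)
      = (\<Sum>k<Suc (Suc n). if k = nat \<lfloor>real (Suc n) * v\<rfloor> then f (real k / real (Suc n)) else 0)"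
      using v by (intro sum.cong refl) (auto simp: indicator_def cell_def)
    also have "\<dots> = f (q n v)" using q(3)[OF v] by (subst sum.delta) (auto simp: q_def)
    finally show ?thesis .
  qed
  have cm[measurable]: "cell n k \<in> sets \<mu>" for n k by (rule cell_sets[OF m])
  have int: "(\<integral>v. (?s n v) \<partial>\<mu>) = riemann \<mu> f n" for n
  proof -
    have "(\<integral>v. (?s n v) \<partial>\<mu>)
      = (\<Sum>k<Suc (Suc n). (\<integral>v. indicator (cell n k) v * f (real k / real (Suc n)) \<partial>\<mu>))"
      by (rule Bochner_Integration.integral_sum)
         (intro integrable_mult_left integrable_real_indicator cm, simp add: emeasure_eq_measure)
    also have "\<dots> = riemann \<mu> f n"
      unfolding riemann_def integral_mult_left_zero Bochner_Integration.integral_indicator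
      by (intro sum.cong refl) (simp add: sets.Int_space_eq2[OF cm])
    finally show ?thesis .
  qed
  have "(\<lambda>n. (\<integral>v. (?s n v) \<partial>\<mu>)) \<longlonglongrightarrow> (\<integral>v. f v \<partial>\<mu>)"
  proof (rule integral_dominated_convergence[where w="\<lambda>_. B"])
    show "f \<in> borel_measurable \<mu>" by (rule M1_01_measurable[OF m f])
    show "AE v in \<mu>. (\<lambda>n. ?s n v) \<longlonglongrightarrow> f v"
    proof (rule AE_I2)
      fix v assume "v \<in> space \<mu>"
      then have v: "v \<in> {0..1}" using M1_01_D(3)[OF m] by simp
      have "(\<lambda>n. q n v) \<longlonglongrightarrow> v"
      proof (rule LIM_zero_cancel, rule Lim_null_comparison[OF _ LIMSEQ_inverse_real_of_nat], rule always_eventually, rule allI)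
        show "norm (q n v - v) \<le> inverse (real (Suc n))" for n using q(2)[OF v, of n] by (simp add: inverse_eq_divide)
      qed
      then have "(\<lambda>n. f (q n v)) \<longlonglongrightarrow> f v"
        by (rule continuous_on_tendsto_compose[OF f _ v]) (simp only: q(1)[OF v] eventually_True)
      then show "(\<lambda>n. ?s n v) \<longlonglongrightarrow> f v"
        unfolding eq[OF v] .
    qed
    show "AE v in \<mu>. norm (?s n v) \<le> B" for n
    proof (rule AE_I2)
      fix v assume "v \<in> space \<mu>"
      then have v: "v \<in> {0..1}" using M1_01_D(3)[OF m] by simp
      show "norm (?s n v) \<le> B"
        unfolding eq[OF v] real_norm_def by (rule B[OF q(1)[OF v]])
    qed
    show "(\<lambda>v. ?s n v) \<in> borel_measurable \<mu>" for n
      by (intro borel_measurable_sum borel_measurable_times borel_measurable_indicator cm borel_measurable_const)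
  qed simp
  then show ?thesis unfolding int .
qed

lemma mix_measure_M1_01:
  assumes m: "\<mu> \<in> M1_01" and n: "\<nu> \<in> M1_01" and p: "p \<in> {0..1}"
  shows "mix_measure p \<mu> \<nu> \<in> M1_01"
    and "A \<in> sets \<mu> \<Longrightarrow> measure (mix_measure p \<mu> \<nu>) A = p * measure \<mu> A + (1 - p) * measure \<nu> A"
proof -
  interpret m: prob_space \<mu> by (rule M1_01_D[OF m])
  interpret n: prob_space \<nu> by (rule M1_01_D[OF n])
  let ?R = "restrict_space borel {0..1::real}"
  have sp: "space ?R = {0..1}" by (simp add: space_restrict_space)
  have sets: "sets (mix_measure p \<mu> \<nu>) = sets ?R"
    unfolding mix_measure_def using sets.sigma_sets_eq[of ?R] sets.space_closed[of ?R] sp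
    by (simp add: sets_measure_of)
  have em: "emeasure (mix_measure p \<mu> \<nu>) A = ennreal p * emeasure \<mu> A + ennreal (1 - p) * emeasure \<nu> A"
    if A: "A \<in> sets ?R" for A
    unfolding mix_measure_def
  proof (rule emeasure_measure_of_sigma[OF _ _ _ A])
    show "sigma_algebra {0..1} (sets ?R)" using sets.sigma_algebra_axioms[of ?R] sp by simp
    show "positive (sets ?R) (\<lambda>A. ennreal p * emeasure \<mu> A + ennreal (1 - p) * emeasure \<nu> A)"
      by (simp add: positive_def)
    show "countably_additive (sets ?R) (\<lambda>A. ennreal p * emeasure \<mu> A + ennreal (1 - p) * emeasure \<nu> A)"
    proof (rule countably_additiveI)
      fix F :: "nat \<Rightarrow> real set" assume F: "range F \<subseteq> sets ?R" "disjoint_family F"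
      have "(\<Sum>i. emeasure \<mu> (F i)) = emeasure \<mu> (\<Union>i. F i)" "(\<Sum>i. emeasure \<nu> (F i)) = emeasure \<nu> (\<Union>i. F i)"
        using F M1_01_D(2)[OF m] M1_01_D(2)[OF n] by (auto intro!: suminf_emeasure)
      then show "(\<Sum>i. ennreal p * emeasure \<mu> (F i) + ennreal (1 - p) * emeasure \<nu> (F i))
        = ennreal p * emeasure \<mu> (\<Union>i. F i) + ennreal (1 - p) * emeasure \<nu> (\<Union>i. F i)"
        by (subst suminf_add[symmetric]) (auto simp: ennreal_suminf_cmult)
    qed
  qed
  have en: "emeasure (mix_measure p \<mu> \<nu>) A = ennreal (p * measure \<mu> A + (1 - p) * measure \<nu> A)"
    if A: "A \<in> sets ?R" for A
    using em[OF A] p by (simp add: m.emeasure_eq_measure n.emeasure_eq_measure ennreal_mult' ennreal_plus)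
  have spm: "space (mix_measure p \<mu> \<nu>) = {0..1}" using sets_eq_imp_space_eq[OF sets] sp by simp
  have top: "{0..1::real} \<in> sets ?R" using sets.top[of ?R] sp by simp
  have "emeasure (mix_measure p \<mu> \<nu>) (space (mix_measure p \<mu> \<nu>)) = 1"
    unfolding spm en[OF top] using m.prob_space n.prob_space M1_01_D(3)[OF m] M1_01_D(3)[OF n] by simp
  then show "mix_measure p \<mu> \<nu> \<in> M1_01" unfolding M1_01_def using sets by (auto intro: prob_spaceI)
  show "measure (mix_measure p \<mu> \<nu>) A = p * measure \<mu> A + (1 - p) * measure \<nu> A" if "A \<in> sets \<mu>"
    using en[of A] that M1_01_D(2)[OF m] p by (intro measure_eq_emeasure_eq_ennreal) auto
qed

text \<open>A measure enters a Riemann sum only through its cell masses, which are affine under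
  mixing; the identity then passes to the limit.\<close>

lemma mix_measure_integral:
  fixes f :: "real \<Rightarrow> real"
  assumes m: "\<mu> \<in> M1_01" and n: "\<nu> \<in> M1_01" and p: "p \<in> {0..1}" and f: "continuous_on {0..1} f"
  shows "(\<integral>v. f v \<partial>mix_measure p \<mu> \<nu>) = p * (\<integral>v. f v \<partial>\<mu>) + (1 - p) * (\<integral>v. f v \<partial>\<nu>)"
proof (rule LIMSEQ_unique)
  show "riemann (mix_measure p \<mu> \<nu>) f \<longlonglongrightarrow> (\<integral>v. f v \<partial>mix_measure p \<mu> \<nu>)"
    by (rule riemann_tendsto[OF mix_measure_M1_01(1)[OF m n p] f])
  have "riemann (mix_measure p \<mu> \<nu>) f = (\<lambda>k. p * riemann \<mu> f k + (1 - p) * riemann \<nu> f k)"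
    unfolding riemann_def mix_measure_M1_01(2)[OF m n p cell_sets[OF m]] sum_distrib_left sum.distrib[symmetric]
    by (intro ext sum.cong refl) (simp add: algebra_simps)
  then show "riemann (mix_measure p \<mu> \<nu>) f \<longlonglongrightarrow> p * (\<integral>v. f v \<partial>\<mu>) + (1 - p) * (\<integral>v. f v \<partial>\<nu>)"
    using riemann_tendsto[OF m f] riemann_tendsto[OF n f] by (simp only:) (intro tendsto_intros)
qed

lemma return_M1_01:
  fixes f :: "real \<Rightarrow> real"
  assumes "v \<in> {0..1}"
  shows "return (restrict_space borel {0..1}) v \<in> M1_01"
    and "continuous_on {0..1} f \<Longrightarrow> (\<integral>x. f x \<partial>return (restrict_space borel {0..1}) v) = f v"
proof -
  have v: "v \<in> space (restrict_space borel {0..1})" using assms by (simp add: space_restrict_space)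
  show "return (restrict_space borel {0..1}) v \<in> M1_01"
    unfolding M1_01_def using prob_space_return[OF v] by simp
  show "continuous_on {0..1} f \<Longrightarrow> (\<integral>x. f x \<partial>return (restrict_space borel {0..1}) v) = f v"
    by (rule integral_return[OF v borel_measurable_continuous_on_restrict])
qed

text \<open>Pushed to the whole line the measures are tight, so Helly's theorem yields a weak limit.
  It remains to see that the limit lives on the unit interval and to restrict it there.\<close>

lemma M1_01_sequentially_compact:
  fixes \<mu> :: "nat \<Rightarrow> real measure"
  assumes m: "\<And>n. \<mu> n \<in> M1_01"
  obtains r \<nu> where "strict_mono (r :: nat \<Rightarrow> nat)" "\<nu> \<in> M1_01"
    "\<And>f :: real \<Rightarrow> real. continuous_on {0..1} f \<Longrightarrow> (\<lambda>n. \<integral>v. f v \<partial>\<mu> (r n)) \<longlonglongrightarrow> (\<integral>v. f v \<partial>\<nu>)"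
proof -
  \<comment> \<open>Clamping to the unit interval extends test functions continuously to the
    line.\<close>
  define c where "c x = max 0 (min 1 x)" for x :: real
  have c01: "c x \<in> {0..1}" for x by (auto simp: c_def)
  have cid: "c x = x" if "x \<in> {0..1}" for x using that by (auto simp: c_def)
  have cc: "continuous_on UNIV c" unfolding c_def by (intro continuous_intros)
  define N where "N n = distr (\<mu> n) borel (\<lambda>x. x)" for n
  have idm: "(\<lambda>x. x) \<in> borel_measurable (\<mu> n)" for n
    by (rule M1_01_measurable[OF m]) (rule continuous_on_id)
  have rd: "real_distribution (N n)" for n
    unfolding N_def by (rule prob_space.real_distribution_distr[OF M1_01_D(1)[OF m] idm])
  have intN: "(\<integral>x. f x \<partial>N n) = (\<integral>x. f x \<partial>\<mu> n)" if "f \<in> borel_measurable borel" for f :: "real \<Rightarrow> real" and n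
    unfolding N_def using that by (rule integral_distr[OF idm])
  have "tight N"
    unfolding tight_def
  proof (intro conjI allI impI rd)
    fix \<epsilon> :: real assume e: "\<epsilon> > 0"
    have "measure (N n) {-1<..2} = 1" for n
    proof -
      interpret prob_space "\<mu> n" by (rule M1_01_D[OF m])
      have "measure (N n) {-1<..2} = measure (\<mu> n) ((\<lambda>x. x) -` {-1<..2} \<inter> space (\<mu> n))"
        unfolding N_def by (rule measure_distr[OF idm]) simp
      also have "(\<lambda>x. x) -` {-1<..2} \<inter> space (\<mu> n) = space (\<mu> n)" unfolding M1_01_D(3)[OF m] by auto
      finally show ?thesis using prob_space by simp
    qed
    then show "\<exists>a b::real. a < b \<and> (\<forall>n. 1 - \<epsilon> < measure (N n) {a<..b})"
      using e by (intro exI[of _ "-1"] exI[of _ "2"]) simp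
  qed
  then obtain r Q where r: "strict_mono r" and Q: "real_distribution Q" and w: "weak_conv_m (N \<circ> id \<circ> r) Q"
    using tight_imp_convergent_subsubsequence[of N id] strict_mono_id by blast
  interpret Q: real_distribution Q by (rule Q)
  have conv: "(\<lambda>n. \<integral>x. f x \<partial>N (r n)) \<longlonglongrightarrow> (\<integral>x. f x \<partial>Q)"
    if "\<And>x. isCont f x" "\<And>x. norm (f x) \<le> B" for f :: "real \<Rightarrow> real" and B
    using weak_conv_imp_integral_bdd_continuous_conv[where \<mu>="N \<circ> id \<circ> r" and M=Q and f=f and B=B] rd Q w that
    by (simp add: comp_def)
  \<comment> \<open>Bounded, continuous and zero exactly on the unit interval: its integral vanishes
    along the sequence, hence in the limit, which confines \<open>Q\<close> to the interval.\<close>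
  define h where "h x = min 1 \<bar>x - c x\<bar>" for x :: real
  have hc: "continuous_on UNIV h" unfolding h_def by (intro continuous_intros cc)
  have hm[measurable]: "h \<in> borel_measurable borel" by (rule borel_measurable_continuous_onI[OF hc])
  have hb: "0 \<le> h x" "h x \<le> 1" for x by (auto simp: h_def)
  have "(\<integral>x. h x \<partial>N n) = 0" for n
  proof -
    have "(\<integral>x. h x \<partial>\<mu> n) = (\<integral>x. 0 \<partial>\<mu> n)"
      by (rule Bochner_Integration.integral_cong[OF refl]) (simp add: M1_01_D(3)[OF m] h_def cid)
    then show ?thesis using intN[OF hm] by simp
  qed
  then have "(\<lambda>n. 0) \<longlonglongrightarrow> (\<integral>x. h x \<partial>Q)"
    using conv[of h 1] hc hb by (simp add: continuous_on_eq_continuous_at)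
  then have h0: "(\<integral>x. h x \<partial>Q) = 0" using LIMSEQ_unique tendsto_const by blast
  have "integrable Q h" by (rule Q.integrable_const_bound[where B=1]) (use hb in auto)
  then have "AE x in Q. h x = 0" using integral_nonneg_eq_0_iff_AE[of Q h] h0 hb by auto
  then have ae: "AE x in Q. x \<in> {0..1}"
  proof (rule AE_mp, intro AE_I2 impI)
    fix x assume "h x = 0"
    then have "x = c x" by (auto simp: h_def min_def split: if_splits)
    then show "x \<in> {0..1}" using c01[of x] by simp
  qed
  have s01: "{0..1::real} \<in> sets Q" by simp
  have e1: "emeasure Q {0..1} = 1"
    using ae s01 by (subst Q.emeasure_eq_1_AE) auto
  define \<nu> where "\<nu> = restrict_space Q {0..1}"
  have \<nu>: "\<nu> \<in> M1_01"
    unfolding M1_01_def \<nu>_def using prob_space_restrict_space[OF s01 e1] Q.M_is_borel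
    by (simp add: sets_restrict_space)
  have "(\<lambda>n. \<integral>v. f v \<partial>\<mu> (r n)) \<longlonglongrightarrow> (\<integral>v. f v \<partial>\<nu>)" if f: "continuous_on {0..1} f" for f :: "real \<Rightarrow> real"
  proof -
    obtain B where B: "\<And>v. v \<in> {0..1} \<Longrightarrow> \<bar>f v\<bar> \<le> B" using continuous_on_unit_interval_bounded[OF f] by blast
    have fc: "continuous_on UNIV (\<lambda>x. f (c x))"
      by (rule continuous_on_compose2[OF f cc]) (use c01 in auto)
    have fm[measurable]: "(\<lambda>x. f (c x)) \<in> borel_measurable borel" by (rule borel_measurable_continuous_onI[OF fc])
    have "(\<lambda>n. \<integral>x. f (c x) \<partial>N (r n)) \<longlonglongrightarrow> (\<integral>x. f (c x) \<partial>Q)"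
      by (rule conv[of _ B]) (use fc B[OF c01] in \<open>auto simp: continuous_on_eq_continuous_at\<close>)
    moreover have "(\<integral>x. f (c x) \<partial>N (r n)) = (\<integral>v. f v \<partial>\<mu> (r n))" for n
      unfolding intN[OF fm] by (rule Bochner_Integration.integral_cong[OF refl]) (simp add: M1_01_D(3)[OF m] cid)
    moreover have "(\<integral>x. f (c x) \<partial>Q) = (\<integral>v. f v \<partial>\<nu>)"
    proof -
      have "(\<integral>v. f v \<partial>\<nu>) = (\<integral>v. f (c v) \<partial>\<nu>)"
        by (rule Bochner_Integration.integral_cong[OF refl]) (simp add: M1_01_D(3)[OF \<nu>] cid)
      also have "\<dots> = (\<integral>x. indicator {0..1} x *\<^sub>R f (c x) \<partial>Q)"
        unfolding \<nu>_def by (rule integral_restrict_space) simp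
      also have "\<dots> = (\<integral>x. f (c x) \<partial>Q)"
        using ae by (intro integral_cong_AE) auto
      finally show ?thesis by simp
    qed
    ultimately show ?thesis by simp
  qed
  then show ?thesis using that[OF r \<nu>] by blast
qed

text \<open>By Weierstrass approximation these countably many integrals control the integrals of all
  continuous functions. The target is a countable product of lines, where sequential compactness
  gives compactness.\<close>

definition bernstein_coords :: "real measure \<Rightarrow> nat \<times> nat \<Rightarrow> real" where
  "bernstein_coords \<mu> = (\<lambda>(n, k). \<integral>v. Bernstein n k v \<partial>\<mu>)"

lemma continuous_on_Bernstein: "continuous_on A (Bernstein n k)"
  unfolding Bernstein_def by (intro continuous_intros)

lemma weak_top_openin_coords:
  assumes "openin weak_top U"
  shows "\<exists>V. open V \<and> U = {\<mu>\<in>M1_01. bernstein_coords \<mu> \<in> V}"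
proof -
  let ?S = "{{\<mu>\<in>M1_01. integral\<^sup>L \<mu> f \<in> U} | (f :: real \<Rightarrow> real) (U :: real set). continuous_on {0..1} f \<and> open U}"
  have "generate_topology_on ?S U"
    using assms unfolding weak_top_def openin_topology_generated_by_iff .
  then show ?thesis
  proof induction
    case Empty
    show ?case by (rule exI[of _ "{}"]) simp
  next
    case (Int a b)
    then obtain V W where "open V" "a = {\<mu>\<in>M1_01. bernstein_coords \<mu> \<in> V}" "open W" "b = {\<mu>\<in>M1_01. bernstein_coords \<mu> \<in> W}"
      by blast
    then show ?case by (intro exI[of _ "V \<inter> W"]) auto
  next
    case (UN K)
    then obtain V where V: "\<And>k. k \<in> K \<Longrightarrow> open (V k) \<and> k = {\<mu>\<in>M1_01. bernstein_coords \<mu> \<in> V k}" by metis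
    have "\<Union>K = {\<mu>\<in>M1_01. bernstein_coords \<mu> \<in> (\<Union>k\<in>K. V k)}"
    proof (intro set_eqI iffI)
      fix \<mu> assume "\<mu> \<in> \<Union>K"
      then obtain k where "k \<in> K" "\<mu> \<in> k" by blast
      then show "\<mu> \<in> {\<mu>\<in>M1_01. bernstein_coords \<mu> \<in> (\<Union>k\<in>K. V k)}" using V[of k] by blast
    next
      fix \<mu> assume "\<mu> \<in> {\<mu>\<in>M1_01. bernstein_coords \<mu> \<in> (\<Union>k\<in>K. V k)}"
      then obtain k where "k \<in> K" "bernstein_coords \<mu> \<in> V k" "\<mu> \<in> M1_01" by blast
      then have "\<mu> \<in> k" using V[of k] by blast
      then show "\<mu> \<in> \<Union>K" using \<open>k \<in> K\<close> by blast
    qed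
    moreover have "open (\<Union>k\<in>K. V k)" using V by blast
    ultimately show ?case by blast
  next
    case (Basis s)
    then obtain f :: "real \<Rightarrow> real" and O' where s: "s = {\<mu>\<in>M1_01. integral\<^sup>L \<mu> f \<in> O'}" and f: "continuous_on {0..1} f" and O: "open O'" by blast
    \<comment> \<open>A Bernstein polynomial within e / 3 of f reduces the condition to finitely
      many coordinates: two approximation errors and the distance of the polynomial integrals, each
      at most e / 3 and the last one strictly below, stay under e.\<close>
    have ex: "\<exists>W. open W \<and> bernstein_coords \<mu> \<in> W \<and> {\<nu>\<in>M1_01. bernstein_coords \<nu> \<in> W} \<subseteq> s" if mu: "\<mu> \<in> s" for \<mu>
    proof -
      have m: "\<mu> \<in> M1_01" "integral\<^sup>L \<mu> f \<in> O'" using mu s by auto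
      then obtain e where e: "e > 0" "ball (integral\<^sup>L \<mu> f) e \<subseteq> O'" using O openE by blast
      obtain n where n: "\<forall>x\<in>{0..1}. \<bar>f x - (\<Sum>k\<le>n. f (k/n) * Bernstein n k x)\<bar> < e / 3"
      proof -
        have "0 < e / 3" using e by simp
        then obtain N where "\<forall>n x. N \<le> n \<and> x \<in> {0..1} \<longrightarrow> \<bar>f x - (\<Sum>k\<le>n. f (k/n) * Bernstein n k x)\<bar> < e / 3"
          using Bernstein_Weierstrass[OF f] by blast
        then show ?thesis using that[of N] by blast
      qed
      let ?p = "\<lambda>x. \<Sum>k\<le>n. f (k/n) * Bernstein n k x"
      define l where "l \<phi> = (\<Sum>k\<le>n. f (k/n) * \<phi> (n, k))" for \<phi> :: "nat \<times> nat \<Rightarrow> real"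
      have l: "continuous_on UNIV l" unfolding l_def by (intro continuous_intros continuous_on_product_coordinates)
      have app: "\<bar>integral\<^sup>L \<nu> f - l (bernstein_coords \<nu>)\<bar> \<le> e / 3" if nu: "\<nu> \<in> M1_01" for \<nu>
      proof -
        interpret prob_space \<nu> by (rule M1_01_D[OF nu])
        have iB: "integrable \<nu> (Bernstein n k)" for k by (rule M1_01_integrable[OF nu continuous_on_Bernstein])
        have iF: "integrable \<nu> f" by (rule M1_01_integrable[OF nu f])
        have lB: "l (bernstein_coords \<nu>) = (\<integral>x. ?p x \<partial>\<nu>)"
          unfolding l_def bernstein_coords_def using iB by simp
        have iS: "integrable \<nu> (\<lambda>x. ?p x)" using iB by simp
        have "\<bar>integral\<^sup>L \<nu> f - l (bernstein_coords \<nu>)\<bar> = \<bar>\<integral>x. f x - ?p x \<partial>\<nu>\<bar>"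
          unfolding lB using iF iS by simp
        also have "\<dots> \<le> (\<integral>x. \<bar>f x - ?p x\<bar> \<partial>\<nu>)" by (rule integral_abs_bound)
        also have "\<dots> \<le> (\<integral>x. e / 3 \<partial>\<nu>)"
        proof (rule integral_mono)
          show "integrable \<nu> (\<lambda>x. \<bar>f x - ?p x\<bar>)" using iF iS by simp
          fix x assume "x \<in> space \<nu>"
          then have "x \<in> {0..1}" using M1_01_D(3)[OF nu] by simp
          then have "\<bar>f x - ?p x\<bar> < e / 3" using n by blast
          then show "\<bar>f x - ?p x\<bar> \<le> e / 3" by (rule less_imp_le)
        qed simp
        also have "\<dots> = e / 3" using prob_space by simp
        finally show ?thesis .
      qed
      let ?W = "l -` ball (l (bernstein_coords \<mu>)) (e / 3)"
      have "open ?W" using l by (simp add: continuous_on_open_vimage)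
      moreover have "bernstein_coords \<mu> \<in> ?W" using e by simp
      moreover have "{\<nu>\<in>M1_01. bernstein_coords \<nu> \<in> ?W} \<subseteq> s"
      proof
        fix \<nu> assume "\<nu> \<in> {\<nu>\<in>M1_01. bernstein_coords \<nu> \<in> ?W}"
        then have nu: "\<nu> \<in> M1_01" and d: "\<bar>l (bernstein_coords \<mu>) - l (bernstein_coords \<nu>)\<bar> < e / 3"
          by (auto simp: dist_real_def)
        have "\<bar>integral\<^sup>L \<mu> f - integral\<^sup>L \<nu> f\<bar> < e" using app[OF nu] app[OF m(1)] d by linarith
        then have "integral\<^sup>L \<nu> f \<in> O'" using e(2) by (auto simp: dist_real_def)
        then show "\<nu> \<in> s" using s nu by blast
      qed
      ultimately show ?thesis by blast
    qed
    \<comment> \<open>The largest open set of coordinates whose preimage lies in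
      \<open>s\<close>.\<close>
    let ?V = "\<Union>{W. open W \<and> {\<nu>\<in>M1_01. bernstein_coords \<nu> \<in> W} \<subseteq> s}"
    have "open ?V" by blast
    moreover have "s = {\<mu>\<in>M1_01. bernstein_coords \<mu> \<in> ?V}"
    proof (intro set_eqI iffI)
      fix \<mu> assume mu: "\<mu> \<in> s"
      then have "\<mu> \<in> M1_01" using s by blast
      then show "\<mu> \<in> {\<mu>\<in>M1_01. bernstein_coords \<mu> \<in> ?V}" using ex[OF mu] by blast
    qed blast
    ultimately show ?case by blast
  qed
qed

text \<open>Convergence in the product is coordinatewise, so the subsequence supplied by Helly's
  theorem converges here.\<close>

lemma compact_bernstein_coords: "compact (bernstein_coords ` M1_01)"
  unfolding compact_eq_seq_compact_metric
proof (rule seq_compactI)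
  fix \<phi> :: "nat \<Rightarrow> nat \<times> nat \<Rightarrow> real" assume "\<forall>n. \<phi> n \<in> bernstein_coords ` M1_01"
  then have "\<forall>n. \<exists>\<mu>. \<mu> \<in> M1_01 \<and> \<phi> n = bernstein_coords \<mu>" by blast
  then obtain \<mu> where mu: "\<And>n. \<mu> n \<in> M1_01" "\<And>n. \<phi> n = bernstein_coords (\<mu> n)" by metis
  obtain r \<nu> where r: "strict_mono (r :: nat \<Rightarrow> nat)" and nu: "\<nu> \<in> M1_01"
    and lim: "\<And>f :: real \<Rightarrow> real. continuous_on {0..1} f \<Longrightarrow> (\<lambda>n. \<integral>v. f v \<partial>\<mu> (r n)) \<longlonglongrightarrow> (\<integral>v. f v \<partial>\<nu>)"
    using M1_01_sequentially_compact[of \<mu>, OF mu(1)] by metis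
  have "(\<lambda>n. \<phi> (r n) i) \<longlonglongrightarrow> bernstein_coords \<nu> i" for i
    unfolding mu(2) bernstein_coords_def by (cases i) (simp add: lim[OF continuous_on_Bernstein])
  then have "limitin (product_topology (\<lambda>_. euclidean) UNIV) (\<lambda>n. \<phi> (r n)) (bernstein_coords \<nu>) sequentially"
    unfolding limitin_componentwise by simp
  then have "(\<phi> \<circ> r) \<longlonglongrightarrow> bernstein_coords \<nu>"
    unfolding euclidean_product_topology comp_def by simp
  then show "\<exists>l\<in>bernstein_coords ` M1_01. \<exists>r::nat \<Rightarrow> nat. strict_mono r \<and> (\<phi> \<circ> r) \<longlonglongrightarrow> l"
    using r nu by blast
qed

lemma topspace_weak_top: "topspace weak_top = M1_01"
proof -
  \<comment> \<open>A vacuous condition exhibits the whole set as a member of the subbase.\<close>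
  have "M1_01 = {\<mu>\<in>M1_01. integral\<^sup>L \<mu> (\<lambda>_. 0::real) \<in> (UNIV :: real set)}" by simp
  then have "M1_01 \<in> {{\<mu>\<in>M1_01. integral\<^sup>L \<mu> f \<in> U} | (f :: real \<Rightarrow> real) (U :: real set). continuous_on {0..1} f \<and> open U}"
    using continuous_on_const[of "{0..1::real}" "0::real"] open_UNIV by blast
  then show ?thesis unfolding weak_top_def topology_generated_by_topspace by blast
qed

text \<open>A weakly open cover becomes an open cover of the compact coordinate image, and a finite
  subcover pulls back.\<close>

lemma compactin_weak_top_M1_01: "compact_space weak_top"
  unfolding compact_space_def compactin_def topspace_weak_top
proof (intro conjI allI impI order_refl)
  fix \<U> assume U: "Ball \<U> (openin weak_top) \<and> M1_01 \<subseteq> \<Union>\<U>"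
  then have "\<forall>S\<in>\<U>. \<exists>V. open V \<and> S = {\<mu>\<in>M1_01. bernstein_coords \<mu> \<in> V}" using weak_top_openin_coords by blast
  then obtain V where V: "\<And>S. S \<in> \<U> \<Longrightarrow> open (V S) \<and> S = {\<mu>\<in>M1_01. bernstein_coords \<mu> \<in> V S}" by metis
  have "bernstein_coords ` M1_01 \<subseteq> (\<Union>S\<in>\<U>. V S)"
  proof
    fix \<phi> assume "\<phi> \<in> bernstein_coords ` M1_01"
    then obtain \<mu> where mu: "\<mu> \<in> M1_01" "\<phi> = bernstein_coords \<mu>" by blast
    then obtain S where S: "S \<in> \<U>" "\<mu> \<in> S" using U by blast
    then show "\<phi> \<in> (\<Union>S\<in>\<U>. V S)" using V[OF S(1)] mu by blast
  qed
  then obtain \<F> where F: "\<F> \<subseteq> \<U>" "finite \<F>" "bernstein_coords ` M1_01 \<subseteq> (\<Union>S\<in>\<F>. V S)"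
    using compactE_image[OF compact_bernstein_coords, of \<U> V] V by metis
  have "M1_01 \<subseteq> \<Union>\<F>"
  proof
    fix \<mu> assume mu: "\<mu> \<in> M1_01"
    then obtain S where S: "S \<in> \<F>" "bernstein_coords \<mu> \<in> V S" using F(3) by blast
    then have "\<mu> \<in> S" using V[of S] F(1) mu by blast
    then show "\<mu> \<in> \<Union>\<F>" using S by blast
  qed
  then show "\<exists>\<F>. finite \<F> \<and> \<F> \<subseteq> \<U> \<and> M1_01 \<subseteq> \<Union>\<F>" using F by blast
qed

lemma closedin_weak_top_le:
  fixes f :: "real \<Rightarrow> real"
  assumes "continuous_on {0..1} f"
  shows "closedin weak_top {\<mu>\<in>M1_01. integral\<^sup>L \<mu> f \<le> c}"
  unfolding closedin_def topspace_weak_top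
proof
  have "M1_01 - {\<mu>\<in>M1_01. integral\<^sup>L \<mu> f \<le> c} = {\<mu>\<in>M1_01. integral\<^sup>L \<mu> f \<in> {c<..}}" by auto
  moreover have "openin weak_top {\<mu>\<in>M1_01. integral\<^sup>L \<mu> f \<in> {c<..}}"
    unfolding weak_top_def by (rule topology_generated_by_Basis) (use assms open_greaterThan in blast)
  ultimately show "openin weak_top (M1_01 - {\<mu>\<in>M1_01. integral\<^sup>L \<mu> f \<le> c})" by simp
qed blast

section \<open>The variational problem\<close>

locale gauss_path =
  fixes M :: "'a measure" and X :: "'d::euclidean_space \<Rightarrow> 'a \<Rightarrow> real" and T :: "'d set" and \<xi> :: "real \<Rightarrow> 'd"
  assumes gf: "centered_gaussian_field M X T"
    and paths: "\<forall>\<omega>\<in>space M. continuous_on T (\<lambda>t. X t \<omega>)"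
    and cont_xi: "continuous_on {0..1} \<xi>" and xi_T: "\<xi> ` {0..1} \<subseteq> T"

sublocale gauss_path \<subseteq> gauss_linear M "gauss_space M X T"
  by (rule gauss_space_gauss_linear[OF gf])

context gauss_path
begin

abbreviation "\<G> \<equiv> gauss_space M X T"
abbreviation "\<Q> \<equiv> quad_form M X \<xi>"
abbreviation "\<W> \<equiv> W_set M X \<xi>"
abbreviation "\<C> \<equiv> CX M X T \<xi>"
abbreviation "\<Psi> \<equiv> Psi M X \<xi>"
abbreviation "\<w> \<equiv> wH M X"
abbreviation "feasible \<equiv> feasible2 M X T \<xi>"
abbreviation "exceed u \<equiv> {\<omega>\<in>space M. \<forall>v\<in>{0..1}. X (\<xi> v) \<omega> > u}"
abbreviation "deviate H \<epsilon> u \<equiv> {\<omega>\<in>space M. (SUP v\<in>{0..1}. \<bar>X (\<xi> v) \<omega> / u - \<w> H (\<xi> v)\<bar>) \<ge> \<epsilon> \<and> (\<forall>v\<in>{0..1}. X (\<xi> v) \<omega> > u)}"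

lemma X_lin_combs:
  assumes "v \<in> {0..1}"
  shows "X (\<xi> v) \<in> lin_combs X T"
proof -
  have "\<xi> v \<in> T" using assms xi_T by blast
  then show ?thesis using lin_combs_sum[of 1 "\<lambda>_. \<xi> v" T "\<lambda>_. 1" X] by simp
qed

lemma X_gauss: "v \<in> {0..1} \<Longrightarrow> X (\<xi> v) \<in> \<G>"
  by (rule lin_combs_gauss_space[OF gf X_lin_combs])

lemma X_path_continuous: "\<omega> \<in> space M \<Longrightarrow> continuous_on {0..1} (\<lambda>v. X (\<xi> v) \<omega>)"
  using paths by (intro continuous_on_compose2[OF _ cont_xi xi_T]) auto

text \<open>Sample continuity is pointwise convergence along sequences, which among Gaussian
  variables upgrades to mean square convergence.\<close>

lemma wH_continuous:
  assumes H: "sq_integrable M H"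
  shows "continuous_on {0..1} (\<lambda>v. \<w> H (\<xi> v))"
  unfolding continuous_on_sequentially comp_def
proof (intro allI ballI impI)
  fix s :: "nat \<Rightarrow> real" and a assume a: "a \<in> {0..1}" and s: "(\<forall>n. s n \<in> {0..1}) \<and> s \<longlonglongrightarrow> a"
  then have s1: "s n \<in> {0..1}" for n by blast
  have "(\<lambda>n. \<integral>\<omega>. (X (\<xi> (s n)) \<omega> - X (\<xi> a) \<omega>)\<^sup>2 \<partial>M) \<longlonglongrightarrow> 0"
  proof (rule L_pointwise_limit(2)[where Y="\<lambda>n. X (\<xi> (s n))" and Z="X (\<xi> a)"])
    show "X (\<xi> (s n)) \<in> \<G>" for n by (rule X_gauss[OF s1])
    fix \<omega> assume w: "\<omega> \<in> space M"
    show "(\<lambda>n. X (\<xi> (s n)) \<omega>) \<longlonglongrightarrow> X (\<xi> a) \<omega>"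
      by (rule continuous_on_tendsto_compose[OF X_path_continuous[OF w] _ a]) (use s in auto)
  qed
  then show "(\<lambda>n. \<w> H (\<xi> (s n))) \<longlonglongrightarrow> \<w> H (\<xi> a)"
    unfolding wH_def by (rule tendsto_integral_mult_L2[OF L_sq[OF X_gauss[OF s1]] L_sq[OF X_gauss[OF a]] H])
qed

section \<open>Averages of the path and the quadratic form\<close>

definition Zmu :: "real measure \<Rightarrow> 'a \<Rightarrow> real" where
  "Zmu \<mu> \<omega> = (\<integral>v. X (\<xi> v) \<omega> \<partial>\<mu>)"

lemma Zmu_approx:
  assumes m: "\<mu> \<in> M1_01"
  shows "(\<lambda>\<omega>. riemann \<mu> (\<lambda>v. X (\<xi> v) \<omega>) n) \<in> lin_combs X T"
    and "\<omega> \<in> space M \<Longrightarrow> (\<lambda>n. riemann \<mu> (\<lambda>v. X (\<xi> v) \<omega>) n) \<longlonglongrightarrow> Zmu \<mu> \<omega>"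
proof -
  show "(\<lambda>\<omega>. riemann \<mu> (\<lambda>v. X (\<xi> v) \<omega>) n) \<in> lin_combs X T"
    unfolding riemann_def
  proof (rule lin_combs_sum)
    fix j assume "j < Suc (Suc n)"
    then have "real j / real (Suc n) \<in> {0..1}" by simp
    then show "\<xi> (real j / real (Suc n)) \<in> T" using xi_T by blast
  qed
  show "\<omega> \<in> space M \<Longrightarrow> (\<lambda>n. riemann \<mu> (\<lambda>v. X (\<xi> v) \<omega>) n) \<longlonglongrightarrow> Zmu \<mu> \<omega>"
    unfolding Zmu_def by (rule riemann_tendsto[OF m X_path_continuous])
qed

lemma Zmu_L2:
  assumes m: "\<mu> \<in> M1_01"
  shows "sq_integrable M (Zmu \<mu>)" "(\<lambda>n. \<integral>\<omega>. (riemann \<mu> (\<lambda>v. X (\<xi> v) \<omega>) n - Zmu \<mu> \<omega>)\<^sup>2 \<partial>M) \<longlonglongrightarrow> 0"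
  using L_pointwise_limit[of "\<lambda>n \<omega>. riemann \<mu> (\<lambda>v. X (\<xi> v) \<omega>) n" "Zmu \<mu>"]
    lin_combs_gauss_space[OF gf Zmu_approx(1)[OF m]] Zmu_approx(2)[OF m] by blast+

lemma Zmu_gauss:
  assumes m: "\<mu> \<in> M1_01"
  shows "Zmu \<mu> \<in> \<G>"
  unfolding gauss_space_iff[OF gf]
  by (intro conjI exI[of _ "\<lambda>n \<omega>. riemann \<mu> (\<lambda>v. X (\<xi> v) \<omega>) n"] allI Zmu_L2[OF m] Zmu_approx(1)[OF m])

text \<open>Expectation and integral are interchanged on Riemann sums. These converge in mean square
  on one side, and on the other because the pairing is continuous along the path.\<close>

lemma Zmu_inner:
  assumes m: "\<mu> \<in> M1_01" and H: "sq_integrable M H"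
  shows "(\<integral>\<omega>. Zmu \<mu> \<omega> * H \<omega> \<partial>M) = (\<integral>v. \<w> H (\<xi> v) \<partial>\<mu>)"
proof (rule LIMSEQ_unique)
  have sqn: "sq_integrable M (\<lambda>\<omega>. riemann \<mu> (\<lambda>v. X (\<xi> v) \<omega>) n)" for n
    by (rule lin_combs_sq[OF gf Zmu_approx(1)[OF m]])
  show "(\<lambda>n. \<integral>\<omega>. riemann \<mu> (\<lambda>v. X (\<xi> v) \<omega>) n * H \<omega> \<partial>M) \<longlonglongrightarrow> (\<integral>\<omega>. Zmu \<mu> \<omega> * H \<omega> \<partial>M)"
    by (rule tendsto_integral_mult_L2[OF sqn Zmu_L2(1)[OF m] H Zmu_L2(2)[OF m]])
  have "(\<integral>\<omega>. riemann \<mu> (\<lambda>v. X (\<xi> v) \<omega>) n * H \<omega> \<partial>M) = riemann \<mu> (\<lambda>v. \<w> H (\<xi> v)) n" for n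
  proof -
    have i: "integrable M (\<lambda>\<omega>. X (\<xi> (real k / real (Suc n))) \<omega> * H \<omega>)" if "k < Suc (Suc n)" for k
      using that by (intro sq_integrable_mult[OF L_sq[OF X_gauss] H]) simp
    have "(\<integral>\<omega>. riemann \<mu> (\<lambda>v. X (\<xi> v) \<omega>) n * H \<omega> \<partial>M)
      = (\<integral>\<omega>. (\<Sum>k<Suc (Suc n). measure \<mu> (cell n k) * (X (\<xi> (real k / real (Suc n))) \<omega> * H \<omega>)) \<partial>M)"
      unfolding riemann_def sum_distrib_right mult.assoc ..
    also have "\<dots> = (\<Sum>k<Suc (Suc n). (\<integral>\<omega>. measure \<mu> (cell n k) * (X (\<xi> (real k / real (Suc n))) \<omega> * H \<omega>) \<partial>M))"
      by (rule Bochner_Integration.integral_sum) (rule integrable_mult_right, rule i, simp)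
    also have "\<dots> = riemann \<mu> (\<lambda>v. \<w> H (\<xi> v)) n"
      unfolding riemann_def wH_def by (simp only: integral_mult_right_zero)
    finally show ?thesis .
  qed
  then show "(\<lambda>n. \<integral>\<omega>. riemann \<mu> (\<lambda>v. X (\<xi> v) \<omega>) n * H \<omega> \<partial>M) \<longlonglongrightarrow> (\<integral>v. \<w> H (\<xi> v) \<partial>\<mu>)"
    using riemann_tendsto[OF m wH_continuous[OF H]] by (simp only:)
qed

text \<open>\<open>Zmu_inner\<close> is used twice: with a field value in the role of
  \<open>H\<close> for the inner integral, then with \<open>Zmu \<mu>\<close> itself for the outer
  one.\<close>

lemma quad_form_eq:
  assumes m: "\<mu> \<in> M1_01"
  shows "\<Q> \<mu> = (msq (Zmu \<mu>))"
proof -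
  have "(\<integral>v. covar M X (\<xi> u) (\<xi> v) \<partial>\<mu>) = \<w> (Zmu \<mu>) (\<xi> u)" if u: "u \<in> {0..1}" for u
  proof -
    have "\<w> (Zmu \<mu>) (\<xi> u) = (\<integral>\<omega>. Zmu \<mu> \<omega> * X (\<xi> u) \<omega> \<partial>M)" unfolding wH_def by (simp only: mult.commute)
    also have "\<dots> = (\<integral>v. \<w> (X (\<xi> u)) (\<xi> v) \<partial>\<mu>)" by (rule Zmu_inner[OF m L_sq[OF X_gauss[OF u]]])
    also have "\<dots> = (\<integral>v. covar M X (\<xi> u) (\<xi> v) \<partial>\<mu>)" unfolding wH_def covar_def by (simp only: mult.commute)
    finally show ?thesis by simp
  qed
  then have "\<Q> \<mu> = (\<integral>u. \<w> (Zmu \<mu>) (\<xi> u) \<partial>\<mu>)"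
    unfolding quad_form_def by (intro Bochner_Integration.integral_cong refl) (simp add: M1_01_D(3)[OF m])
  also have "\<dots> = (\<integral>\<omega>. Zmu \<mu> \<omega> * Zmu \<mu> \<omega> \<partial>M)" by (rule Zmu_inner[OF m Zmu_L2(1)[OF m], symmetric])
  finally show ?thesis by (simp add: power2_eq_square)
qed

lemma quad_form_nonneg: "\<mu> \<in> M1_01 \<Longrightarrow> 0 \<le> \<Q> \<mu>"
  by (simp add: quad_form_eq)

text \<open>The quadratic form is a supremum of weakly continuous affine functionals; this yields lower
  semicontinuity and convexity at once.\<close>

lemma quad_form_le_iff:
  assumes m: "\<mu> \<in> M1_01"
  shows "\<Q> \<mu> \<le> c \<longleftrightarrow>
    (\<forall>H\<in>\<G>. (\<integral>v. \<w> H (\<xi> v) \<partial>\<mu>) \<le> (c + (msq H)) / 2)"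
proof
  assume le: "\<Q> \<mu> \<le> c"
  show "\<forall>H\<in>\<G>. (\<integral>v. \<w> H (\<xi> v) \<partial>\<mu>) \<le> (c + (msq H)) / 2"
  proof
    fix H assume H: "H \<in> \<G>"
    \<comment> \<open>Expanding E (Z - H)^2 \<ge> 0 gives E Z H \<le> (E Z^2 + E H^2) / 2.\<close>
    have "0 \<le> (\<integral>\<omega>. (1 * Zmu \<mu> \<omega> + (-1) * H \<omega>)\<^sup>2 \<partial>M)" by (rule integral_nonneg_AE) simp
    then show "(\<integral>v. \<w> H (\<xi> v) \<partial>\<mu>) \<le> (c + (msq H)) / 2"
      unfolding integral_square_lin[OF Zmu_L2(1)[OF m] L_sq[OF H]] Zmu_inner[OF m L_sq[OF H]]
      using le unfolding quad_form_eq[OF m] by simp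
  qed
next
  assume "\<forall>H\<in>\<G>. (\<integral>v. \<w> H (\<xi> v) \<partial>\<mu>) \<le> (c + (msq H)) / 2"
  \<comment> \<open>The affine bound is sharp at H = Z, so this single instance recovers the
    quadratic form.\<close>
  then have "(\<integral>v. \<w> (Zmu \<mu>) (\<xi> v) \<partial>\<mu>) \<le> (c + (msq (Zmu \<mu>))) / 2"
    using Zmu_gauss[OF m] by blast
  then show "\<Q> \<mu> \<le> c"
    unfolding Zmu_inner[OF m Zmu_L2(1)[OF m], symmetric] quad_form_eq[OF m] by (simp add: power2_eq_square)
qed

lemma closedin_quad_form_le: "closedin weak_top {\<mu>\<in>M1_01. \<Q> \<mu> \<le> c}"
proof -
  have "{\<mu>\<in>M1_01. \<Q> \<mu> \<le> c}
    = (\<Inter>H\<in>\<G>. {\<mu>\<in>M1_01. integral\<^sup>L \<mu> (\<lambda>v. \<w> H (\<xi> v)) \<le> (c + (msq H)) / 2})"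
    using quad_form_le_iff L_zero by blast
  moreover have "closedin weak_top (\<Inter>H\<in>\<G>. {\<mu>\<in>M1_01. integral\<^sup>L \<mu> (\<lambda>v. \<w> H (\<xi> v)) \<le> (c + (msq H)) / 2})"
    using L_zero by (intro closedin_INT closedin_weak_top_le wH_continuous L_sq) auto
  ultimately show ?thesis by simp
qed

text \<open>Sublevel sets just above the infimum are nonempty, nested and weakly closed; by
  compactness they share a point, and that point is a minimiser.\<close>

lemma W_set_nonempty: "\<W> \<noteq> {}"
proof -
  define m where "m = Inf (\<Q> ` M1_01)"
  have bdd: "bdd_below (\<Q> ` M1_01)" using quad_form_nonneg by (auto intro!: bdd_belowI[of _ 0])
  have ne: "M1_01 \<noteq> {}" using return_M1_01(1)[of 0] by auto
  define C where "C n = {\<mu>\<in>M1_01. \<Q> \<mu> \<le> m + inverse (real (Suc n))}" for n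
  have "(\<Inter>n. C n) \<noteq> {}"
  proof (rule compact_space_imp_nest[OF compactin_weak_top_M1_01])
    show "closedin weak_top (C n)" for n unfolding C_def by (rule closedin_quad_form_le)
    show "C n \<noteq> {}" for n
    proof -
      have "m < m + inverse (real (Suc n))" by simp
      then have "\<exists>q\<in>\<Q> ` M1_01. q < m + inverse (real (Suc n))"
        unfolding m_def by (intro cInf_lessD) (use ne in simp)
      then obtain \<mu> where "\<mu> \<in> M1_01" "\<Q> \<mu> < m + inverse (real (Suc n))" by blast
      then have "\<mu> \<in> C n" unfolding C_def by (simp only: mem_Collect_eq less_imp_le simp_thms)
      then show ?thesis by blast
    qed
    show "decseq C"
    proof (rule decseq_SucI)
      show "C (Suc n) \<subseteq> C n" for n
      proof -
        have "inverse (real (Suc (Suc n))) \<le> inverse (real (Suc n))" by simp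
        then have "m + inverse (real (Suc (Suc n))) \<le> m + inverse (real (Suc n))" by (rule add_left_mono)
        then show ?thesis unfolding C_def using order_trans by blast
      qed
    qed
  qed
  then obtain \<mu> where mu: "\<And>n. \<mu> \<in> C n" by blast
  then have m1: "\<mu> \<in> M1_01" by (auto simp: C_def)
  have "\<Q> \<mu> \<le> m + inverse (real (Suc n))" for n using mu[of n] by (simp add: C_def)
  moreover have "(\<lambda>n. m + inverse (real (Suc n))) \<longlonglongrightarrow> m + 0" by (intro tendsto_intros LIMSEQ_inverse_real_of_nat)
  ultimately have "\<Q> \<mu> \<le> m" using LIMSEQ_le_const[of _ "m + 0"] by auto
  moreover have "m \<le> \<Q> \<nu>" if "\<nu> \<in> M1_01" for \<nu>
    unfolding m_def using that bdd by (intro cInf_lower) auto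
  ultimately have "\<mu> \<in> \<W>" unfolding W_set_def using m1 order_trans by blast
  then show ?thesis by blast
qed

text \<open>As a sublevel set, \<W> takes compactness from \<open>closedin_quad_form_le\<close> and
  convexity from \<open>quad_form_le_iff\<close>.\<close>

lemma W_set_level: "\<mu> \<in> \<W> \<Longrightarrow> \<W> = {\<nu>\<in>M1_01. \<Q> \<nu> \<le> \<Q> \<mu>}"
  unfolding W_set_def using order_trans by blast

lemma W_set_compact: "compactin weak_top (\<W>)"
proof -
  obtain \<mu> where mu: "\<mu> \<in> \<W>" using W_set_nonempty by blast
  show ?thesis unfolding W_set_level[OF mu]
    by (rule closedin_compact_space[OF compactin_weak_top_M1_01 closedin_quad_form_le])
qed

lemma W_set_convex: "measure_convex (\<W>)"
  unfolding measure_convex_def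
proof (intro ballI)
  fix \<mu> \<nu> and p :: real assume mu: "\<mu> \<in> \<W>" and nu: "\<nu> \<in> \<W>" and p: "p \<in> {0..1}"
  define c where "c = \<Q> \<mu>"
  have m: "\<mu> \<in> M1_01" and n: "\<nu> \<in> M1_01" using mu nu by (auto simp: W_set_def)
  have qm: "\<Q> \<mu> \<le> c" and qn: "\<Q> \<nu> \<le> c"
    using nu m by (auto simp: c_def W_set_def)
  note mix = mix_measure_M1_01(1)[OF m n p]
  have "\<Q> (mix_measure p \<mu> \<nu>) \<le> c"
    unfolding quad_form_le_iff[OF mix]
  proof
    fix H assume H: "H \<in> \<G>"
    have "(\<integral>v. \<w> H (\<xi> v) \<partial>\<mu>) \<le> (c + (msq H)) / 2" "(\<integral>v. \<w> H (\<xi> v) \<partial>\<nu>) \<le> (c + (msq H)) / 2"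
      using qm[unfolded quad_form_le_iff[OF m]] qn[unfolded quad_form_le_iff[OF n]] H by blast+
    then show "(\<integral>v. \<w> H (\<xi> v) \<partial>mix_measure p \<mu> \<nu>) \<le> (c + (msq H)) / 2"
      unfolding mix_measure_integral[OF m n p wH_continuous[OF L_sq[OF H]]]
      using p by (intro convex_bound_le) auto
  qed
  then show "mix_measure p \<mu> \<nu> \<in> \<W>" unfolding W_set_level[OF mu] c_def using mix by blast
qed

lemma first_order_condition:
  assumes mu: "\<mu> \<in> \<W>" and v: "v \<in> {0..1}"
  shows "\<Q> \<mu> \<le> \<w> (Zmu \<mu>) (\<xi> v)"
proof (rule ccontr)
  assume neg: "\<not> ?thesis"
  define q w R where "q = \<Q> \<mu>" and "w = \<w> (Zmu \<mu>) (\<xi> v)" and "R = (\<integral>\<omega>. (X (\<xi> v) \<omega>)\<^sup>2 \<partial>M)"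
  have d: "q - w > 0" using neg by (simp add: q_def w_def)
  have m: "\<mu> \<in> M1_01" using mu by (simp add: W_set_def)
  let ?\<delta> = "return (restrict_space borel {0..1}) v :: real measure"
  note del = return_M1_01(1)[OF v]
  have key: "q \<le> t\<^sup>2 * R + 2 * t * (1 - t) * w + (1 - t)\<^sup>2 * q" if t: "t \<in> {0..1}" for t
  proof -
    note mix = mix_measure_M1_01(1)[OF del m t]
    have "q \<le> \<Q> (mix_measure t ?\<delta> \<mu>)" using mu mix by (simp add: W_set_def q_def)
    also have "\<dots> = (\<integral>\<omega>. (t * X (\<xi> v) \<omega> + (1 - t) * Zmu \<mu> \<omega>)\<^sup>2 \<partial>M)"
      unfolding quad_form_eq[OF mix]
    proof (rule Bochner_Integration.integral_cong[OF refl])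
      fix \<omega> assume w: "\<omega> \<in> space M"
      show "(Zmu (mix_measure t ?\<delta> \<mu>) \<omega>)\<^sup>2 = (t * X (\<xi> v) \<omega> + (1 - t) * Zmu \<mu> \<omega>)\<^sup>2"
        unfolding Zmu_def mix_measure_integral[OF del m t X_path_continuous[OF w]]
          return_M1_01(2)[OF v X_path_continuous[OF w]] ..
    qed
    also have "\<dots> = t\<^sup>2 * R + 2 * t * (1 - t) * w + (1 - t)\<^sup>2 * q"
      unfolding integral_square_lin[OF L_sq[OF X_gauss[OF v]] Zmu_L2(1)[OF m]]
      by (simp add: R_def w_def wH_def q_def quad_form_eq[OF m])
    finally show ?thesis .
  qed
  \<comment> \<open>With D the second-order coefficient, minimality reads 0 \<le> t (t D - 2 (q -
    w)). The choice of t keeps t D \<le> q - w, so that q - w > 0 becomes impossible.\<close>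
  define D where "D = R - 2 * w + q"
  define t where "t = min 1 ((q - w) / (\<bar>D\<bar> + 1))"
  have t: "0 < t" "t \<le> 1" using d by (auto simp: t_def)
  have "t * D \<le> t * (\<bar>D\<bar> + 1)" using t by (intro mult_left_mono) auto
  also have "\<dots> \<le> (q - w) / (\<bar>D\<bar> + 1) * (\<bar>D\<bar> + 1)" by (intro mult_right_mono) (auto simp: t_def)
  also have "\<dots> = q - w" by simp
  finally have ub: "t * D \<le> q - w" .
  have "0 \<le> t * (t * D - 2 * (q - w))"
    using key[of t] t by (simp add: D_def power2_eq_square algebra_simps)
  then have "2 * (q - w) \<le> t * D" using t by (simp add: zero_le_mult_iff)
  from order_trans[OF this ub] show False using d by simp
qed

text \<open>Integrating the constraint against \<mu> gives E Z H \<ge> 1, and Cauchy-Schwarz does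
  the rest. The product form also covers \<open>\<Q> \<mu> = 0\<close>, where it rules out feasible
  \<open>H\<close> altogether.\<close>

lemma feasible_lower_bound:
  assumes m: "\<mu> \<in> M1_01" and H: "feasible H"
  shows "1 \<le> \<Q> \<mu> * (msq H)"
proof -
  interpret mu: prob_space \<mu> by (rule M1_01_D[OF m])
  have Hg: "H \<in> \<G>" and w: "\<And>v. v \<in> {0..1} \<Longrightarrow> 1 \<le> \<w> H (\<xi> v)"
    using H by (auto simp: feasible2_def)
  have "(\<integral>v. 1 \<partial>\<mu>) \<le> (\<integral>v. \<w> H (\<xi> v) \<partial>\<mu>)"
    by (rule integral_mono) (use M1_01_integrable[OF m wH_continuous[OF L_sq[OF Hg]]] w M1_01_D(3)[OF m] in auto)
  then have "1 \<le> (\<integral>\<omega>. Zmu \<mu> \<omega> * H \<omega> \<partial>M)" unfolding Zmu_inner[OF m L_sq[OF Hg]] using mu.prob_space by simp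
  then have "1 \<le> (\<integral>\<omega>. Zmu \<mu> \<omega> * H \<omega> \<partial>M)\<^sup>2" by (simp add: one_le_power)
  also have "\<dots> \<le> \<Q> \<mu> * (msq H)"
    unfolding quad_form_eq[OF m] by (rule integral_Cauchy_Schwarz[OF Zmu_L2(1)[OF m] L_sq[OF Hg]])
  finally show ?thesis .
qed

section \<open>The optimum, its uniqueness and the support of minimising measures\<close>

definition Hopt :: "real measure \<Rightarrow> 'a \<Rightarrow> real" where
  "Hopt \<mu> \<omega> = (1 / \<Q> \<mu>) * Zmu \<mu> \<omega>"

lemma Hopt_eq: "Hopt \<mu> = (\<lambda>\<omega>. (1 / \<Q> \<mu>) * Zmu \<mu> \<omega>)"
  by (rule ext) (rule Hopt_def)

lemma wH_scale: "\<w> (\<lambda>\<omega>. c * H \<omega>) t = c * \<w> H t"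
  unfolding wH_def by (subst mult.left_commute) (rule integral_mult_right_zero)

lemma Hopt_props:
  assumes mu: "\<mu> \<in> \<W>" and q: "\<Q> \<mu> > 0"
  shows "feasible (Hopt \<mu>)" "(msq (Hopt \<mu>)) = 1 / \<Q> \<mu>"
proof -
  have m: "\<mu> \<in> M1_01" using mu by (simp add: W_set_def)
  have "Hopt \<mu> \<in> \<G>" unfolding Hopt_eq by (rule L_scale[OF Zmu_gauss[OF m]])
  moreover have "1 \<le> \<w> (Hopt \<mu>) (\<xi> v)" if v: "v \<in> {0..1}" for v
  proof -
    have "\<w> (Hopt \<mu>) (\<xi> v) = (1 / \<Q> \<mu>) * \<w> (Zmu \<mu>) (\<xi> v)"
      unfolding Hopt_eq by (rule wH_scale)
    then show ?thesis using first_order_condition[OF mu v] q by simp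
  qed
  ultimately show "feasible (Hopt \<mu>)" by (simp add: feasible2_def)
  have "(msq (Hopt \<mu>)) = (1 / \<Q> \<mu>)\<^sup>2 * (msq (Zmu \<mu>))"
    unfolding Hopt_def power_mult_distrib by (rule integral_mult_right_zero)
  then show "(msq (Hopt \<mu>)) = 1 / \<Q> \<mu>"
    using q by (simp add: quad_form_eq[OF m] power2_eq_square)
qed

lemma feasible_iff:
  assumes mu: "\<mu> \<in> \<W>"
  shows "(\<exists>H. feasible H) \<longleftrightarrow> \<Q> \<mu> > 0"
proof
  have m: "\<mu> \<in> M1_01" using mu by (simp add: W_set_def)
  assume "\<exists>H. feasible H"
  then obtain H where H: "feasible H" by blast
  show "\<Q> \<mu> > 0"
  proof (rule ccontr)
    assume "\<not> ?thesis"
    then have "\<Q> \<mu> = 0" using quad_form_nonneg[OF m] by simp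
    then show False using feasible_lower_bound[OF m H] by simp
  qed
qed (use Hopt_props[OF mu] in blast)

text \<open>Weak constraints become strict after scaling by a factor slightly above 1, at an
  arbitrarily small increase of the variance.\<close>

lemma CX_eq: "\<C> = Inf {ereal (integral\<^sup>L M (\<lambda>\<omega>. (H \<omega>)\<^sup>2)) | H. feasible H}"
proof (rule antisym)
  show "\<C> \<le> Inf {ereal (integral\<^sup>L M (\<lambda>\<omega>. (H \<omega>)\<^sup>2)) | H. feasible H}"
  proof (rule Inf_greatest)
    fix z assume "z \<in> {ereal (integral\<^sup>L M (\<lambda>\<omega>. (H \<omega>)\<^sup>2)) | H. feasible H}"
    then obtain H where z: "z = ereal (msq H)" and H: "feasible H" by blast
    define n where "n = (msq H)"
    have n: "0 \<le> n" by (simp add: n_def)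
    show "\<C> \<le> z"
    proof (rule ereal_le_epsilon2)
      fix e :: real assume e: "0 < e"
      \<comment> \<open>Chosen so that the cost is c^2 n = n + e n / (n + 1), at most n + e; the
        denominator n + 1 stays positive when n = 0.\<close>
      define c where "c = sqrt (1 + e / (n + 1))"
      have c: "c > 1" using e n by (simp add: c_def)
      have c2: "c\<^sup>2 = 1 + e / (n + 1)" using e n by (simp add: c_def add_nonneg_nonneg)
      have A: "1 < \<w> (\<lambda>\<omega>. c * H \<omega>) (\<xi> v)" if "v \<in> {0..1}" for v
      proof -
        have "1 \<le> \<w> H (\<xi> v)" using H that by (simp add: feasible2_def)
        then have "c * 1 \<le> c * \<w> H (\<xi> v)" using c by (intro mult_left_mono) auto
        then show ?thesis unfolding wH_scale using c by linarith
      qed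
      have B: "(\<lambda>\<omega>. c * H \<omega>) \<in> \<G>" using H L_scale by (simp add: feasible2_def)
      have "\<C> \<le> ereal (\<integral>\<omega>. (c * H \<omega>)\<^sup>2 \<partial>M)"
        unfolding CX_def by (rule Inf_lower, rule CollectI, rule exI[of _ "\<lambda>\<omega>. c * H \<omega>"], intro conjI refl ballI A B)
      also have "(\<integral>\<omega>. (c * H \<omega>)\<^sup>2 \<partial>M) = c\<^sup>2 * n" unfolding power_mult_distrib n_def by (rule integral_mult_right_zero)
      also have "\<dots> = n + e * (n / (n + 1))" unfolding c2 by (simp add: algebra_simps)
      also have "ereal \<dots> \<le> ereal (n + e * 1)"
        unfolding ereal_less_eq using e n by (intro add_left_mono mult_left_mono) auto
      finally show "\<C> \<le> z + ereal e" by (simp add: z n_def)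
    qed
  qed
  show "Inf {ereal (integral\<^sup>L M (\<lambda>\<omega>. (H \<omega>)\<^sup>2)) | H. feasible H} \<le> \<C>"
    unfolding CX_def feasible2_def by (rule Inf_superset_mono) (use less_imp_le in blast)
qed

lemma CX_value:
  assumes mu: "\<mu> \<in> \<W>" and q: "\<Q> \<mu> > 0"
  shows "\<C> = ereal (1 / \<Q> \<mu>)"
  unfolding CX_eq
proof (rule antisym)
  have m: "\<mu> \<in> M1_01" using mu by (simp add: W_set_def)
  show "Inf {ereal (integral\<^sup>L M (\<lambda>\<omega>. (H \<omega>)\<^sup>2)) | H. feasible H} \<le> ereal (1 / \<Q> \<mu>)"
    unfolding Hopt_props(2)[OF mu q, symmetric] by (rule Inf_lower) (use Hopt_props(1)[OF mu q] in blast)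
  show "ereal (1 / \<Q> \<mu>) \<le> Inf {ereal (integral\<^sup>L M (\<lambda>\<omega>. (H \<omega>)\<^sup>2)) | H. feasible H}"
  proof (rule Inf_greatest)
    fix z assume "z \<in> {ereal (integral\<^sup>L M (\<lambda>\<omega>. (H \<omega>)\<^sup>2)) | H. feasible H}"
    then obtain H where z: "z = ereal (msq H)" and H: "feasible H" by blast
    show "ereal (1 / \<Q> \<mu>) \<le> z"
      unfolding z ereal_less_eq using feasible_lower_bound[OF m H] q by (simp add: pos_divide_le_eq mult.commute)
  qed
qed

text \<open>Parallelogram identity: the midpoint of two optima is feasible and so has at least the
  optimal norm, which leaves nothing for their distance.\<close>

lemma optimal_unique:
  assumes H: "feasible H" "ereal (msq H) = \<C>"
    and K: "feasible K" "ereal (msq K) = \<C>"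
  shows "AE \<omega> in M. K \<omega> = H \<omega>"
proof -
  define c where "c = (msq H)"
  have Kc: "(msq K) = c" using H K unfolding c_def by (metis ereal.inject)
  have g: "H \<in> \<G>" "K \<in> \<G>" using H K by (auto simp: feasible2_def)
  note sq = L_sq[OF g(1)] L_sq[OF g(2)]
  let ?A = "\<lambda>\<omega>. (1/2) * H \<omega> + (1/2) * K \<omega>"
  have "1 \<le> \<w> ?A (\<xi> v)" if v: "v \<in> {0..1}" for v
  proof -
    have "\<w> ?A (\<xi> v) = (1/2) * \<w> H (\<xi> v) + (1/2) * \<w> K (\<xi> v)"
      unfolding wH_def using integral_mult_lin[OF sq L_sq[OF X_gauss[OF v]], of "1/2" "1/2"] by (simp only: mult.commute)
    then show ?thesis using H(1) K(1) v by (simp add: feasible2_def) force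
  qed
  then have A: "feasible ?A" unfolding feasible2_def using L_lin[OF g] by blast
  have "\<C> \<le> ereal (\<integral>\<omega>. (?A \<omega>)\<^sup>2 \<partial>M)"
    unfolding CX_eq by (rule Inf_lower, rule CollectI, rule exI[of _ ?A], intro conjI refl A)
  then have ge: "c \<le> (\<integral>\<omega>. (?A \<omega>)\<^sup>2 \<partial>M)" using H(2) unfolding c_def by (metis ereal_less_eq(3))
  have "(\<integral>\<omega>. (1 * K \<omega> + (-1) * H \<omega>)\<^sup>2 \<partial>M) = 4 * c - 4 * (\<integral>\<omega>. (?A \<omega>)\<^sup>2 \<partial>M)"
    unfolding integral_square_lin[OF sq] integral_square_lin[OF sq(2) sq(1)] Kc c_def[symmetric]
    by (simp add: power2_eq_square mult.commute)
  then have "(\<integral>\<omega>. (1 * K \<omega> + (-1) * H \<omega>)\<^sup>2 \<partial>M) \<le> 0" using ge by linarith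
  moreover have "0 \<le> (\<integral>\<omega>. (1 * K \<omega> + (-1) * H \<omega>)\<^sup>2 \<partial>M)" by (rule integral_nonneg_AE) simp
  ultimately have z: "(\<integral>\<omega>. (1 * K \<omega> + (-1) * H \<omega>)\<^sup>2 \<partial>M) = 0" by linarith
  have "AE \<omega> in M. (1 * K \<omega> + (-1) * H \<omega>)\<^sup>2 = 0"
    using integral_nonneg_eq_0_iff_AE[OF sq_integrable_square[OF sq_integrable_lin[OF sq(2) sq(1), of 1 "-1"]]] z by simp
  then show ?thesis by (rule AE_mp) (rule AE_I2, simp)
qed

lemma wH_cong_AE:
  assumes "AE \<omega> in M. K \<omega> = H \<omega>" "H \<in> borel_measurable M" "K \<in> borel_measurable M" "v \<in> {0..1}"
  shows "\<w> K (\<xi> v) = \<w> H (\<xi> v)"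
  unfolding wH_def
proof (rule integral_cong_AE)
  have [measurable]: "X (\<xi> v) \<in> borel_measurable M" by (rule L_measurable[OF X_gauss[OF assms(4)]])
  note [measurable] = assms(2,3)
  show "(\<lambda>\<omega>. X (\<xi> v) \<omega> * K \<omega>) \<in> borel_measurable M" "(\<lambda>\<omega>. X (\<xi> v) \<omega> * H \<omega>) \<in> borel_measurable M" by measurable
  show "AE \<omega> in M. X (\<xi> v) \<omega> * K \<omega> = X (\<xi> v) \<omega> * H \<omega>" using assms(1) by (rule AE_mp) (rule AE_I2, simp)
qed

text \<open>Complementary slackness: the pairing is at least 1 along the path, while Cauchy-Schwarz
  and C = 1 / q keep its \<mu>-average at most 1. Hence it equals 1 \<mu>-almost everywhere.\<close>

lemma optimal_support:
  assumes H: "feasible H" "ereal (msq H) = \<C>" and mu: "\<mu> \<in> \<W>"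
  shows "emeasure \<mu> {v\<in>{0..1}. \<w> H (\<xi> v) > 1} = 0"
proof -
  have m: "\<mu> \<in> M1_01" using mu by (simp add: W_set_def)
  interpret mu: prob_space \<mu> by (rule M1_01_D[OF m])
  have q: "\<Q> \<mu> > 0" using feasible_iff[OF mu] H by blast
  have g: "H \<in> \<G>" using H by (auto simp: feasible2_def)
  have iw: "integrable \<mu> (\<lambda>v. \<w> H (\<xi> v))" by (rule M1_01_integrable[OF m wH_continuous[OF L_sq[OF g]]])
  have C: "\<Q> \<mu> * (msq H) = 1"
    using H(2) CX_value[OF mu q] q by simp
  have "(\<integral>v. \<w> H (\<xi> v) \<partial>\<mu>)\<^sup>2 \<le> 1"
    unfolding Zmu_inner[OF m L_sq[OF g], symmetric]
    using integral_Cauchy_Schwarz[OF Zmu_L2(1)[OF m] L_sq[OF g]] C unfolding quad_form_eq[OF m] by linarith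
  then have "(\<integral>v. \<w> H (\<xi> v) \<partial>\<mu>) \<le> 1" by (simp add: power2_le_iff_abs_le abs_le_square_iff power_le_one_iff abs_square_le_1)
  then have le: "(\<integral>v. \<w> H (\<xi> v) - 1 \<partial>\<mu>) \<le> 0" using iw mu.prob_space by simp
  have nn: "AE v in \<mu>. 0 \<le> \<w> H (\<xi> v) - 1"
    by (rule AE_I2) (use H(1) in \<open>simp add: M1_01_D(3)[OF m] feasible2_def\<close>)
  have "0 \<le> (\<integral>v. \<w> H (\<xi> v) - 1 \<partial>\<mu>)" by (rule integral_nonneg_AE[OF nn])
  then have "(\<integral>v. \<w> H (\<xi> v) - 1 \<partial>\<mu>) = 0" using le by linarith
  then have "AE v in \<mu>. \<w> H (\<xi> v) - 1 = 0"
    using integral_nonneg_eq_0_iff_AE[OF _ nn] iw by simp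
  then have "AE v in \<mu>. \<not> \<w> H (\<xi> v) > 1" by (rule AE_mp) (rule AE_I2, simp)
  then have "emeasure \<mu> {v\<in>space \<mu>. \<w> H (\<xi> v) > 1} = 0" by (rule emeasure_eq_0_AE)
  then show ?thesis unfolding M1_01_D(3)[OF m] .
qed

end

section \<open>Exceedance probabilities\<close>

lemma unit_interval_dense_seq:
  "\<exists>d :: nat \<Rightarrow> real. (\<forall>k. d k \<in> {0..1}) \<and> closure (range d) = {0..1}"
proof -
  obtain S :: "real set" where S: "countable S" "S \<subseteq> {0..1}" "{0..1} \<subseteq> closure S"
    using separable[of "{0..1::real}"] by metis
  have ne: "S \<noteq> {}" using S(3) by auto
  have r: "range (from_nat_into S) = S" by (rule range_from_nat_into[OF ne S(1)])
  have "closure S \<subseteq> {0..1}" using S(2) by (rule closure_minimal) simp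
  then have "closure S = {0..1}" using S(3) by blast
  moreover have "from_nat_into S k \<in> {0..1}" for k using from_nat_into[OF ne] S(2) by blast
  ultimately show ?thesis using r by (intro exI[of _ "from_nat_into S"] conjI allI) (simp_all only:)
qed

text \<open>One fixed dense sequence serves both measurability of exceedance events and Fernique's
  inequality, since path continuity reduces bounds over the interval to countably many.\<close>

definition unit_dense :: "nat \<Rightarrow> real" where
  "unit_dense = (SOME d. (\<forall>k. d k \<in> {0..1}) \<and> closure (range d) = {0..1})"

lemma unit_dense: "unit_dense k \<in> {0..1}" "closure (range unit_dense) = {0..1}"
  using someI_ex[OF unit_interval_dense_seq] unfolding unit_dense_def by blast+

lemma unit_dense_le:
  fixes f :: "real \<Rightarrow> real"
  assumes "continuous_on {0..1} f" "\<And>k. f (unit_dense k) \<le> s" "v \<in> {0..1}"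
  shows "f v \<le> s"
  by (rule continuous_le_on_closure[of "range unit_dense" f v s]) (use assms unit_dense(2) in auto)

lemma exp_quadratic_tendsto_zero:
  fixes \<beta> :: real
  assumes b: "\<beta> > 0"
  shows "((\<lambda>u. exp (- \<beta> * u\<^sup>2 + a * u + c)) \<longlongrightarrow> 0) at_top"
proof (rule tendsto_sandwich[OF _ _ tendsto_const])
  have "filterlim (\<lambda>u::real. - u) at_bot at_top" by (rule filterlim_uminus_at_bot_at_top)
  then show "((\<lambda>u::real. exp (- u)) \<longlongrightarrow> 0) at_top" by (rule filterlim_compose[OF exp_at_bot])
  show "eventually (\<lambda>u. 0 \<le> exp (- \<beta> * u\<^sup>2 + a * u + c)) at_top" by simp
  \<comment> \<open>Beyond the threshold, \<beta> u^2 is at least (|a| + 1 + |c|) u, which absorbs a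
    u and c and leaves one further u for the comparison function.\<close>
  show "eventually (\<lambda>u. exp (- \<beta> * u\<^sup>2 + a * u + c) \<le> exp (- u)) at_top"
    using eventually_ge_at_top[of "max 1 ((\<bar>a\<bar> + 1 + \<bar>c\<bar>) / \<beta>)"]
  proof eventually_elim
    case (elim u)
    then have u: "u \<ge> 1" and "(\<bar>a\<bar> + 1 + \<bar>c\<bar>) / \<beta> \<le> u" by auto
    then have "\<bar>a\<bar> + 1 + \<bar>c\<bar> \<le> \<beta> * u" using b by (simp add: pos_divide_le_eq mult.commute)
    then have "(\<bar>a\<bar> + 1 + \<bar>c\<bar>) * u \<le> \<beta> * u * u" using u by (intro mult_right_mono) auto
    then have 1: "\<bar>a\<bar> * u + u + \<bar>c\<bar> * u \<le> \<beta> * u\<^sup>2" by (simp add: distrib_right power2_eq_square mult.assoc)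
    have 2: "a * u \<le> \<bar>a\<bar> * u" using u by (intro mult_right_mono) auto
    have "\<bar>c\<bar> * 1 \<le> \<bar>c\<bar> * u" using u by (intro mult_left_mono) auto
    then have 3: "c \<le> \<bar>c\<bar> * u" by linarith
    have "u + a * u + c \<le> \<beta> * u\<^sup>2" using 1 2 3 by linarith
    then show ?case by simp
  qed
qed

text \<open>Divided by u^2, the logarithm of the lower bound is ln c0 / u^2 - (C + L / u)^2 / (2 C);
  prefactor and shift vanish on this scale, and both bounds meet at -C / 2.\<close>

lemma eln_quadratic_limit:
  fixes f :: "real \<Rightarrow> real"
  assumes C: "C > 0" and c0: "c0 > 0"
    and lo: "\<And>u. u \<ge> 0 \<Longrightarrow> c0 * exp (- (C * u + L)\<^sup>2 / (2 * C)) \<le> f u"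
    and up: "\<And>u. u \<ge> 0 \<Longrightarrow> f u \<le> exp (- (C * u\<^sup>2) / 2)"
  shows "((\<lambda>u. eln (f u) / ereal (u\<^sup>2)) \<longlongrightarrow> ereal (- C / 2)) at_top"
proof -
  have pos: "f u > 0" if "u \<ge> 0" for u
    by (rule less_le_trans[OF _ lo[OF that]]) (use c0 in simp)
  have inv: "((\<lambda>u::real. inverse u) \<longlongrightarrow> 0) at_top" by (rule tendsto_inverse_0_at_top) (rule filterlim_ident)
  have "((\<lambda>u. ln c0 * (inverse u)\<^sup>2 - (C + L * inverse u)\<^sup>2 / (2 * C)) \<longlongrightarrow> ln c0 * 0\<^sup>2 - (C + L * 0)\<^sup>2 / (2 * C)) at_top"
    by (intro tendsto_intros inv) (use C in simp)
  then have l1: "((\<lambda>u. ln c0 * (inverse u)\<^sup>2 - (C + L * inverse u)\<^sup>2 / (2 * C)) \<longlongrightarrow> - C / 2) at_top"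
    using C by (simp add: power2_eq_square)
  have "((\<lambda>u. ln (f u) / u\<^sup>2) \<longlongrightarrow> - C / 2) at_top"
  proof (rule tendsto_sandwich[OF _ _ l1 tendsto_const])
    show "eventually (\<lambda>u. ln c0 * (inverse u)\<^sup>2 - (C + L * inverse u)\<^sup>2 / (2 * C) \<le> ln (f u) / u\<^sup>2) at_top"
      using eventually_gt_at_top[of 0]
    proof eventually_elim
      case (elim u)
      have "ln (c0 * exp (- (C * u + L)\<^sup>2 / (2 * C))) \<le> ln (f u)"
        using lo[of u] c0 elim pos[of u] by (subst ln_le_cancel_iff) auto
      then have "ln c0 - (C * u + L)\<^sup>2 / (2 * C) \<le> ln (f u)" using c0 by (simp add: ln_mult)
      then have "(ln c0 - (C * u + L)\<^sup>2 / (2 * C)) / u\<^sup>2 \<le> ln (f u) / u\<^sup>2" by (rule divide_right_mono) simp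
      moreover have "(C * u + L)\<^sup>2 = (C + L * inverse u)\<^sup>2 * u\<^sup>2"
        using elim unfolding power_mult_distrib[symmetric] by (simp add: distrib_right mult.assoc)
      then have "(ln c0 - (C * u + L)\<^sup>2 / (2 * C)) / u\<^sup>2 = ln c0 * (inverse u)\<^sup>2 - (C + L * inverse u)\<^sup>2 / (2 * C)"
      proof -
        have "(C + L * inverse u)\<^sup>2 * u\<^sup>2 / (2 * C) / u\<^sup>2 = (C + L * inverse u)\<^sup>2 / (2 * C)" using elim by simp
        moreover have "ln c0 / u\<^sup>2 = ln c0 * (inverse u)\<^sup>2" by (simp only: divide_inverse power_inverse)
        ultimately show ?thesis
          unfolding diff_divide_distrib \<open>(C * u + L)\<^sup>2 = (C + L * inverse u)\<^sup>2 * u\<^sup>2\<close> by (simp only:)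
      qed
      ultimately show ?case by simp
    qed
    show "eventually (\<lambda>u. ln (f u) / u\<^sup>2 \<le> - C / 2) at_top"
      using eventually_gt_at_top[of 0]
    proof eventually_elim
      case (elim u)
      have "ln (f u) \<le> ln (exp (- (C * u\<^sup>2) / 2))"
        using up[of u] elim pos[of u] by (subst ln_le_cancel_iff) auto
      then have "ln (f u) \<le> - C / 2 * u\<^sup>2" by simp
      then show ?case using elim by (simp only: pos_divide_le_eq zero_less_power)
    qed
  qed
  then have "((\<lambda>u. ereal (ln (f u) / u\<^sup>2)) \<longlongrightarrow> ereal (- C / 2)) at_top" by simp
  then show ?thesis
  proof (rule Lim_transform_eventually)
    show "eventually (\<lambda>u. ereal (ln (f u) / u\<^sup>2) = eln (f u) / ereal (u\<^sup>2)) at_top"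
      using eventually_gt_at_top[of 0]
    proof eventually_elim
      case (elim u)
      then show ?case using pos[of u] by (simp add: eln_def)
    qed
  qed
qed

context gauss_path
begin

text \<open>The event involves uncountably many strict inequalities. A path attains its minimum, so
  exceedance leaves a uniform margin 1 / (n + 1), and a weak inequality with margin can be tested on
  the dense sequence.\<close>

lemma exceedance_sets: "exceed u \<in> sets M"
proof -
  have [measurable]: "X (\<xi> (unit_dense k)) \<in> borel_measurable M" for k
    by (rule L_measurable[OF X_gauss[OF unit_dense(1)]])
  have "exceed u
    = {\<omega>\<in>space M. \<exists>n::nat. \<forall>k. u + inverse (real (Suc n)) \<le> X (\<xi> (unit_dense k)) \<omega>}"
  proof (intro set_eqI iffI)
    fix \<omega> assume "\<omega> \<in> exceed u"
    then have w: "\<omega> \<in> space M" and gt: "\<And>v. v \<in> {0..1} \<Longrightarrow> X (\<xi> v) \<omega> > u" by blast+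
    obtain v0 where v0: "v0 \<in> {0..1}" "\<forall>v\<in>{0..1}. X (\<xi> v0) \<omega> \<le> X (\<xi> v) \<omega>"
      using continuous_attains_inf[OF compact_Icc _ X_path_continuous[OF w]] by auto
    have "0 < X (\<xi> v0) \<omega> - u" using gt[OF v0(1)] by simp
    then obtain n where n: "inverse (real (Suc n)) < X (\<xi> v0) \<omega> - u" using reals_Archimedean by blast
    have "u + inverse (real (Suc n)) \<le> X (\<xi> (unit_dense k)) \<omega>" for k
    proof -
      have "X (\<xi> v0) \<omega> \<le> X (\<xi> (unit_dense k)) \<omega>" using v0(2) unit_dense(1) by blast
      then show ?thesis using n by linarith
    qed
    then show "\<omega> \<in> {\<omega>\<in>space M. \<exists>n::nat. \<forall>k. u + inverse (real (Suc n)) \<le> X (\<xi> (unit_dense k)) \<omega>}" using w by blast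
  next
    fix \<omega> assume "\<omega> \<in> {\<omega>\<in>space M. \<exists>n::nat. \<forall>k. u + inverse (real (Suc n)) \<le> X (\<xi> (unit_dense k)) \<omega>}"
    then obtain n where w: "\<omega> \<in> space M" and n: "\<And>k. u + inverse (real (Suc n)) \<le> X (\<xi> (unit_dense k)) \<omega>" by blast
    have "X (\<xi> v) \<omega> > u" if v: "v \<in> {0..1}" for v
    proof -
      have "- X (\<xi> v) \<omega> \<le> - (u + inverse (real (Suc n)))"
        by (rule unit_dense_le[OF continuous_on_minus[OF X_path_continuous[OF w]] _ v]) (rule le_imp_neg_le, rule n)
      moreover have "0 < inverse (real (Suc n))" by simp
      ultimately show ?thesis by linarith
    qed
    then show "\<omega> \<in> exceed u" using w by blast
  qed
  moreover have "{\<omega>\<in>space M. \<exists>n::nat. \<forall>k. u + inverse (real (Suc n)) \<le> X (\<xi> (unit_dense k)) \<omega>} \<in> sets M"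
    by measurable
  ultimately show ?thesis by simp
qed

lemma Zmu_exceedance:
  assumes m: "\<mu> \<in> M1_01" and w: "\<omega> \<in> space M" and gt: "\<forall>v\<in>{0..1}. X (\<xi> v) \<omega> > u"
  shows "Zmu \<mu> \<omega> \<ge> u"
proof -
  interpret mu: prob_space \<mu> by (rule M1_01_D[OF m])
  have "(\<integral>v. u \<partial>\<mu>) \<le> (\<integral>v. X (\<xi> v) \<omega> \<partial>\<mu>)"
  proof (rule integral_mono)
    show "integrable \<mu> (\<lambda>v. X (\<xi> v) \<omega>)" by (rule M1_01_integrable[OF m X_path_continuous[OF w]])
    show "u \<le> X (\<xi> v) \<omega>" if "v \<in> space \<mu>" for v using gt that M1_01_D(3)[OF m] by (simp add: less_imp_le)
  qed simp
  then show ?thesis using mu.prob_space by (simp add: Zmu_def)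
qed

lemma Psi_zero:
  assumes mu: "\<mu> \<in> M1_01" and q: "\<Q> \<mu> = 0" and u: "u > 0"
  shows "\<Psi> u = 0"
proof -
  have "AE \<omega> in M. (Zmu \<mu> \<omega>)\<^sup>2 = 0"
    using integral_nonneg_eq_0_iff_AE[OF sq_integrable_square[OF Zmu_L2(1)[OF mu]]] q quad_form_eq[OF mu] by simp
  then have "AE \<omega> in M. \<omega> \<in> exceed u \<longrightarrow> \<omega> \<in> {}"
  proof (rule AE_mp, intro AE_I2 impI)
    fix \<omega> assume z: "(Zmu \<mu> \<omega>)\<^sup>2 = 0" and e: "\<omega> \<in> exceed u"
    then have "Zmu \<mu> \<omega> \<ge> u" using Zmu_exceedance[OF mu] by blast
    then show "\<omega> \<in> {}" using z u by simp
  qed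
  then have "measure M (exceed u) \<le> measure M {}"
    by (rule finite_measure_mono_AE) simp
  then show ?thesis unfolding Psi_def by (simp add: measure_le_0_iff)
qed

text \<open>Splitting the path as \<open>X = w H / C + y\<close> with \<open>H\<close> optimal and \<open>y\<close> independent of \<open>H\<close>:
  exceedance of the level \<open>u\<close> forces \<open>H \<ge> C u\<close>, and conversely it is implied by \<open>H > C (u + K)\<close>
  as long as \<open>y\<close> stays below \<open>K\<close>.\<close>

lemma exceedance_bounds:
  fixes C :: real
  assumes mu: "\<mu> \<in> \<W>" and q: "\<Q> \<mu> > 0"
  defines "C \<equiv> 1 / \<Q> \<mu>"
  obtains \<alpha> c0 B L K where "\<alpha> > 0" "c0 > 0" "B > 0"
    "\<And>u. u \<ge> 0 \<Longrightarrow> \<Psi> u \<le> exp (- (C * u\<^sup>2) / 2)"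
    "\<And>u. u \<ge> 0 \<Longrightarrow> c0 * exp (- (C * u + L)\<^sup>2 / (2 * C)) \<le> \<Psi> u"
    "\<And>u \<epsilon>. u > 0 \<Longrightarrow> \<epsilon> > 0 \<Longrightarrow> \<epsilon> * u / 2 \<ge> K \<Longrightarrow>
       measure M (deviate (Hopt \<mu>) \<epsilon> u)
       \<le> exp (- (C * u * (1 + \<epsilon> / (2 * B)))\<^sup>2 / (2 * C)) + exp (- (C * u\<^sup>2) / 2) * exp (- \<alpha> * (\<epsilon> * u / 2)\<^sup>2)"
proof -
  have m: "\<mu> \<in> M1_01" using mu by (simp add: W_set_def)
  have C: "C > 0" using q by (simp add: C_def)
  define H where "H = Hopt \<mu>"
  define w where "w v = \<w> H (\<xi> v)" for v
  have feas: "feasible H" and nH: "(msq H) = C"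
    unfolding H_def C_def by (rule Hopt_props[OF mu q])+
  have Hg: "H \<in> \<G>" and w1: "\<And>v. v \<in> {0..1} \<Longrightarrow> 1 \<le> w v"
    using feas by (auto simp: feasible2_def w_def)
  have HZ: "H \<omega> = C * Zmu \<mu> \<omega>" for \<omega> by (simp add: H_def Hopt_def C_def)
  have cw: "continuous_on {0..1} w" unfolding w_def by (rule wH_continuous[OF L_sq[OF Hg]])
  obtain B where B: "B > 0" "\<And>v. v \<in> {0..1} \<Longrightarrow> \<bar>w v\<bar> \<le> B" using continuous_on_unit_interval_bounded[OF cw] by blast
  \<comment> \<open>The coefficient w / C makes \<open>Y v\<close> orthogonal to \<open>H\<close>,
    because E H^2 = C and the pairing of \<open>X (\<xi> v)\<close> with \<open>H\<close> is
    \<open>w v\<close>.\<close>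
  define Y where "Y v = (\<lambda>\<omega>. 1 * X (\<xi> v) \<omega> + (- (w v / C)) * H \<omega>)" for v
  have XY: "X (\<xi> v) \<omega> = w v * (H \<omega> / C) + Y v \<omega>" for v \<omega> by (simp add: Y_def)
  have Yg: "Y v \<in> \<G>" if "v \<in> {0..1}" for v unfolding Y_def by (rule L_lin[OF X_gauss[OF that] Hg])
  have Yo: "(\<integral>\<omega>. Y v \<omega> * H \<omega> \<partial>M) = 0" if v: "v \<in> {0..1}" for v
    unfolding Y_def integral_mult_lin[OF L_sq[OF X_gauss[OF v]] L_sq[OF Hg] L_sq[OF Hg]]
    using nH C by (simp add: w_def wH_def power2_eq_square)
  have cY: "continuous_on {0..1} (\<lambda>v. Y v \<omega>)" if "\<omega> \<in> space M" for \<omega>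
    unfolding Y_def by (intro continuous_intros X_path_continuous[OF that] cw) (use C in auto)
  define y where "y k = Y (unit_dense k)" for k
  have yg: "y k \<in> \<G>" for k unfolding y_def by (rule Yg[OF unit_dense(1)])
  have yo: "(\<integral>\<omega>. y k \<omega> * H \<omega> \<partial>M) = 0" for k unfolding y_def by (rule Yo[OF unit_dense(1)])
  have ybd: "\<exists>s. \<forall>k. \<bar>y k \<omega>\<bar> \<le> s" if o: "\<omega> \<in> space M" for \<omega>
  proof -
    obtain s where "\<And>v. v \<in> {0..1} \<Longrightarrow> \<bar>Y v \<omega>\<bar> \<le> s" using continuous_on_unit_interval_bounded[OF cY[OF o]] by blast
    then show ?thesis unfolding y_def using unit_dense(1) by blast
  qed
  have Ysup: "\<bar>Y v \<omega>\<bar> \<le> s" if "\<omega> \<in> sup_le y s" "v \<in> {0..1}" for v \<omega> s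
  proof -
    have o: "\<omega> \<in> space M" and k: "\<And>k. \<bar>Y (unit_dense k) \<omega>\<bar> \<le> s" using that(1) unfolding sup_le_def y_def by blast+
    show ?thesis by (rule unit_dense_le[OF continuous_on_rabs[OF cY[OF o]] k that(2)])
  qed
  obtain K \<alpha> where K: "K > 0" and al: "\<alpha> > 0" and half: "measure M (sup_le y K) \<ge> 1/2"
    and tail: "\<And>t. t \<ge> K \<Longrightarrow> 1 - measure M (sup_le y t) \<le> exp (- \<alpha> * t\<^sup>2)"
    using Fernique_tail[of y, OF yg ybd] by metis
  have vH: "(msq H) > 0" using nH C by simp
  have Htail: "measure M {\<omega>\<in>space M. H \<omega> \<ge> a} \<le> exp (- a\<^sup>2 / (2 * C))" if "a \<ge> 0" for a
    using L_upper_tail[OF Hg vH that] unfolding nH .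
  have Hm[measurable]: "H \<in> borel_measurable M" by (rule L_measurable[OF Hg])
  have Hsets: "{\<omega>\<in>space M. H \<omega> \<ge> a} \<in> sets M" for a by measurable
  have Hu: "H \<omega> \<ge> C * u" if "\<omega> \<in> space M" "\<forall>v\<in>{0..1}. X (\<xi> v) \<omega> > u" for \<omega> u
    unfolding HZ using Zmu_exceedance[OF m that] C by simp
  have sqC: "(C * u)\<^sup>2 / (2 * C) = C * u\<^sup>2 / 2" for u using C by (simp add: power2_eq_square)
  have Hu_tail: "measure M {\<omega>\<in>space M. H \<omega> \<ge> C * u} \<le> exp (- (C * u\<^sup>2) / 2)" if "u \<ge> 0" for u
    using Htail[of "C * u"] that C sqC[of u] by simp
  \<comment> \<open>The prefactor of the lower normal tail times 1/2, the bound for the probability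
    that y stays within K. In \<open>L\<close>, the term C K pays for that margin and 1 for the unit
    interval in \<open>normal_density_lower_tail\<close>.\<close>
  define c0 where "c0 = (1 / sqrt (2 * pi * C)) / 2"
  define L where "L = C * K + 1"
  show ?thesis
  proof (rule that[of \<alpha> c0 B L K])
    show "\<alpha> > 0" "B > 0" using al B by auto
    show "c0 > 0" using C by (simp add: c0_def)
    show "\<Psi> u \<le> exp (- (C * u\<^sup>2) / 2)" if "u \<ge> 0" for u
    proof -
      have "\<Psi> u \<le> measure M {\<omega>\<in>space M. H \<omega> \<ge> C * u}"
        unfolding Psi_def by (rule finite_measure_mono[OF _ Hsets]) (use Hu in blast)
      also have "\<dots> \<le> exp (- (C * u\<^sup>2) / 2)" by (rule Hu_tail[OF that])
      finally show ?thesis .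
    qed
    show "c0 * exp (- (C * u + L)\<^sup>2 / (2 * C)) \<le> \<Psi> u" if u: "u \<ge> 0" for u
    proof -
      let ?a = "C * (u + K)"
      have a0: "0 \<le> ?a" using C u K by simp
      have lt: "1 / sqrt (2 * pi * C) * exp (- (?a + 1)\<^sup>2 / (2 * C)) \<le> measure M {\<omega>\<in>space M. H \<omega> > ?a}"
        using L_lower_tail[OF Hg vH a0] unfolding nH .
      have eqa: "C * u + L = ?a + 1" by (simp add: L_def distrib_left)
      have "c0 * exp (- (C * u + L)\<^sup>2 / (2 * C)) = (1 / sqrt (2 * pi * C) * exp (- (?a + 1)\<^sup>2 / (2 * C))) * (1 / 2)"
        unfolding eqa c0_def by simp
      also have "\<dots> \<le> measure M {\<omega>\<in>space M. H \<omega> > ?a} * measure M (sup_le y K)"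
        by (rule mult_mono[OF lt half]) simp_all
      also have "\<dots> = measure M ({\<omega>\<in>space M. H \<omega> \<in> {?a<..}} \<inter> sup_le y K)"
        using uncorrelated_sup[of H y "{?a<..}" K, OF Hg yg yo borel_open[OF open_greaterThan]]
        unfolding greaterThan_iff by (rule sym)
      also have "\<dots> \<le> \<Psi> u"
        unfolding Psi_def
      proof (rule finite_measure_mono[OF _ exceedance_sets], rule subsetI)
        fix \<omega> assume o: "\<omega> \<in> {\<omega>\<in>space M. H \<omega> \<in> {?a<..}} \<inter> sup_le y K"
        then have os: "\<omega> \<in> space M" and Ha: "H \<omega> > ?a" and oy: "\<omega> \<in> sup_le y K" by auto
        have "X (\<xi> v) \<omega> > u" if v: "v \<in> {0..1}" for v
        proof -
          \<comment> \<open>H / C is positive and w \<ge> 1, so X is at least H / C - K, which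
            exceeds u.\<close>
          have h: "H \<omega> / C > u + K" using Ha unfolding pos_less_divide_eq[OF C] by (simp only: mult.commute)
          then have "1 * (H \<omega> / C) \<le> w v * (H \<omega> / C)" using w1[OF v] u K by (intro mult_right_mono) auto
          then show ?thesis using XY[of v \<omega>] Ysup[OF oy v] h by linarith
        qed
        then show "\<omega> \<in> exceed u" using os by blast
      qed
      finally show ?thesis .
    qed
    show "measure M (deviate (Hopt \<mu>) \<epsilon> u)
       \<le> exp (- (C * u * (1 + \<epsilon> / (2 * B)))\<^sup>2 / (2 * C)) + exp (- (C * u\<^sup>2) / 2) * exp (- \<alpha> * (\<epsilon> * u / 2)\<^sup>2)"
      (is "measure M ?N \<le> _") if u: "u > 0" and e: "\<epsilon> > 0" and eK: "\<epsilon> * u / 2 \<ge> K" for u \<epsilon>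
    proof -
      let ?b = "C * u * (1 + \<epsilon> / (2 * B))"
      let ?A1 = "{\<omega>\<in>space M. H \<omega> \<ge> ?b}" and ?A2 = "{\<omega>\<in>space M. H \<omega> \<ge> C * u}" and ?S = "sup_le y (\<epsilon> * u / 2)"
      have b0: "?b \<ge> 0"
        by (intro mult_nonneg_nonneg add_nonneg_nonneg divide_nonneg_nonneg) (use C u e B in auto)
      have S: "?S \<in> sets M" by (rule sup_le_sets[of y, OF yg])
      \<comment> \<open>The deviation \<epsilon> is split in halves: either \<open>H\<close> exceeds
        C u by the relative amount \<epsilon> / (2 B), or the remainder exceeds \<epsilon> u / 2
        somewhere. In the second case H \<ge> C u is retained, and independence makes the two
        probabilities multiply.\<close>
      have sub: "?N \<subseteq> ?A1 \<union> (?A2 - ?A2 \<inter> ?S)"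
      proof
        fix \<omega> assume "\<omega> \<in> ?N"
        then have o: "\<omega> \<in> space M \<and> (SUP v\<in>{0..1}. \<bar>X (\<xi> v) \<omega> / u - w v\<bar>) \<ge> \<epsilon> \<and> (\<forall>v\<in>{0..1}. X (\<xi> v) \<omega> > u)"
          unfolding w_def H_def mem_Collect_eq .
        note os = conjunct1[OF o] and sup = conjunct1[OF conjunct2[OF o]] and gt = conjunct2[OF conjunct2[OF o]]
        have H2: "H \<omega> \<ge> C * u" by (rule Hu[OF os gt])
        have cf: "continuous_on {0..1} (\<lambda>v. \<bar>X (\<xi> v) \<omega> / u - w v\<bar>)"
          by (intro continuous_intros X_path_continuous[OF os] cw) (use u in auto)
        obtain v where v: "v \<in> {0..1}" "\<forall>x\<in>{0..1}. \<bar>X (\<xi> x) \<omega> / u - w x\<bar> \<le> \<bar>X (\<xi> v) \<omega> / u - w v\<bar>"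
          using continuous_attains_sup[OF compact_Icc _ cf] by auto
        have "(SUP v\<in>{0..1}. \<bar>X (\<xi> v) \<omega> / u - w v\<bar>) \<le> \<bar>X (\<xi> v) \<omega> / u - w v\<bar>"
          by (rule cSUP_least) (use v(2) in auto)
        then have ge: "\<epsilon> \<le> \<bar>X (\<xi> v) \<omega> / u - w v\<bar>" using sup by linarith
        have "\<omega> \<notin> ?S" if nb: "\<not> H \<omega> \<ge> ?b"
        proof
          assume oS: "\<omega> \<in> ?S"
          \<comment> \<open>Relative overshoot of \<open>H\<close> over C u; the deviation at v is
            then w r + Y / u.\<close>
          define r where "r = H \<omega> / (C * u) - 1"
          have Cu: "C * u > 0" using C u by simp
          have r0: "0 \<le> r" using H2 Cu by (simp add: r_def pos_le_divide_eq)
          have "H \<omega> / (C * u) < 1 + \<epsilon> / (2 * B)" using nb Cu by (simp add: pos_divide_less_eq mult.commute)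
          then have r1: "r < \<epsilon> / (2 * B)" by (simp add: r_def)
          have "X (\<xi> v) \<omega> / u - w v = w v * r + Y v \<omega> / u"
            unfolding XY[of v \<omega>] r_def using C u by (simp add: add_divide_distrib right_diff_distrib)
          then have "\<bar>X (\<xi> v) \<omega> / u - w v\<bar> \<le> \<bar>w v * r\<bar> + \<bar>Y v \<omega> / u\<bar>" by (simp only: abs_triangle_ineq)
          moreover have "\<bar>w v * r\<bar> \<le> B * r" unfolding abs_mult using B(2)[OF v(1)] r0 by (intro mult_mono) auto
          moreover have "B * r < B * (\<epsilon> / (2 * B))" using r1 B(1) by (rule mult_strict_left_mono)
          moreover have "B * (\<epsilon> / (2 * B)) = \<epsilon> / 2" using B(1) by simp
          moreover have "\<bar>Y v \<omega> / u\<bar> \<le> \<epsilon> / 2"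
            using Ysup[OF oS v(1)] u by (simp add: abs_divide pos_divide_le_eq)
          ultimately show False using ge by linarith
        qed
        then show "\<omega> \<in> ?A1 \<union> (?A2 - ?A2 \<inter> ?S)" using os H2 by blast
      qed
      have "measure M ?N \<le> measure M (?A1 \<union> (?A2 - ?A2 \<inter> ?S))"
        by (rule finite_measure_mono[OF sub]) (use Hsets S in auto)
      also have "\<dots> \<le> measure M ?A1 + measure M (?A2 - ?A2 \<inter> ?S)"
        by (rule measure_Un_le) (use Hsets S in auto)
      also have "measure M (?A2 - ?A2 \<inter> ?S) = measure M ?A2 - measure M (?A2 \<inter> ?S)"
        by (rule finite_measure_Diff) (use Hsets S in auto)
      also have "measure M (?A2 \<inter> ?S) = measure M ?A2 * measure M ?S"
        using uncorrelated_sup[of H y "{C * u..}" "\<epsilon> * u / 2", OF Hg yg yo borel_closed[OF closed_atLeast]]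
        unfolding atLeast_iff .
      also have "measure M ?A1 + (measure M ?A2 - measure M ?A2 * measure M ?S)
        = measure M ?A1 + measure M ?A2 * (1 - measure M ?S)" by (simp add: right_diff_distrib)
      also have "\<dots> \<le> exp (- ?b\<^sup>2 / (2 * C)) + exp (- (C * u\<^sup>2) / 2) * exp (- \<alpha> * (\<epsilon> * u / 2)\<^sup>2)"
        by (intro add_mono mult_mono Htail[OF b0] Hu_tail tail[OF eK]) (use u in auto)
      finally show ?thesis .
    qed
  qed
qed

text \<open>Both terms of the upper bound beat exp (-C u^2 / 2) by a factor Gaussian in u, whereas
  the lower bound for the denominator loses only a factor exponential in u.\<close>

lemma conditional_limit:
  assumes mu: "\<mu> \<in> \<W>" and q: "\<Q> \<mu> > 0" and e: "\<epsilon> > 0"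
  shows "((\<lambda>u. measure M (deviate (Hopt \<mu>) \<epsilon> u)
      / \<Psi> u) \<longlongrightarrow> 0) at_top"
    (is "((\<lambda>u. ?N u / _) \<longlongrightarrow> 0) at_top")
proof -
  define C where "C = 1 / \<Q> \<mu>"
  have C: "C > 0" using q by (simp add: C_def)
  show ?thesis
  proof (rule exceedance_bounds[OF mu q, folded C_def])
    fix \<alpha> c0 B L K :: real
    assume p: "\<alpha> > 0" "c0 > 0" "B > 0"
      and lo: "\<And>u. u \<ge> 0 \<Longrightarrow> c0 * exp (- (C * u + L)\<^sup>2 / (2 * C)) \<le> \<Psi> u"
      and up: "\<And>u \<epsilon>. u > 0 \<Longrightarrow> \<epsilon> > 0 \<Longrightarrow> \<epsilon> * u / 2 \<ge> K \<Longrightarrow>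
         measure M (deviate (Hopt \<mu>) \<epsilon> u)
         \<le> exp (- (C * u * (1 + \<epsilon> / (2 * B)))\<^sup>2 / (2 * C)) + exp (- (C * u\<^sup>2) / 2) * exp (- \<alpha> * (\<epsilon> * u / 2)\<^sup>2)"
    define \<eta> where "\<eta> = \<epsilon> / (2 * B)"
    have eta: "\<eta> > 0" using p e by (simp add: \<eta>_def)
    \<comment> \<open>\<open>b1\<close> and \<open>b2\<close> are the surplus of the two exponents
      over C u^2 / 2: one from (1 + \<eta>)^2 - 1 = 2 \<eta> + \<eta>^2, the other from \<alpha>
      (\<epsilon> u / 2)^2.\<close>
    define b1 where "b1 = C * (2 * \<eta> + \<eta>\<^sup>2) / 2"
    define b2 where "b2 = \<alpha> * \<epsilon>\<^sup>2 / 4"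
    have b: "b1 > 0" "b2 > 0" using C eta p e by (auto simp: b1_def b2_def add_pos_pos)
    let ?g = "\<lambda>u. (exp (- b1 * u\<^sup>2 + L * u + L\<^sup>2 / (2 * C)) + exp (- b2 * u\<^sup>2 + L * u + L\<^sup>2 / (2 * C))) / c0"
    have "(?g \<longlongrightarrow> (0 + 0) / c0) at_top"
      by (intro tendsto_intros exp_quadratic_tendsto_zero b) (use p in simp)
    then have g: "(?g \<longlongrightarrow> 0) at_top" by simp
    have E: "(C * u + L)\<^sup>2 / (2 * C) = C * u\<^sup>2 / 2 + L * u + L\<^sup>2 / (2 * C)" for u
      using C by (simp add: power2_eq_square field_simps)
    have bound: "?N u / \<Psi> u \<le> ?g u" if u: "u > 0" "\<epsilon> * u / 2 \<ge> K" for u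
    proof -
      let ?l = "exp (- (C * u + L)\<^sup>2 / (2 * C))"
      have lpos: "c0 * ?l > 0" using p by simp
      have "?N u / \<Psi> u \<le> ?N u / (c0 * ?l)"
        by (rule divide_left_mono[OF lo]) (use u lpos less_le_trans[OF lpos lo[of u]] in auto)
      also have "\<dots> \<le> (exp (- (C * u * (1 + \<epsilon> / (2 * B)))\<^sup>2 / (2 * C)) + exp (- (C * u\<^sup>2) / 2) * exp (- \<alpha> * (\<epsilon> * u / 2)\<^sup>2)) / (c0 * ?l)"
        by (rule divide_right_mono[OF up[OF u(1) e u(2)] less_imp_le[OF lpos]])
      also have "\<dots> = ?g u"
      proof -
        have 1: "- (C * u * (1 + \<epsilon> / (2 * B)))\<^sup>2 / (2 * C) = (- b1 * u\<^sup>2 + L * u + L\<^sup>2 / (2 * C)) + - (C * u + L)\<^sup>2 / (2 * C)"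
        proof -
          have "(C * u * (1 + \<eta>))\<^sup>2 / (2 * C) = C * u\<^sup>2 / 2 + b1 * u\<^sup>2"
            using C by (simp add: b1_def power2_eq_square field_simps)
          then show ?thesis unfolding \<eta>_def[symmetric] divide_minus_left mult_minus_left E by (simp only:)
        qed
        have 2: "- (C * u\<^sup>2) / 2 + - \<alpha> * (\<epsilon> * u / 2)\<^sup>2 = (- b2 * u\<^sup>2 + L * u + L\<^sup>2 / (2 * C)) + - (C * u + L)\<^sup>2 / (2 * C)"
        proof -
          have "\<alpha> * (\<epsilon> * u / 2)\<^sup>2 = b2 * u\<^sup>2" by (simp add: b2_def power2_eq_square)
          then show ?thesis unfolding divide_minus_left mult_minus_left E by (simp only:)
        qed
        have r: "(x * l + y * l) / (c0 * l) = (x + y) / c0" if "l > 0" for x y l :: real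
          using that p by (simp add: distrib_right[symmetric])
        show ?thesis unfolding exp_add[symmetric] 1 2 unfolding exp_add[of _ "- (C * u + L)\<^sup>2 / (2 * C)"]
          by (rule r) simp
      qed
      finally show ?thesis .
    qed
    show ?thesis
    proof (rule tendsto_sandwich[OF _ _ tendsto_const g])
      show "eventually (\<lambda>u. 0 \<le> ?N u / \<Psi> u) at_top" by (simp add: Psi_def)
      show "eventually (\<lambda>u. ?N u / \<Psi> u \<le> ?g u) at_top"
        using eventually_gt_at_top[of "max 0 (2 * K / \<epsilon>)"]
      proof eventually_elim
        case (elim u)
        then have u: "u > 0" and "2 * K / \<epsilon> < u" by auto
        then have "\<epsilon> * u / 2 \<ge> K" using e by (simp add: pos_divide_less_eq mult.commute)
        then show ?case by (rule bound[OF u])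
      qed
    qed
  qed
qed

lemma log_asymptotics: "((\<lambda>u. eln (\<Psi> u) / ereal (u\<^sup>2)) \<longlongrightarrow> - \<C> / 2) at_top"
proof -
  obtain \<mu> where mu: "\<mu> \<in> \<W>" using W_set_nonempty by blast
  have m: "\<mu> \<in> M1_01" using mu by (simp add: W_set_def)
  show ?thesis
  proof (cases "\<Q> \<mu> > 0")
    case True
    define C where "C = 1 / \<Q> \<mu>"
    have C: "C > 0" using True by (simp add: C_def)
    have "((\<lambda>u. eln (\<Psi> u) / ereal (u\<^sup>2)) \<longlongrightarrow> ereal (- C / 2)) at_top"
    proof (rule exceedance_bounds[OF mu True, folded C_def])
      fix L c0 :: real
      assume c0: "c0 > 0"
        and up: "\<And>u. u \<ge> 0 \<Longrightarrow> \<Psi> u \<le> exp (- (C * u\<^sup>2) / 2)"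
        and lo: "\<And>u. u \<ge> 0 \<Longrightarrow> c0 * exp (- (C * u + L)\<^sup>2 / (2 * C)) \<le> \<Psi> u"
      show ?thesis by (rule eln_quadratic_limit[OF C c0 lo up])
    qed
    moreover have "- \<C> / 2 = ereal (- C / 2)"
      unfolding CX_value[OF mu True] C_def[symmetric] by (simp add: divide_ereal_def)
    ultimately show ?thesis by (simp only:)
  next
    case False
    \<comment> \<open>Infeasible case: the infimum over the empty set is infinite, and for u > 0 the
      probability is 0, so \<open>eln\<close> makes the quotient constantly minus infinity.\<close>
    then have q: "\<Q> \<mu> = 0" using quad_form_nonneg[OF m] by simp
    have "\<not> (\<exists>H. feasible H)" using feasible_iff[OF mu] False by blast
    then have "{ereal (integral\<^sup>L M (\<lambda>\<omega>. (H \<omega>)\<^sup>2)) | H. feasible H} = {}" by blast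
    then have "\<C> = \<infinity>" unfolding CX_eq by (simp add: top_ereal_def)
    then have t: "- \<C> / 2 = - \<infinity>" by (simp add: divide_ereal_def)
    have "eventually (\<lambda>u. - \<infinity> = eln (\<Psi> u) / ereal (u\<^sup>2)) at_top"
      using eventually_gt_at_top[of 0]
    proof eventually_elim
      case (elim u)
      then show ?case using Psi_zero[OF m q elim] by (simp add: eln_def divide_ereal_def)
    qed
    then show ?thesis unfolding t by (rule Lim_transform_eventually[OF tendsto_const])
  qed
qed

end

theorem theorem4p1:
  fixes M :: "'a measure" and X :: "'d::euclidean_space \<Rightarrow> 'a \<Rightarrow> real"
    and T :: "'d set" and \<xi> :: "real \<Rightarrow> 'd" and a b :: 'd
  assumes "compact T"
    and "centered_gaussian_field M X T"
    and "\<forall>\<omega>\<in>space M. continuous_on T (\<lambda>t. X t \<omega>)"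
    and "continuous_on {0..1} \<xi>" and "\<xi> ` {0..1} \<subseteq> T"
    and "\<xi> 0 = a" and "\<xi> 1 = b"
  shows
    \<comment> \<open>(i)\<close>
    "((\<lambda>u. eln (Psi M X \<xi> u) / ereal (u\<^sup>2)) \<longlongrightarrow> - CX M X T \<xi> / 2) at_top
    \<comment> \<open>(ii)\<close>
    \<and> CX M X T \<xi> = Inf {ereal (integral\<^sup>L M (\<lambda>\<omega>. (H \<omega>)\<^sup>2)) | H. feasible2 M X T \<xi> H}
    \<and> ((\<exists>H. feasible2 M X T \<xi> H) \<longrightarrow>
        (\<exists>H. feasible2 M X T \<xi> H \<and>
             ereal (integral\<^sup>L M (\<lambda>\<omega>. (H \<omega>)\<^sup>2)) = CX M X T \<xi> \<and>
             (\<forall>H'. feasible2 M X T \<xi> H' \<and>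
                   ereal (integral\<^sup>L M (\<lambda>\<omega>. (H' \<omega>)\<^sup>2)) = CX M X T \<xi> \<longrightarrow>
                   (AE \<omega> in M. H' \<omega> = H \<omega>))))
    \<comment> \<open>(iii)\<close>
    \<and> W_set M X \<xi> \<noteq> {}
    \<and> compactin weak_top (W_set M X \<xi>)
    \<and> measure_convex (W_set M X \<xi>)
    \<and> (\<forall>H. feasible2 M X T \<xi> H \<and> ereal (integral\<^sup>L M (\<lambda>\<omega>. (H \<omega>)\<^sup>2)) = CX M X T \<xi> \<longrightarrow>
         (\<forall>\<mu>\<in>W_set M X \<xi>. emeasure \<mu> {v\<in>{0..1}. wH M X H (\<xi> v) > 1} = 0))
    \<comment> \<open>(iv)\<close>
    \<and> (\<forall>H. feasible2 M X T \<xi> H \<and> ereal (integral\<^sup>L M (\<lambda>\<omega>. (H \<omega>)\<^sup>2)) = CX M X T \<xi> \<longrightarrow>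
         (\<forall>\<epsilon>>0. ((\<lambda>u.
            measure M {\<omega>\<in>space M.
               (SUP v\<in>{0..1}. \<bar>X (\<xi> v) \<omega> / u - wH M X H (\<xi> v)\<bar>) \<ge> \<epsilon> \<and>
               (\<forall>v\<in>{0..1}. X (\<xi> v) \<omega> > u)}
            / Psi M X \<xi> u) \<longlongrightarrow> 0) at_top))"
proof -
  interpret gauss_path M X T \<xi> by unfold_locales (use assms in auto)
  obtain \<mu> where mu: "\<mu> \<in> W_set M X \<xi>" using W_set_nonempty by blast
  have opt: "feasible2 M X T \<xi> (Hopt \<mu>)" "ereal (\<integral>\<omega>. (Hopt \<mu> \<omega>)\<^sup>2 \<partial>M) = CX M X T \<xi>"
    if "\<exists>H. feasible2 M X T \<xi> H"
  proof -
    have q: "quad_form M X \<xi> \<mu> > 0" using feasible_iff[OF mu] that by blast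
    show "feasible2 M X T \<xi> (Hopt \<mu>)" by (rule Hopt_props(1)[OF mu q])
    show "ereal (\<integral>\<omega>. (Hopt \<mu> \<omega>)\<^sup>2 \<partial>M) = CX M X T \<xi>"
      unfolding CX_value[OF mu q] Hopt_props(2)[OF mu q] ..
  qed
  have iv: "((\<lambda>u. measure M {\<omega>\<in>space M. (SUP v\<in>{0..1}. \<bar>X (\<xi> v) \<omega> / u - wH M X H (\<xi> v)\<bar>) \<ge> \<epsilon> \<and> (\<forall>v\<in>{0..1}. X (\<xi> v) \<omega> > u)}
      / Psi M X \<xi> u) \<longlongrightarrow> 0) at_top"
    if H: "feasible2 M X T \<xi> H" "ereal (\<integral>\<omega>. (H \<omega>)\<^sup>2 \<partial>M) = CX M X T \<xi>" and e: "\<epsilon> > 0" for H \<epsilon>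
  proof -
    have ex: "\<exists>H. feasible2 M X T \<xi> H" using H by blast
    have q: "quad_form M X \<xi> \<mu> > 0" using feasible_iff[OF mu] ex by blast
    \<comment> \<open>An arbitrary optimum agrees almost surely with \<open>Hopt \<mu>\<close>; its
      pairings along the path are the same, so the limit transfers.\<close>
    have "AE \<omega> in M. H \<omega> = Hopt \<mu> \<omega>" by (rule optimal_unique[OF opt[OF ex] H])
    then have w: "wH M X H (\<xi> v) = wH M X (Hopt \<mu>) (\<xi> v)" if "v \<in> {0..1}" for v
      by (rule wH_cong_AE[OF _ _ _ that])
        (use H opt[OF ex] L_measurable in \<open>auto simp: feasible2_def\<close>)
    have "(SUP v\<in>{0..1}. \<bar>X (\<xi> v) \<omega> / u - wH M X H (\<xi> v)\<bar>) = (SUP v\<in>{0..1}. \<bar>X (\<xi> v) \<omega> / u - wH M X (Hopt \<mu>) (\<xi> v)\<bar>)" for u \<omega>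
      by (rule SUP_cong[OF refl]) (simp only: w)
    then show ?thesis using conditional_limit[OF mu q e] by (simp only:)
  qed
  show ?thesis
  proof (intro conjI)
    show "(\<exists>H. feasible2 M X T \<xi> H) \<longrightarrow>
        (\<exists>H. feasible2 M X T \<xi> H \<and>
             ereal (integral\<^sup>L M (\<lambda>\<omega>. (H \<omega>)\<^sup>2)) = CX M X T \<xi> \<and>
             (\<forall>H'. feasible2 M X T \<xi> H' \<and>
                   ereal (integral\<^sup>L M (\<lambda>\<omega>. (H' \<omega>)\<^sup>2)) = CX M X T \<xi> \<longrightarrow>
                   (AE \<omega> in M. H' \<omega> = H \<omega>)))"
    proof (intro impI exI[of _ "Hopt \<mu>"] conjI allI)
      assume ex: "\<exists>H. feasible2 M X T \<xi> H"
      show "feasible2 M X T \<xi> (Hopt \<mu>)" "ereal (\<integral>\<omega>. (Hopt \<mu> \<omega>)\<^sup>2 \<partial>M) = CX M X T \<xi>" by (rule opt[OF ex])+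
      fix H' assume H': "feasible2 M X T \<xi> H' \<and> ereal (\<integral>\<omega>. (H' \<omega>)\<^sup>2 \<partial>M) = CX M X T \<xi>"
      show "AE \<omega> in M. H' \<omega> = Hopt \<mu> \<omega>"
        by (rule optimal_unique[OF opt[OF ex] conjunct1[OF H'] conjunct2[OF H']])
    qed
  qed (use log_asymptotics CX_eq W_set_nonempty W_set_compact W_set_convex optimal_support iv in blast)+
qed

end
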